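(* Let $J=(J_1,J_2)$, where $J_i:U_i\to Y_i$ is a holomorphic solution of the Schwarzian equation $$S_{t_i}(y_i)+\left(\frac{d y_i}{d t_i}\right)^2R_i(y_i)=0\qquad(i=1,2),$$ and assume that both $R_1$ and $R_2$ satisfy the Riccati hypothesis. If $\mathcal{C}\subset\mathbb{C}^2$ is a bi-algebraic curve with respect to $J$ which is neither vertical nor horizontal, then $\mathcal{C}$ is the graph of a homography, i.e. there are $a,b,c,d\in\mathbb{C}$ with $ad-bc\neq0$ such that $\mathcal{C}$ is the set of $(t_1,t_2)\in\mathbb{C}^2$ with $t_2=\frac{at_1+b}{ct_1+d}$.
   Context: $Y_1,Y_2$ are hyperbolic algebraic curves over $\mathbb{C}$ of genus zero (each is $\mathbb{CP}^1$ minus a finite set of at least $3$ points), with affine coordinates $y_1,y_2$, and $R_1\in\mathbb{C}(y_1)$, $R_2\in\mathbb{C}(y_2)$ are rational functions. $S_t(y)=\left(\frac{y''}{y'}\right)'-\frac12\left(\frac{y''}{y'}\right)^2$ with $'=\frac{d}{dt}$ is the Schwarzian derivative. $U_1,U_2\subset\mathbb{C}$ are domains, and $J:U_1\times U_2\to Y_1\times Y_2$ is $J(t_1,t_2)=(J_1(t_1),J_2(t_2))$ (the solutions $J_i$ are nonconstant). Algebraic curves are irreducible. An algebraic curve $\mathcal{C}\subset\mathbb{C}^2$ is bi-algebraic with respect to $J$ if the Zariski closure of $J(\mathcal{C}\cap(U_1\times U_2))$ is an algebraic curve in $Y_1\times Y_2$. Vertical and horizontal curves are those of the form $\{b\}\times\mathbb{C}$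 and $\mathbb{C}\times\{b\}$, $b\in\mathbb{C}$. A rational function $R$ satisfies the Riccati hypothesis if the equation $\frac{du}{dy}+u^2+\frac12R(y)=0$ has no solutions in $\mathbb{C}(y)^{alg}$. *)

theory Defs
  imports
    "HOL-Algebra.Algebraic_Closure_Type"
    "HOL-Complex_Analysis.Complex_Analysis"
    "HOL-Computational_Algebra.Computational_Algebra"
begin

section \<open>Zariski topologies, irreducible closed sets and algebraic curves\<close>

definition irreducible_closed :: "'a topology \<Rightarrow> 'a set \<Rightarrow> bool" where
  "irreducible_closed T Z \<longleftrightarrow> closedin T Z \<and> Z \<noteq> {} \<and>
     (\<forall>A B. closedin T A \<and> closedin T B \<and> Z = A \<union> B \<longrightarrow> Z = A \<or> Z = B)"

definition irreducible_chain :: "'a topology \<Rightarrow> 'a set \<Rightarrow> nat \<Rightarrow> (nat \<Rightarrow> 'a set) \<Rightarrow> bool" where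
  "irreducible_chain T Z n c \<longleftrightarrow>
     (\<forall>i\<le>n. irreducible_closed T (c i) \<and> c i \<subseteq> Z) \<and> (\<forall>i<n. c i \<subset> c (Suc i))"

text \<open>Krull dimension: the maximal \<open>n\<close> admitting a chain
  \<open>Z\<^sub>0 \<subset> \<dots> \<subset> Z\<^sub>n\<close> of irreducible closed subsets.\<close>

definition has_krull_dim :: "'a topology \<Rightarrow> 'a set \<Rightarrow> nat \<Rightarrow> bool" where
  "has_krull_dim T Z n \<longleftrightarrow>
     (\<exists>c. irreducible_chain T Z n c) \<and> (\<nexists>c. irreducible_chain T Z (Suc n) c)"

text \<open>Algebraic curves are irreducible by convention.\<close>

definition algebraic_curve :: "'a topology \<Rightarrow> 'a set \<Rightarrow> bool" where
  "algebraic_curve T Z \<longleftrightarrow> irreducible_closed T Z \<and> has_krull_dim T Z 1"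

text \<open>The complements of the zero loci of single polynomials form a basis of the Zariski
  topology; a polynomial in two variables \<open>x, y\<close> is an element of \<open>\<complex>[x][y]\<close>.\<close>

definition zariski_plane :: "(complex \<times> complex) topology" where
  "zariski_plane = topology_generated_by
     {{(x, y). poly (poly F [:y:]) x \<noteq> 0} | F :: complex poly poly. True}"


section \<open>The projective line\<close>

datatype cp1 = Fin complex | Infty

fun affine_coord :: "cp1 \<Rightarrow> complex" where
  "affine_coord (Fin z) = z"
| "affine_coord Infty = 0"

text \<open>Homogeneous coordinates \<open>[Y : W]\<close> with affine coordinate \<open>y = Y / W\<close>.\<close>

fun hom_coords :: "cp1 \<Rightarrow> complex \<times> complex" where
  "hom_coords (Fin z) = (z, 1)"
| "hom_coords Infty = (1, 0)"

text \<open>Value, at the above representatives, of the bihomogeneous polynomial of bidegree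
  \<open>(m, n)\<close> with coefficients \<open>a\<close>; whether it vanishes does not depend on the representatives.\<close>

definition bihom_eval ::
  "nat \<Rightarrow> nat \<Rightarrow> (nat \<Rightarrow> nat \<Rightarrow> complex) \<Rightarrow> cp1 \<times> cp1 \<Rightarrow> complex" where
  "bihom_eval m n a = (\<lambda>(p, q).
     let (Y1, W1) = hom_coords p; (Y2, W2) = hom_coords q in
     \<Sum>i\<le>m. \<Sum>j\<le>n. a i j * Y1 ^ i * W1 ^ (m - i) * Y2 ^ j * W2 ^ (n - j))"

definition zariski_cp1_cp1 :: "(cp1 \<times> cp1) topology" where
  "zariski_cp1_cp1 = topology_generated_by {{p. bihom_eval m n a p \<noteq> 0} | m n a. True}"

definition hyperbolic_genus_zero :: "cp1 set \<Rightarrow> bool" where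
  "hyperbolic_genus_zero Y \<longleftrightarrow> finite (- Y) \<and> card (- Y) \<ge> 3"

definition inv_chart :: "complex \<Rightarrow> cp1" where
  "inv_chart w = (if w = 0 then Infty else Fin (1 / w))"

definition holomorphic_to_cp1 :: "(complex \<Rightarrow> cp1) \<Rightarrow> complex set \<Rightarrow> bool" where
  "holomorphic_to_cp1 f U \<longleftrightarrow>
     (\<forall>t\<in>U. \<exists>V g. open V \<and> t \<in> V \<and> V \<subseteq> U \<and> g holomorphic_on V \<and>
        ((\<forall>s\<in>V. f s = Fin (g s)) \<or> (\<forall>s\<in>V. f s = inv_chart (g s))))"


section \<open>Schwarzian equations\<close>

type_synonym ratfun = "complex poly fract"

definition ratfun_pole :: "ratfun \<Rightarrow> complex \<Rightarrow> bool" where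
  "ratfun_pole R z \<longleftrightarrow> poly (snd (quot_of_fract R)) z = 0"

definition ratfun_eval :: "ratfun \<Rightarrow> complex \<Rightarrow> complex" where
  "ratfun_eval R z = poly (fst (quot_of_fract R)) z / poly (snd (quot_of_fract R)) z"

definition schwarzian :: "(complex \<Rightarrow> complex) \<Rightarrow> complex \<Rightarrow> complex" where
  "schwarzian y t = deriv (\<lambda>s. deriv (deriv y) s / deriv y s) t
     - 1/2 * (deriv (deriv y) t / deriv y t)\<^sup>2"

text \<open>The equation is an identity of meromorphic functions: it is required at the points where
  all its terms are defined. For nonconstant \<open>J\<close> on a domain, the other points (those where
  \<open>J\<close> is infinite, is ramified, or meets a pole of \<open>R\<close>) are isolated.\<close>

definition schwarzian_solution ::
  "ratfun \<Rightarrow> (complex \<Rightarrow> cp1) \<Rightarrow> complex set \<Rightarrow> cp1 set \<Rightarrow> bool" where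
  "schwarzian_solution R J U Y \<longleftrightarrow>
     holomorphic_to_cp1 J U \<and> J ` U \<subseteq> Y \<and>
     (let y = affine_coord \<circ> J in
      \<forall>t\<in>U. J t \<noteq> Infty \<and> deriv y t \<noteq> 0 \<and> \<not> ratfun_pole R (y t) \<longrightarrow>
        schwarzian y t + (deriv y t)\<^sup>2 * ratfun_eval R (y t) = 0)"


section \<open>The derivation on the algebraic closure of the rational functions\<close>

text \<open>Derivations of \<open>\<complex>(y)\<^sup>a\<^sup>l\<^sup>g\<close> that extend \<open>d/dy\<close>; on \<open>\<complex>(y)\<close> it suffices to
  prescribe them on polynomials.\<close>

definition extends_ddy :: "(ratfun alg_closure \<Rightarrow> ratfun alg_closure) \<Rightarrow> bool" where
  "extends_ddy D \<longleftrightarrow>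
     (\<forall>u v. D (u + v) = D u + D v) \<and>
     (\<forall>u v. D (u * v) = D u * v + u * D v) \<and>
     (\<forall>p. D (to_ac (to_fract p)) = to_ac (to_fract (pderiv p)))"

instance fract :: ("{idom, ring_char_0}") field_char_0
proof
  show "inj (of_nat :: nat \<Rightarrow> 'a fract)"
    by (rule injI) (simp add: of_nat_fract eq_fract)
qed

subsection \<open>Existence and uniqueness\<close>

definition coeffs_in :: "'a::field_char_0 set \<Rightarrow> 'a poly \<Rightarrow> bool" where
  "coeffs_in F p \<longleftrightarrow> (\<forall>i. coeff p i \<in> F)"

definition subfield_deriv :: "'a::field_char_0 set \<Rightarrow> ('a \<Rightarrow> 'a) \<Rightarrow> bool" where
  "subfield_deriv F d \<longleftrightarrow> 1 \<in> F \<and> (\<forall>x\<in>F. \<forall>y\<in>F. x - y \<in> F \<and> x * y \<in> F) \<and>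
     (\<forall>x\<in>F. inverse x \<in> F) \<and>
     (\<forall>x\<in>F. \<forall>y\<in>F. d (x + y) = d x + d y \<and> d (x * y) = d x * y + x * d y)"

context
  fixes F :: "'a::field_char_0 set" and d :: "'a \<Rightarrow> 'a"
  assumes F: "subfield_deriv F d"
begin

lemma F_basic: "0 \<in> F" "1 \<in> F" "x \<in> F \<Longrightarrow> y \<in> F \<Longrightarrow> x - y \<in> F"
  "x \<in> F \<Longrightarrow> y \<in> F \<Longrightarrow> x * y \<in> F" "x \<in> F \<Longrightarrow> inverse x \<in> F"
proof -
  show *: "1 \<in> F" "x \<in> F \<Longrightarrow> y \<in> F \<Longrightarrow> x - y \<in> F"
   "x \<in> F \<Longrightarrow> y \<in> F \<Longrightarrow> x * y \<in> F" "x \<in> F \<Longrightarrow> inverse x \<in> F" for x y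
    using F by (auto simp: subfield_deriv_def)
  show "0 \<in> F" using *(2)[OF *(1) *(1)] by simp
qed

lemma F_more: "x \<in> F \<Longrightarrow> - x \<in> F" "x \<in> F \<Longrightarrow> y \<in> F \<Longrightarrow> x + y \<in> F"
  "x \<in> F \<Longrightarrow> y \<in> F \<Longrightarrow> x / y \<in> F"
proof -
  show m: "- x \<in> F" if "x \<in> F" for x using F_basic(3)[OF F_basic(1) that] by simp
  show "x \<in> F \<Longrightarrow> y \<in> F \<Longrightarrow> x + y \<in> F" using F_basic(3)[of x "-y"] m by simp
  show "x \<in> F \<Longrightarrow> y \<in> F \<Longrightarrow> x / y \<in> F"
    using F_basic(4)[of x "inverse y"] F_basic(5) by (simp add: divide_inverse)
qed

lemma F_nat: "of_nat n \<in> F"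
  by (induction n) (auto intro: F_basic F_more)

lemma F_sum: "(\<And>i. i \<in> A \<Longrightarrow> f i \<in> F) \<Longrightarrow> sum f A \<in> F"
  by (induction A rule: infinite_finite_induct) (auto intro: F_basic F_more)

lemma d_add: "x \<in> F \<Longrightarrow> y \<in> F \<Longrightarrow> d (x + y) = d x + d y"
  and d_mult: "x \<in> F \<Longrightarrow> y \<in> F \<Longrightarrow> d (x * y) = d x * y + x * d y"
  using F by (auto simp: subfield_deriv_def)

lemma d_0: "d 0 = 0" using d_add[of 0 0] F_basic by simp

lemma d_1: "d 1 = 0" using d_mult[of 1 1] F_basic by simp

lemma d_sum: "(\<And>i. i \<in> A \<Longrightarrow> f i \<in> F) \<Longrightarrow> d (sum f A) = (\<Sum>i\<in>A. d (f i))"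
  by (induction A rule: infinite_finite_induct) (auto simp: d_0 d_add F_sum)

lemma ci_add: "coeffs_in F p \<Longrightarrow> coeffs_in F q \<Longrightarrow> coeffs_in F (p + q)"
  and ci_diff: "coeffs_in F p \<Longrightarrow> coeffs_in F q \<Longrightarrow> coeffs_in F (p - q)"
  and ci_mult: "coeffs_in F p \<Longrightarrow> coeffs_in F q \<Longrightarrow> coeffs_in F (p * q)"
  and ci_pderiv: "coeffs_in F p \<Longrightarrow> coeffs_in F (pderiv p)"
  by (auto simp: coeffs_in_def coeff_mult coeff_pderiv simp del: of_nat_Suc
      intro!: F_sum F_basic F_more F_nat)

lemma ci_pCons: "coeffs_in F (pCons a p) \<longleftrightarrow> a \<in> F \<and> coeffs_in F p"
  by (auto simp: coeffs_in_def coeff_pCons split: nat.splits)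

lemma ci_0: "coeffs_in F 0" by (simp add: coeffs_in_def F_basic)

lemma ci_monom: "a \<in> F \<Longrightarrow> coeffs_in F (monom a n)"
  by (simp add: coeffs_in_def F_basic)

lemma ci_smult: "a \<in> F \<Longrightarrow> coeffs_in F p \<Longrightarrow> coeffs_in F (smult a p)"
  by (simp add: coeffs_in_def F_basic)

lemma ci_pcompose: "coeffs_in F p \<Longrightarrow> coeffs_in F q \<Longrightarrow> coeffs_in F (pcompose p q)"
  by (induction p) (auto simp: ci_pCons ci_0 pcompose_pCons intro!: ci_add ci_mult)

lemma md_add: "coeffs_in F p \<Longrightarrow> coeffs_in F q \<Longrightarrow>
    map_poly d (p + q) = map_poly d p + map_poly d q"
  by (rule poly_eqI) (auto simp: coeff_map_poly d_0 coeffs_in_def d_add)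

lemma md_mult: "coeffs_in F p \<Longrightarrow> coeffs_in F q \<Longrightarrow>
    map_poly d (p * q) = map_poly d p * q + p * map_poly d q"
  by (rule poly_eqI)
    (auto simp: coeff_map_poly d_0 coeffs_in_def d_mult coeff_mult d_sum F_basic sum.distrib)

lemma d_poly: "coeffs_in F p \<Longrightarrow> x \<in> F \<Longrightarrow>
    poly p x \<in> F \<and> d (poly p x) = poly (map_poly d p) x + poly (pderiv p) x * d x"
proof (induction p)
  case (pCons a p)
  then show ?case
    by (auto simp: ci_pCons d_add d_mult d_0 map_poly_pCons pderiv_pCons F_basic F_more algebra_simps)
qed (auto simp: d_0 F_basic)

text \<open>Extension of the derivation to \<open>F(v)\<close>.\<close>

context
  fixes v :: 'a
  assumes alg: "\<And>x. \<exists>p. p \<noteq> 0 \<and> coeffs_in F p \<and> poly p x = 0"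
begin

lemma implicit_diff:
  "\<exists>m. coeffs_in F m \<and> poly m v = 0 \<and> poly (pderiv m) v \<noteq> 0 \<and>
     (\<forall>e. poly (map_poly d m) v + poly (pderiv m) v * e = 0 \<longrightarrow>
      (\<forall>p. coeffs_in F p \<and> poly p v = 0 \<longrightarrow> poly (map_poly d p) v + poly (pderiv p) v * e = 0))"
proof -
  let ?P = "\<lambda>p. p \<noteq> 0 \<and> coeffs_in F p \<and> poly p v = 0"
  obtain m where m: "?P m" and min: "\<And>p. ?P p \<Longrightarrow> degree m \<le> degree p"
    using alg[of v] ex_has_least_nat[of ?P _ degree] by blast
  have deg: "degree m > 0"
  proof (rule ccontr)
    assume "\<not> degree m > 0"
    then obtain c where "m = [:c:]" by (metis degree_eq_zeroE gr0I)
    then show False using m by auto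
  qed
  have pd: "poly (pderiv m) v \<noteq> 0"
  proof
    assume "poly (pderiv m) v = 0"
    moreover have "pderiv m \<noteq> 0" using deg by (simp add: pderiv_eq_0_iff)
    ultimately have "degree m \<le> degree (pderiv m)"
      using min m ci_pderiv by blast
    then show False using deg by (simp add: degree_pderiv)
  qed
  have good: "poly (map_poly d p) v + poly (pderiv p) v * e = 0"
    if e: "poly (map_poly d m) v + poly (pderiv m) v * e = 0"
      and p: "coeffs_in F p" "poly p v = 0" for p e
    using p
  proof (induction "degree p" arbitrary: p rule: less_induct)
    case less
    show ?case
    proof (cases "p = 0")
      case False
      then have le: "degree m \<le> degree p" using min less.prems by blast
      define c where "c = monom (lead_coeff p / lead_coeff m) (degree p - degree m)"
      define r where "r = p - c * m"
      have c0: "coeffs_in F c"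
        unfolding c_def using less.prems m by (intro ci_monom F_more) (auto simp: coeffs_in_def)
      have cm: "coeffs_in F (c * m)" using c0 m ci_mult by blast
      have r: "coeffs_in F r" "poly r v = 0"
        using less.prems cm m by (auto simp: r_def intro: ci_diff)
      have p_eq: "p = r + c * m" by (simp add: r_def)
      have good_r: "poly (map_poly d r) v + poly (pderiv r) v * e = 0"
      proof (cases "r = 0")
        case False
        have "lead_coeff p / lead_coeff m \<noteq> 0" using \<open>p \<noteq> 0\<close> m by simp
        then have "degree (c * m) = degree p" "lead_coeff (c * m) = lead_coeff p"
          using le m unfolding lead_coeff_mult
          by (auto simp: c_def degree_mult_eq degree_monom_eq monom_eq_0_iff)
        then have "coeff r (degree p) = 0" "degree r \<le> degree p"
          by (auto simp: r_def intro: degree_diff_le)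
        then have "degree r < degree p"
          using False by (metis le_neq_implies_less leading_coeff_0_iff)
        then show ?thesis using less.hyps r by blast
      qed simp
      have "poly (map_poly d p) v + poly (pderiv p) v * e
        = (poly (map_poly d r) v + poly (pderiv r) v * e)
          + poly c v * (poly (map_poly d m) v + poly (pderiv m) v * e)"
        using m by (simp add: p_eq md_add[OF r(1) cm] md_mult[OF c0] pderiv_add pderiv_mult
            algebra_simps)
      then show ?thesis using e good_r by simp
    qed simp
  qed
  show ?thesis using m pd good by blast
qed

lemma extend_deriv:
  "\<exists>F' d'. subfield_deriv F' d' \<and> F \<subseteq> F' \<and> v \<in> F' \<and> (\<forall>x\<in>F. d' x = d x)"
proof -
  obtain m where m: "coeffs_in F m" "poly m v = 0" "poly (pderiv m) v \<noteq> 0"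
    and good: "\<And>e p. poly (map_poly d m) v + poly (pderiv m) v * e = 0 \<Longrightarrow>
       coeffs_in F p \<Longrightarrow> poly p v = 0 \<Longrightarrow> poly (map_poly d p) v + poly (pderiv p) v * e = 0"
    using implicit_diff by blast
  define e where "e = - poly (map_poly d m) v / poly (pderiv m) v"
  have e: "poly (map_poly d m) v + poly (pderiv m) v * e = 0"
    using m by (simp add: e_def)
  define T where "T p = poly (map_poly d p) v + poly (pderiv p) v * e" for p
  define F' where "F' = {poly p v | p. coeffs_in F p}"
  define d' where "d' w = T (SOME p. coeffs_in F p \<and> poly p v = w)" for w
  have T_add: "T (p + q) = T p + T q" if "coeffs_in F p" "coeffs_in F q" for p q
    using that by (simp add: T_def md_add pderiv_add algebra_simps)
  have T_mult: "T (p * q) = T p * poly q v + poly p v * T q"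
    if "coeffs_in F p" "coeffs_in F q" for p q
    using that by (simp add: T_def md_mult pderiv_mult algebra_simps)
  have T_eq: "T p = T q" if "coeffs_in F p" "coeffs_in F q" "poly p v = poly q v" for p q
  proof -
    have "T (p - q) = 0" unfolding T_def using good[OF e, of "p - q"] that ci_diff by simp
    then show ?thesis using T_add[of "p - q" q] that ci_diff by simp
  qed
  have d': "d' (poly p v) = T p" if "coeffs_in F p" for p
    unfolding d'_def using someI[of "\<lambda>q. coeffs_in F q \<and> poly q v = poly p v" p] that
    by (intro T_eq) auto
  have FF: "F \<subseteq> F'"
  proof
    fix x assume "x \<in> F"
    then show "x \<in> F'" unfolding F'_def
      by (intro CollectI exI[of _ "[:x:]"]) (auto simp: ci_pCons ci_0)
  qed
  have vF: "v \<in> F'"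
    unfolding F'_def by (intro CollectI exI[of _ "[:0, 1:]"]) (auto simp: ci_pCons ci_0 F_basic)
  have dd: "d' x = d x" if "x \<in> F" for x
    using d'[of "[:x:]"] that by (simp add: T_def ci_pCons ci_0 map_poly_pCons d_0)
  have inv: "inverse w \<in> F'" if w: "w \<in> F'" for w
  proof (cases "w = 0")
    case False
    let ?P = "\<lambda>p. p \<noteq> 0 \<and> coeffs_in F p \<and> poly p w = 0"
    obtain q where q: "?P q" and min: "\<And>p. ?P p \<Longrightarrow> degree q \<le> degree p"
      using alg[of w] ex_has_least_nat[of ?P _ degree] by blast
    obtain a q' where qq: "q = pCons a q'" by (cases q)
    have a: "a \<noteq> 0"
    proof
      assume "a = 0"
      then have "?P q'" using q qq False by (auto simp: ci_pCons)
      then show False using min[of q'] qq by simp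
    qed
    obtain p where p: "coeffs_in F p" "w = poly p v" using w by (auto simp: F'_def)
    have "a + w * poly q' w = 0" using q qq by simp
    then have "inverse w = (- inverse a) * poly q' w"
      using a False by (auto simp: field_simps add_eq_0_iff)
    also have "\<dots> = poly (smult (- inverse a) (pcompose q' p)) v"
      using p by (simp add: poly_pcompose)
    finally have "inverse w = poly (smult (- inverse a) (pcompose q' p)) v" .
    moreover have "coeffs_in F (smult (- inverse a) (pcompose q' p))"
      using q qq p by (intro ci_smult ci_pcompose F_more F_basic) (auto simp: ci_pCons)
    ultimately show ?thesis unfolding F'_def by blast
  qed (use w in simp)
  have "subfield_deriv F' d'"
    unfolding subfield_deriv_def
  proof (intro conjI ballI)
    show "1 \<in> F'" using FF F_basic by blast
    show "inverse x \<in> F'" if "x \<in> F'" for x using inv that .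
    fix x y assume "x \<in> F'" "y \<in> F'"
    then obtain p q where pq: "coeffs_in F p" "coeffs_in F q" "x = poly p v" "y = poly q v"
      by (auto simp: F'_def)
    show "x - y \<in> F'" unfolding F'_def using pq ci_diff
      by (intro CollectI exI[of _ "p - q"]) auto
    show "x * y \<in> F'" unfolding F'_def using pq ci_mult
      by (intro CollectI exI[of _ "p * q"]) auto
    show "d' (x + y) = d' x + d' y"
      using pq d'[of "p + q"] d'[of p] d'[of q] by (simp add: T_add ci_add)
    show "d' (x * y) = d' x * y + x * d' y"
      using pq d'[of "p * q"] d'[of p] d'[of q] by (simp add: T_mult ci_mult)
  qed
  then show ?thesis using FF vF dd by blast
qed

end

end

lemma deriv_unique:
  assumes F: "subfield_deriv F d"
    and alg: "\<And>x. \<exists>p. p \<noteq> 0 \<and> coeffs_in F p \<and> poly p x = 0"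
    and "subfield_deriv G1 d1" "F \<subseteq> G1" "v \<in> G1" "\<And>x. x \<in> F \<Longrightarrow> d1 x = d x"
    and "subfield_deriv G2 d2" "F \<subseteq> G2" "v \<in> G2" "\<And>x. x \<in> F \<Longrightarrow> d2 x = d x"
  shows "d1 v = d2 v"
proof -
  obtain m where m: "coeffs_in F m" "poly m v = 0" "poly (pderiv m) v \<noteq> 0"
    using implicit_diff[OF F alg] by blast
  have *: "d' v = - poly (map_poly d m) v / poly (pderiv m) v"
    if G: "subfield_deriv G d'" "F \<subseteq> G" "v \<in> G" "\<And>x. x \<in> F \<Longrightarrow> d' x = d x" for G d'
  proof -
    have ciG: "coeffs_in G m" using m G by (auto simp: coeffs_in_def)
    have "d' 0 = 0" using G(4)[OF F_basic(1)[OF F]] d_0[OF F] by simp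
    then have "map_poly d' m = map_poly d m"
      using m G by (intro poly_eqI) (auto simp: coeff_map_poly d_0[OF F] coeffs_in_def)
    then have "0 = poly (map_poly d m) v + poly (pderiv m) v * d' v"
      using d_poly[OF G(1) ciG G(3)] m \<open>d' 0 = 0\<close> by simp
    then show ?thesis using m by (simp add: field_simps add_eq_0_iff)
  qed
  show ?thesis using *[OF assms(3-6)] *[OF assms(7-10)] by simp
qed

definition ratfun_deriv :: "ratfun \<Rightarrow> ratfun" where
  "ratfun_deriv r = (let (a, b) = quot_of_fract r in
     (to_fract (pderiv a) - r * to_fract (pderiv b)) / to_fract b)"

lemma to_fract_add': "to_fract (a + b) = to_fract a + to_fract b"
  and to_fract_mult': "to_fract (a * b) = to_fract a * to_fract b"
  by (simp_all add: to_fract_def)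

lemma ratfun_deriv_eq:
  assumes "r * to_fract b = to_fract a" "b \<noteq> 0"
  shows "ratfun_deriv r = (to_fract (pderiv a) - r * to_fract (pderiv b)) / to_fract b"
proof -
  obtain a' b' where q: "quot_of_fract r = (a', b')" by fastforce
  have b': "b' \<noteq> 0" using snd_quot_of_fract_nonzero[of r] q by simp
  have r: "r * to_fract b' = to_fract a'"
    using quot_to_fract_quot_of_fract[of r] q b'
    by (auto simp: quot_to_fract_def to_fract_def eq_fract)
  have "to_fract (a' * b) = to_fract (a * b')"
    unfolding to_fract_mult' by (simp flip: r assms(1))
  then have "a' * b = a * b'" by (simp add: to_fract_def eq_fract)
  from arg_cong[OF this, of "\<lambda>p. to_fract (pderiv p)"]
  have "(to_fract (pderiv a') - r * to_fract (pderiv b')) * to_fract b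
      = (to_fract (pderiv a) - r * to_fract (pderiv b)) * to_fract b'"
    unfolding pderiv_mult to_fract_add' to_fract_mult'
    by (simp flip: r assms(1) add: algebra_simps)
  then show ?thesis using assms b' q by (simp add: ratfun_deriv_def frac_eq_eq)
qed

lemma ratfun_repr:
  obtains a b :: "complex poly" where "r * to_fract b = to_fract a" "b \<noteq> 0"
  by (cases r) (auto simp: to_fract_def eq_fract)

lemma ratfun_deriv_add: "ratfun_deriv (r + s) = ratfun_deriv r + ratfun_deriv s"
  and ratfun_deriv_mult: "ratfun_deriv (r * s) = ratfun_deriv r * s + r * ratfun_deriv s"
proof -
  obtain a b where r: "r * to_fract b = to_fract a" "b \<noteq> 0" by (rule ratfun_repr)
  obtain c d where s: "s * to_fract d = to_fract c" "d \<noteq> 0" by (rule ratfun_repr)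
  have nz: "to_fract b \<noteq> 0" "to_fract d \<noteq> 0" "b * d \<noteq> 0" using r s by auto
  have sum: "(r + s) * to_fract (b * d) = to_fract (a * d + c * b)"
    unfolding to_fract_add' to_fract_mult' by (simp flip: r(1) s(1) add: algebra_simps)
  have prod: "(r * s) * to_fract (b * d) = to_fract (a * c)"
    unfolding to_fract_mult' by (simp flip: r(1) s(1) add: algebra_simps)
  show "ratfun_deriv (r + s) = ratfun_deriv r + ratfun_deriv s"
    unfolding ratfun_deriv_eq[OF sum nz(3)] ratfun_deriv_eq[OF r] ratfun_deriv_eq[OF s]
      pderiv_mult pderiv_add to_fract_add' to_fract_mult' r(1)[symmetric] s(1)[symmetric]
    using nz(1,2) by (simp add: field_simps)
  show "ratfun_deriv (r * s) = ratfun_deriv r * s + r * ratfun_deriv s"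
    unfolding ratfun_deriv_eq[OF prod nz(3)] ratfun_deriv_eq[OF r] ratfun_deriv_eq[OF s]
      pderiv_mult pderiv_add to_fract_add' to_fract_mult' r(1)[symmetric] s(1)[symmetric]
    using nz(1,2) by (simp add: field_simps)
qed

lemma ratfun_deriv_poly: "ratfun_deriv (to_fract p) = to_fract (pderiv p)"
  using ratfun_deriv_eq[of "to_fract p" 1 p] by (simp add: pderiv_1)

lemma extends_ddy_ratfun:
  assumes "extends_ddy D" shows "D (to_ac r) = to_ac (ratfun_deriv r)"
proof (cases r)
  case (Fract a b)
  have add: "D (u * v) = D u * v + u * D v" for u v using assms by (simp add: extends_ddy_def)
  have r: "r * to_fract b = to_fract a" using Fract by (simp add: to_fract_def eq_fract)
  have "to_ac (ratfun_deriv (r * to_fract b)) = D (to_ac (r * to_fract b))"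
    using assms by (simp only: r ratfun_deriv_poly) (simp add: extends_ddy_def)
  then have "to_ac (ratfun_deriv r) * to_ac (to_fract b) = D (to_ac r) * to_ac (to_fract b)"
    using assms by (simp add: ratfun_deriv_mult ratfun_deriv_poly add) (simp add: extends_ddy_def)
  moreover have "to_fract b \<noteq> 0" using Fract by simp
  ultimately show ?thesis by simp
qed

theorem extends_ddy_unique_existence: "\<exists>!D. extends_ddy D"
proof -
  let ?K = "range (to_ac :: ratfun \<Rightarrow> _)"
  define d where "d x = to_ac (ratfun_deriv (of_ac x))" for x :: "ratfun alg_closure"
  have d_to_ac: "d (to_ac r) = to_ac (ratfun_deriv r)" for r by (simp add: d_def)
  have K: "subfield_deriv ?K d"
    unfolding subfield_deriv_def
    by (auto simp: d_to_ac ratfun_deriv_add ratfun_deriv_mult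
        simp flip: to_ac_add to_ac_mult to_ac_diff to_ac_inverse to_ac_1)
  have alg: "\<exists>p. p \<noteq> 0 \<and> coeffs_in G p \<and> poly p x = 0" if "?K \<subseteq> G" for G x
  proof -
    obtain p where "p \<noteq> 0" "poly (map_poly to_ac p) x = 0"
      using alg_closure_algebraic[of x] by blast
    then show ?thesis using that
      by (intro exI[of _ "map_poly to_ac p"])
        (auto simp: coeffs_in_def coeff_map_poly map_poly_eq_0_iff poly_eq_iff)
  qed
  define ext where "ext G d' \<longleftrightarrow> subfield_deriv G d' \<and> ?K \<subseteq> G \<and> (\<forall>x\<in>?K. d' x = d x)"
    for G and d' :: "ratfun alg_closure \<Rightarrow> _"
  have uniq: "d1 v = d2 v" if "ext G1 d1" "v \<in> G1" "ext G2 d2" "v \<in> G2" for G1 d1 G2 d2 v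
    using deriv_unique[OF K alg[OF subset_refl], of G1 d1 v G2 d2] that unfolding ext_def by blast
  have ex: "\<exists>G d'. ext G d' \<and> u \<in> G \<and> v \<in> G" for u v
  proof -
    obtain G d1 where G: "subfield_deriv G d1" "?K \<subseteq> G" "u \<in> G" "\<And>x. x \<in> ?K \<Longrightarrow> d1 x = d x"
      using extend_deriv[OF K alg[OF subset_refl], of u] by blast
    obtain G' d2 where "subfield_deriv G' d2" "G \<subseteq> G'" "v \<in> G'" "\<And>x. x \<in> G \<Longrightarrow> d2 x = d1 x"
      using extend_deriv[OF G(1) alg[OF G(2)], of v] by blast
    then show ?thesis unfolding ext_def using G
      by (intro exI[of _ G'] exI[of _ d2]) (auto simp: subset_iff)
  qed
  define D where "D u = (SOME e. \<exists>G d'. ext G d' \<and> u \<in> G \<and> d' u = e)" for u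
  have D: "D u = d' u" if "ext G d'" "u \<in> G" for G d' u
  proof -
    have "\<exists>G d'. ext G d' \<and> u \<in> G \<and> d' u = D u"
      unfolding D_def by (rule someI_ex) (use that in blast)
    then show ?thesis using uniq that by metis
  qed
  have "ext ?K d" using K by (simp add: ext_def)
  then have "D (to_ac r) = to_ac (ratfun_deriv r)" for r
    using D[of ?K d] by (simp add: d_to_ac)
  moreover have "D (u + v) = D u + D v \<and> D (u * v) = D u * v + u * D v" for u v
  proof -
    obtain G d' where G: "ext G d'" "u \<in> G" "v \<in> G" using ex by blast
    then have sf: "subfield_deriv G d'" by (simp add: ext_def)
    show ?thesis
      using D[OF G(1)] G F_basic(4)[OF sf] F_more(2)[OF sf] d_add[OF sf] d_mult[OF sf] by simp
  qed
  ultimately have "extends_ddy D" by (simp add: extends_ddy_def ratfun_deriv_poly)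
  moreover have "D' = D" if "extends_ddy D'" for D'
  proof
    fix u
    have "ext UNIV D'"
      using that extends_ddy_ratfun[OF that]
      by (auto simp: ext_def subfield_deriv_def extends_ddy_def d_to_ac)
    then show "D' u = D u" using D by simp
  qed
  ultimately show ?thesis by blast
qed

subsection \<open>The Riccati hypothesis\<close>

definition ddy :: "ratfun alg_closure \<Rightarrow> ratfun alg_closure" where
  "ddy = (THE D. extends_ddy D)"

lemma extends_ddy_ddy: "extends_ddy ddy"
  unfolding ddy_def by (rule theI'[OF extends_ddy_unique_existence])

definition riccati_hypothesis :: "ratfun \<Rightarrow> bool" where
  "riccati_hypothesis R \<longleftrightarrow> (\<nexists>u. ddy u + u\<^sup>2 + 1/2 * to_ac R = 0)"


section \<open>Bi-algebraic curves\<close>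

definition bialgebraic_curve ::
  "complex set \<Rightarrow> complex set \<Rightarrow> cp1 set \<Rightarrow> cp1 set \<Rightarrow> (complex \<Rightarrow> cp1) \<Rightarrow> (complex \<Rightarrow> cp1) \<Rightarrow>
    (complex \<times> complex) set \<Rightarrow> bool" where
  "bialgebraic_curve U1 U2 Y1 Y2 J1 J2 C \<longleftrightarrow>
     algebraic_curve zariski_plane C \<and>
     (let Z = subtopology zariski_cp1_cp1 (Y1 \<times> Y2)
      in algebraic_curve Z (Abstract_Topology.closure_of Z (map_prod J1 J2 ` (C \<inter> U1 \<times> U2))))"

end

theory Submission
  imports Defs
begin

text \<open>The rigidity comes from a function that is algebraic over \<open>\<complex>(t)\<close> and over \<open>\<complex>(J\<^sub>1(t))\<close> at once.

Near a generic point of \<open>C\<close> the curve is the graph of a holomorphic function \<open>\<phi>\<close> that is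
algebraic over \<open>\<complex>(t)\<close>. Put \<open>y = J\<^sub>1(t)\<close> and \<open>z = J\<^sub>2(\<phi>(t))\<close>; bi-algebraicity says that \<open>z\<close> is
algebraic over \<open>\<complex>(y)\<close>. Write \<open>'\<close> for \<open>d/dt\<close>, \<open>D = d/dy = '/y'\<close>, and \<open>S\<close> for the Schwarzian
with respect to \<open>t\<close>. The chain rule for \<open>S\<close>, applied to the two Schwarzian equations, gives
\<open>S(\<phi>) = y'\<^sup>2 A\<close> with \<open>A\<close> algebraic over \<open>\<complex>(y)\<close>, while \<open>Q = S(\<phi>)\<close> is algebraic over \<open>\<complex>(t)\<close>.

Suppose \<open>Q \<noteq> 0\<close>. With \<open>h = Q'/(2Q)\<close> and \<open>v = DA/(2A)\<close>, the relation \<open>Q = y'\<^sup>2 A\<close> turns the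
equation of \<open>y\<close> into \<open>(h' - h\<^sup>2/2) / Q = (Dv - v\<^sup>2/2 - R\<^sub>1(y)) / A\<close>. The common value \<open>c\<close> is
algebraic over \<open>\<complex>(t)\<close> and over \<open>\<complex>(y)\<close>. If \<open>c\<close> is not constant, \<open>t\<close> itself is algebraic over
\<open>\<complex>(c)\<close>, hence over \<open>\<complex>(y)\<close>, and then \<open>u = y''/(2y'\<^sup>2)\<close> is an algebraic solution of the Riccati
equation \<open>Du + u\<^sup>2 + R\<^sub>1/2 = 0\<close>. If \<open>c\<close> is constant, \<open>u = -(v + \<lambda>a)/2\<close> with \<open>a\<^sup>2 = A\<close> and
\<open>\<lambda>\<^sup>2 = 2c\<close> is such a solution (\<open>schwarz_eq_0_of_bialgebraic\<close>). A solution that is algebraic over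
\<open>\<complex>(y)\<close> contradicts the Riccati hypothesis, because any other root of its minimal polynomial,
in particular one in \<open>\<complex>(y)\<^sup>a\<^sup>l\<^sup>g\<close>, solves the same equation (\<open>transfer_riccati_solution\<close>).

So \<open>S(\<phi>) = 0\<close> and \<open>\<phi>\<close> is a homography (\<open>homography_of_schwarz_eq_0\<close>). The irreducible equation
of \<open>C\<close> divides the polynomial of bidegree \<open>(1, 1)\<close> that vanishes on its graph, and the two have the
same zeros (\<open>graph_of_homography\<close>).

All of this differential algebra takes place in the field of formal Laurent series at a generic
base point, which contains the germs of \<open>t\<close>, \<open>\<phi>\<close>, \<open>y\<close> and \<open>z\<close>
(\<open>formal_bialgebraic_branch\<close>). Two geometric inputs lead there: a plane curve is the
zero set of an irreducible polynomial, and a curve in \<open>\<complex>P\<^sup>1 \<times> \<complex>P\<^sup>1\<close> satisfies a polynomial relation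
(\<open>algebraic_curve_plane\<close>, \<open>algebraic_curve_cp1\<close>); and arbitrarily close to each of its points a
plane curve has a holomorphic branch (\<open>local_branch\<close>).\<close>

section \<open>Algebraic elements over a subfield\<close>

definition algebraic_over :: "'a::field set \<Rightarrow> 'a set" where
  "algebraic_over k = {w. \<exists>p. p \<noteq> 0 \<and> (\<forall>i. coeff p i \<in> k) \<and> poly p w = 0}"

text \<open>A field type as a ring with carrier, the setting of finite extensions: there the elements that are
algebraic over a subfield form a field.\<close>

abbreviation type_ring :: "'a::field ring" where "type_ring \<equiv> ring_of_type_algebra"

lemma type_ring_simps [simp]:
  "carrier (type_ring :: 'a::field ring) = UNIV" "x \<otimes>\<^bsub>type_ring\<^esub> y = x * y"
  "x \<oplus>\<^bsub>type_ring\<^esub> y = x + y" "\<zero>\<^bsub>type_ring\<^esub> = (0::'a)" "\<one>\<^bsub>type_ring\<^esub> = (1::'a)"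
  by (simp_all add: ring_of_type_algebra_def)

lemma type_ring_minus [simp]: "\<ominus>\<^bsub>type_ring\<^esub> x = - (x::'a::field)"
proof -
  interpret type_ring: field "type_ring :: 'a ring" by (rule field_from_type_algebra)
  show ?thesis by (rule type_ring.minus_equality) auto
qed

lemma type_ring_inv [simp]: "x \<noteq> 0 \<Longrightarrow> inv\<^bsub>type_ring\<^esub> x = inverse (x::'a::field)"
proof -
  interpret type_ring: field "type_ring :: 'a ring" by (rule field_from_type_algebra)
  show "x \<noteq> 0 \<Longrightarrow> inv\<^bsub>type_ring\<^esub> x = inverse x"
    by (rule type_ring.comm_inv_char) auto
qed

lemma type_ring_pow [simp]: "x [^]\<^bsub>type_ring\<^esub> (n::nat) = (x::'a::field) ^ n"
  by (induction n) (simp_all add: nat_pow_def ring_of_type_algebra_def mult.commute)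

text \<open>The coefficient lists of \<open>ring.eval\<close> start with the leading coefficient.\<close>

lemma type_ring_eval: "ring.eval type_ring p x = poly (Poly (rev p)) (x::'a::field)"
proof -
  interpret type_ring: field "type_ring :: 'a ring" by (rule field_from_type_algebra)
  show ?thesis by (induction p) (auto simp: Poly_append poly_monom)
qed

lemma type_ring_algebraic_iff:
  assumes "subfield k (type_ring :: 'a::field ring)"
  shows "(ring.algebraic type_ring over k) w \<longleftrightarrow> w \<in> algebraic_over k"
proof -
  interpret type_ring: field "type_ring :: 'a ring" by (rule field_from_type_algebra)
  have sr: "subring k (type_ring :: 'a ring)" using assms by (rule subfieldE(1))
  have "0 \<in> k" using subringE(2)[OF sr] by simp
  show ?thesis
  proof
    assume "(type_ring.algebraic over k) w"
    then obtain p where p: "p \<in> carrier (k [X]\<^bsub>type_ring\<^esub>)" "p \<noteq> []" "type_ring.eval p w = 0"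
      using type_ring.algebraicE[OF sr, of w] by auto
    then have hd: "set p \<subseteq> k" "hd p \<noteq> 0" by (auto simp: univ_poly_def polynomial_def)
    have "coeffs (Poly (rev p)) = rev p"
      using hd(2) p(2) by (cases p) (auto simp: no_trailing_unfold)
    then have "Poly (rev p) \<noteq> 0" using p(2) by (metis coeffs_eq_Nil rev_is_Nil_conv)
    moreover have "coeff (Poly (rev p)) i \<in> k" for i
      using hd \<open>0 \<in> k\<close> by (auto simp: nth_default_def rev_nth subset_iff)
    ultimately show "w \<in> algebraic_over k"
      using p(3) by (auto simp: algebraic_over_def type_ring_eval)
  next
    assume "w \<in> algebraic_over k"
    then obtain p where p: "p \<noteq> 0" "\<And>i. coeff p i \<in> k" "poly p w = 0"
      by (auto simp: algebraic_over_def)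
    show "(type_ring.algebraic over k) w"
    proof (rule type_ring.algebraicI)
      show "type_ring.eval (rev (coeffs p)) w = \<zero>\<^bsub>type_ring\<^esub>"
        using p by (simp add: type_ring_eval)
      show "rev (coeffs p) \<noteq> []" using p by simp
      have "set (coeffs p) \<subseteq> k" using p by (auto simp: coeffs_def)
      then show "rev (coeffs p) \<in> carrier (k [X]\<^bsub>type_ring\<^esub>)"
        using p(1) by (auto simp: univ_poly_def polynomial_def hd_rev last_coeffs_eq_coeff_degree)
    qed
  qed
qed

lemma subfield_algebraic_over:
  assumes "subfield k (type_ring :: 'a::field ring)"
  shows "subfield (algebraic_over k) (type_ring :: 'a ring)"
  using field.subfield_of_algebraics[OF field_from_type_algebra assms] type_ring_algebraic_iff[OF assms] by simp

lemma subset_algebraic_over: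
  assumes "subfield k (type_ring :: 'a::field ring)"
  shows "k \<subseteq> algebraic_over k"
proof -
  interpret type_ring: field "type_ring :: 'a ring" by (rule field_from_type_algebra)
  show ?thesis
    using type_ring.algebraic_self[OF subfieldE(1)[OF assms]] type_ring_algebraic_iff[OF assms]
    by blast
qed

text \<open>The coefficients of an equation generate a finite extension \<open>E\<close>, so \<open>w\<close> lies in \<open>E(w)\<close>, which is
finite over \<open>k\<close> by multiplicativity of degrees.\<close>

lemma algebraic_over_trans:
  assumes k: "subfield k (type_ring :: 'a::field ring)"
    and w: "w \<in> algebraic_over (algebraic_over k)"
  shows "w \<in> algebraic_over k"
proof -
  interpret type_ring: field "type_ring :: 'a ring" by (rule field_from_type_algebra)
  obtain p where p: "p \<noteq> 0" "\<And>i. coeff p i \<in> algebraic_over k" "poly p w = 0"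
    using w by (auto simp: algebraic_over_def)
  define cs where "cs = coeffs p"
  have alg: "(type_ring.algebraic over k) x" if "x \<in> set cs" for x
    unfolding type_ring_algebraic_iff[OF k] using that p by (auto simp: cs_def coeffs_def)
  let ?E = "type_ring.finite_extension k cs"
  have E: "subfield ?E (type_ring :: 'a ring)"
    using type_ring.finite_extension_is_subfield[OF k _ alg] by simp
  have "coeff p i \<in> ?E" for i
  proof (cases "coeff p i = 0")
    case True
    then show ?thesis using subringE(2)[OF subfieldE(1)[OF E]] by simp
  next
    case False
    then have "coeffs p ! i = coeff p i" "i < length (coeffs p)"
      using p(1) by (auto simp: coeffs_nth le_degree length_coeffs less_Suc_eq_le)
    then have "coeff p i \<in> set cs" unfolding cs_def using nth_mem by metis
    then show ?thesis using type_ring.finite_extension_mem[OF subfieldE(1)[OF k], of cs] by auto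
  qed
  then have "w \<in> algebraic_over ?E" using p by (auto simp: algebraic_over_def)
  then have wE: "(type_ring.algebraic over ?E) w" using type_ring_algebraic_iff[OF E] by blast
  have "type_ring.finite_dimension k ?E"
    using type_ring.finite_extension_finite_dimension(1)[OF k _ alg] by simp
  then have "type_ring.finite_dimension k (type_ring.simple_extension ?E w)"
    using type_ring.telescopic_base_dim(1)[OF k E _
        type_ring.finite_dimensionI[OF type_ring.dimension_simple_extension[OF E _ wE]]] by simp
  then have "(type_ring.algebraic over k) w"
    using type_ring.finite_dimension_imp_algebraic[OF k
        type_ring.simple_extension_is_subring[OF subfieldE(1)[OF E]]]
      type_ring.simple_extension_mem[OF subfieldE(1)[OF E]] by simp
  then show ?thesis by (simp add: type_ring_algebraic_iff[OF k])
qed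

lemma subfield_closed:
  assumes "subfield K (type_ring :: 'a::field ring)"
  shows "0 \<in> K" "1 \<in> K" "x \<in> K \<Longrightarrow> y \<in> K \<Longrightarrow> x + y \<in> K" "x \<in> K \<Longrightarrow> y \<in> K \<Longrightarrow> x * y \<in> K"
    "x \<in> K \<Longrightarrow> - x \<in> K" "x \<in> K \<Longrightarrow> y \<in> K \<Longrightarrow> x - y \<in> K" "x \<in> K \<Longrightarrow> inverse x \<in> K"
    "x \<in> K \<Longrightarrow> y \<in> K \<Longrightarrow> x / y \<in> K" "x \<in> K \<Longrightarrow> x ^ n \<in> K" "numeral b \<in> K"
proof -
  have sr: "subring K (type_ring :: 'a ring)" using assms by (rule subfieldE(1))
  show zo: "0 \<in> K" "1 \<in> K" using subringE(2,3)[OF sr] by auto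
  show add: "x + y \<in> K" if "x \<in> K" "y \<in> K" for x y using subringE(7)[OF sr, of x y] that by simp
  show mult: "x * y \<in> K" if "x \<in> K" "y \<in> K" for x y using subringE(6)[OF sr, of x y] that by simp
  show minus: "- x \<in> K" if "x \<in> K" for x using subringE(5)[OF sr, of x] that by simp
  show "x - y \<in> K" if "x \<in> K" "y \<in> K" for x y using add[OF that(1) minus[OF that(2)]] by simp
  show inv: "inverse x \<in> K" if "x \<in> K" for x
  proof (cases "x = 0")
    case False
    then show ?thesis using ring.subfield_m_inv(1)[OF ring_from_type_algebra assms, of x] that by simp
  qed (use that in simp)
  show "x / y \<in> K" if "x \<in> K" "y \<in> K" for x y
    using mult[OF that(1) inv[OF that(2)]] by (simp add: divide_inverse)
  show "x ^ n \<in> K" if "x \<in> K" for x n by (induction n) (auto simp: zo mult that)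
  show "numeral b \<in> K" for b
    by (induction b) (auto simp only: numeral.simps intro: add zo)
qed

section \<open>Irreducible polynomials over a factorial ring\<close>

text \<open>Over the fraction field of the coefficient ring, \<open>F\<close> and \<open>G\<close> are coprime; clearing denominators in
a Bezout identity leaves a nonzero constant \<open>r\<close>. The proof avoids fractions: \<open>F\<close> is prime and does
not divide \<open>G\<close>, so an element of least degree in the ideal \<open>(F, G)\<close> is constant. For polynomials in
two variables this is the weak form of Bezout's theorem: common zeros lie over the roots of \<open>r\<close>.\<close>

lemma irreducible_bezout:
  fixes F G :: "'a::{factorial_semiring,semiring_Gcd,ring_gcd,idom_divide,semiring_gcd_mult_normalize} poly"
  assumes F: "irreducible F" and ndvd: "\<not> F dvd G"
  obtains A B r where "A * F + B * G = [:r:]" "r \<noteq> 0"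
proof (cases "degree F = 0")
  case True
  then obtain f where f: "F = [:f:]" by (rule degree_eq_zeroE)
  moreover have "F \<noteq> 0" using F by auto
  ultimately show thesis using that[of 1 0 f] by simp
next
  case False
  have prime: "prime_elem F" using F by (rule irreducible_imp_prime_poly)
  have F0: "F \<noteq> 0" using F by auto
  have no_const: "\<not> F dvd [:c:]" if "c \<noteq> 0" for c
    using dvd_imp_degree_le[of F "[:c:]"] False that by auto
  let ?P = "\<lambda>H. H \<noteq> 0 \<and> (\<exists>A B. H = A * F + B * G)"
  have "?P F" using F0 by (intro conjI exI[of _ 1] exI[of _ 0]) auto
  then obtain H where H: "?P H" and min: "\<And>H'. ?P H' \<Longrightarrow> degree H \<le> degree H'"
    using ex_has_least_nat[of ?P F degree] by blast
  then obtain A B where AB: "H = A * F + B * G" by blast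
  \<comment> \<open>by pseudo-division, a combination of minimal degree divides every combination up to a
    constant factor\<close>
  have div: "\<exists>c Q. c \<noteq> 0 \<and> smult c (S * F + T * G) = H * Q" for S T
  proof -
    let ?E = "S * F + T * G"
    obtain c Q where cQ: "c \<noteq> 0" "smult c ?E = H * Q + pseudo_mod ?E H"
      using pseudo_mod(1)[of H ?E] H by blast
    have "pseudo_mod ?E H = (smult c S - Q * A) * F + (smult c T - Q * B) * G"
      using cQ(2) unfolding AB by (simp add: algebra_simps smult_add_right)
    then have "pseudo_mod ?E H = 0"
      using min[of "pseudo_mod ?E H"] pseudo_mod(2)[of H ?E] H by force
    then show ?thesis using cQ by auto
  qed
  obtain c Q where c: "c \<noteq> 0" "smult c F = H * Q" using div[of 1 0] by auto
  obtain c' Q' where c': "c' \<noteq> 0" "smult c' G = H * Q'" using div[of 0 1] by auto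
  have "\<not> F dvd H"
  proof
    assume "F dvd H"
    then have "F dvd H * Q'" by simp
    then have "F dvd smult c' G" by (simp only: c'(2))
    then have "F dvd [:c':] * G" by simp
    then show False using prime ndvd no_const c' by (metis prime_elem_dvd_multD)
  qed
  moreover have "F dvd H * Q" by (metis c(2) dvd_smult dvd_refl)
  ultimately have "F dvd Q" using prime prime_elem_dvd_multD by blast
  then obtain Q2 where "Q = F * Q2" by blast
  then have "F * [:c:] = F * (H * Q2)" using c by (simp add: mult_ac)
  then have "[:c:] = H * Q2" using F0 by (simp only: mult_cancel_left) simp
  then have "degree H = 0" using c(1)
    by (metis H degree_pCons_0 degree_mult_eq_0 mult_zero_right pCons_eq_0_iff)
  then obtain r where "H = [:r:]" by (rule degree_eq_zeroE)
  then show thesis using that[of A B r] AB H by simp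
qed

text \<open>Used with predicates such as ``\<open>p\<close> vanishes at a given point'', in order to pass from a polynomial
to one of its irreducible factors.\<close>

lemma multiplicative_irreducible:
  fixes x :: "'a::factorial_semiring"
  assumes mult: "\<And>a b. P (a * b) \<Longrightarrow> P a \<or> P b" and unit: "\<And>u. is_unit u \<Longrightarrow> \<not> P u"
    and x: "P x" "x \<noteq> 0"
  obtains p where "irreducible p" "P p"
proof -
  have "P x \<longrightarrow> x \<noteq> 0 \<longrightarrow> (\<exists>p. irreducible p \<and> P p)"
  proof (induction x rule: prime_divisors_induct)
    case (factor p x)
    then show ?case
      using mult[of p x] prime_elem_imp_irreducible[of p] by (auto simp: prime_def)
  qed (use unit in auto)
  then show thesis using x that by blast
qed

section \<open>Differential fields that contain the rational functions\<close>

locale embedding_into_field =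
  fixes e :: "'r::idom \<Rightarrow> 'l::field"
  assumes e_add: "e (a + b) = e a + e b" and e_mult: "e (a * b) = e a * e b"
    and e_1: "e 1 = 1" and e_nonzero: "a \<noteq> 0 \<Longrightarrow> e a \<noteq> 0"
begin

lemma e_0 [simp]: "e 0 = 0" by (metis add.right_neutral add_left_cancel e_add)

lemma e_minus: "e (- a) = - e a"
  using e_add[of a "- a"] by (simp add: eq_neg_iff_add_eq_0 add.commute)

lemma e_numeral: "e (numeral b) = numeral b"
  by (induction b) (auto simp only: numeral.simps e_add e_1)

text \<open>The image of the fraction field of the domain of \<open>e\<close>.\<close>

definition quotients :: "'l set" where "quotients = {e a / e b | a b. b \<noteq> 0}"

definition eval2 :: "'r poly \<Rightarrow> 'l \<Rightarrow> 'l" where "eval2 F w = poly (map_poly e F) w"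

lemma eval2_simps [simp]: "eval2 0 w = 0" "eval2 (pCons a F) w = e a + w * eval2 F w"
  by (simp_all add: eval2_def map_poly_pCons)

lemma eval2_add: "eval2 (F + G) w = eval2 F w + eval2 G w"
proof (induction F arbitrary: G)
  case (pCons a F)
  then show ?case by (cases G) (auto simp: e_add algebra_simps)
qed simp

lemma eval2_smult: "eval2 (smult c F) w = e c * eval2 F w"
  by (induction F) (auto simp: e_mult algebra_simps)

lemma eval2_mult: "eval2 (F * G) w = eval2 F w * eval2 G w"
  by (induction F) (auto simp: eval2_add eval2_smult algebra_simps)

lemma eval2_diff: "eval2 (F - G) w = eval2 F w - eval2 G w"
  using eval2_add[of "F - G" G w] by simp

lemma e_in_quotients: "e a \<in> quotients"
  unfolding quotients_def using e_1 by (intro CollectI exI[of _ a] exI[of _ 1]) auto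

lemma subfield_quotients: "subfield quotients type_ring"
proof -
  interpret type_ring: field "type_ring :: 'l ring" by (rule field_from_type_algebra)
  have mult: "x * y \<in> quotients" and add: "x + y \<in> quotients" if xyQ: "x \<in> quotients" "y \<in> quotients" for x y
  proof -
    obtain a b where "x = e a / e b" "b \<noteq> 0" using xyQ(1) by (auto simp: quotients_def)
    moreover obtain c d where "y = e c / e d" "d \<noteq> 0" using xyQ(2) by (auto simp: quotients_def)
    ultimately have xy: "x = e a / e b" "b \<noteq> 0" "y = e c / e d" "d \<noteq> 0" by auto
    have "x * y = e (a * c) / e (b * d)" using xy by (simp add: e_mult)
    then show "x * y \<in> quotients"
      unfolding quotients_def using xy by (intro CollectI exI[of _ "a * c"] exI[of _ "b * d"]) auto
    have "x + y = e (a * d + c * b) / e (b * d)"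
      using xy e_nonzero[of b] e_nonzero[of d] by (simp add: e_mult e_add add_frac_eq)
    then show "x + y \<in> quotients"
      unfolding quotients_def using xy
      by (intro CollectI exI[of _ "a * d + c * b"] exI[of _ "b * d"]) auto
  qed
  have neg: "- x \<in> quotients" if x: "x \<in> quotients" for x
  proof -
    obtain a b where "x = e a / e b" "b \<noteq> 0" using x by (auto simp: quotients_def)
    then have "- x = e (- a) / e b" by (simp add: e_minus)
    then show ?thesis unfolding quotients_def using \<open>b \<noteq> 0\<close> by blast
  qed
  have inv: "inverse x \<in> quotients" if xQ: "x \<in> quotients" "x \<noteq> 0" for x
  proof -
    obtain a b where x: "x = e a / e b" "b \<noteq> 0" using xQ by (auto simp: quotients_def)
    then have "a \<noteq> 0" using xQ by auto
    then show ?thesis unfolding quotients_def using x by (auto simp: inverse_eq_divide)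
  qed
  show ?thesis
    by (rule type_ring.subfieldI'[OF type_ring.subringI])
      (use e_in_quotients[of 1] in \<open>auto simp: e_1 mult add neg inv\<close>)
qed

lemma clear_denominators:
  assumes "\<And>i. coeff p i \<in> quotients"
  obtains d F where "d \<noteq> 0" "smult (e d) p = map_poly e F"
proof -
  have "\<exists>d F. d \<noteq> 0 \<and> smult (e d) p = map_poly e F" using assms
  proof (induction p)
    case 0
    show ?case by (intro exI[of _ 1] exI[of _ 0]) auto
  next
    case (pCons a p)
    have "coeff p i \<in> quotients" for i using pCons.prems[of "Suc i"] by simp
    then obtain d F where dF: "d \<noteq> 0" "smult (e d) p = map_poly e F" using pCons.IH by blast
    obtain u v where uv: "a = e u / e v" "v \<noteq> 0"
      using pCons.prems[of 0] by (auto simp: quotients_def)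
    have "smult (e (v * d)) p = smult (e v) (map_poly e F)" by (simp add: e_mult flip: dF(2))
    then have "smult (e (v * d)) (pCons a p) = map_poly e (pCons (u * d) (smult v F))"
      using uv e_nonzero[of v] by (simp add: map_poly_pCons map_poly_smult e_mult)
    then show ?case using dF uv by (intro exI[of _ "v * d"]) auto
  qed
  then show thesis using that by blast
qed

lemma algebraic_over_quotients_iff:
  "w \<in> algebraic_over quotients \<longleftrightarrow> (\<exists>F. F \<noteq> 0 \<and> eval2 F w = 0)"
proof
  assume "w \<in> algebraic_over quotients"
  then obtain p where p: "p \<noteq> 0" "\<And>i. coeff p i \<in> quotients" "poly p w = 0"
    by (auto simp: algebraic_over_def)
  obtain d F where dF: "d \<noteq> 0" "smult (e d) p = map_poly e F"
    using clear_denominators[of p] p(2) by blast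
  have "eval2 F w = 0" unfolding eval2_def dF(2)[symmetric] using p by simp
  moreover have "F \<noteq> 0" using dF p e_nonzero by auto
  ultimately show "\<exists>F. F \<noteq> 0 \<and> eval2 F w = 0" by blast
next
  assume "\<exists>F. F \<noteq> 0 \<and> eval2 F w = 0"
  then obtain F where F: "F \<noteq> 0" "eval2 F w = 0" by blast
  then show "w \<in> algebraic_over quotients"
    unfolding algebraic_over_def eval2_def
    by (intro CollectI exI[of _ "map_poly e F"])
      (auto simp: map_poly_eq_0_iff coeff_map_poly e_in_quotients e_nonzero)
qed

end

text \<open>An embedding of \<open>\<complex>[y]\<close>, hence of \<open>\<complex>(y)\<close>, into a field with a derivation \<open>D\<close> that extends \<open>d/dy\<close>.\<close>

locale differential_embedding = embedding_into_field e
  for e :: "complex poly \<Rightarrow> 'l::field_char_0" +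
  fixes D :: "'l \<Rightarrow> 'l"
  assumes D_add: "D (u + v) = D u + D v" and D_mult: "D (u * v) = D u * v + u * D v"
    and D_e: "D (e p) = e (pderiv p)"
begin

lemma D_0 [simp]: "D 0 = 0" using D_add[of 0 0] by simp

lemma D_eval2: "D (eval2 F w) = eval2 (map_poly pderiv F) w + eval2 (pderiv F) w * D w"
  by (induction F)
    (auto simp: D_add D_mult D_e pderiv_pCons eval2_add map_poly_pCons algebra_simps)

abbreviation algebraics :: "'l set" where "algebraics \<equiv> algebraic_over quotients"

lemmas algebraics_closed = subfield_closed[OF subfield_algebraic_over[OF subfield_quotients]]

lemma e_in_algebraics: "e a \<in> algebraics"
  using e_in_quotients subset_algebraic_over[OF subfield_quotients] by blast

lemma eval2_in_algebraics: "w \<in> algebraics \<Longrightarrow> eval2 F w \<in> algebraics"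
  by (induction F) (auto intro: algebraics_closed e_in_algebraics)

lemma irreducible_dvd_of_root:
  assumes F: "irreducible F" "eval2 F w = 0" and G: "eval2 G w = 0"
  shows "F dvd G"
proof (rule ccontr)
  assume "\<not> F dvd G"
  then obtain A B r where "A * F + B * G = [:r:]" "r \<noteq> 0"
    using F(1) irreducible_bezout by blast
  from arg_cong[OF this(1), of "\<lambda>H. eval2 H w"] this(2) show False
    using F(2) G e_nonzero by (simp add: eval2_add eval2_mult)
qed

lemma irreducible_degree_pos:
  assumes "irreducible F" "eval2 F w = 0"
  shows "degree F > 0"
proof (rule ccontr)
  assume "\<not> degree F > 0"
  then obtain f where "F = [:f:]" by (metis degree_eq_zeroE gr0I)
  moreover have "F \<noteq> 0" using assms by auto
  ultimately show False using assms e_nonzero[of f] by auto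
qed

text \<open>In characteristic zero the derivative of \<open>F\<close> is a nonzero polynomial of smaller degree, so the
minimal polynomial \<open>F\<close> cannot divide it.\<close>

lemma irreducible_separable:
  assumes F: "irreducible F" "eval2 F w = 0"
  shows "eval2 (pderiv F) w \<noteq> 0"
proof
  assume "eval2 (pderiv F) w = 0"
  then have "F dvd pderiv F" by (rule irreducible_dvd_of_root[OF F])
  moreover have "pderiv F \<noteq> 0" using irreducible_degree_pos[OF F] by (simp add: pderiv_eq_0_iff)
  ultimately have "degree F \<le> degree (pderiv F)" by (rule dvd_imp_degree_le)
  then show False using irreducible_degree_pos[OF F] by (simp add: degree_pderiv)
qed

lemma algebraics_irreducible:
  assumes "w \<in> algebraics"
  obtains F where "irreducible F" "eval2 F w = 0"
proof -
  obtain F where F: "F \<noteq> 0" "eval2 F w = 0"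
    using assms by (auto simp: algebraic_over_quotients_iff)
  show thesis
  proof (rule multiplicative_irreducible[of "\<lambda>F. eval2 F w = 0" F])
    show "\<not> eval2 u w = 0" if u: "is_unit u" for u
    proof -
      obtain c where "u = [:c:]" "c dvd 1" using u is_unit_poly_iff by blast
      moreover from this have "c \<noteq> 0" by auto
      ultimately show ?thesis using e_nonzero by auto
    qed
  qed (use F that in \<open>auto simp: eval2_mult\<close>)
qed

text \<open>Differentiating \<open>F(w) = 0\<close> expresses \<open>Dw\<close> rationally in \<open>w\<close>.\<close>

lemma D_in_algebraics:
  assumes "w \<in> algebraics"
  shows "D w \<in> algebraics"
proof -
  obtain F where F: "irreducible F" "eval2 F w = 0" using algebraics_irreducible assms by blast
  have "D w = - eval2 (map_poly pderiv F) w / eval2 (pderiv F) w"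
    using D_eval2[of F w] F irreducible_separable[OF F] by (simp add: field_simps add_eq_0_iff)
  then show ?thesis using assms by (auto intro!: algebraics_closed eval2_in_algebraics)
qed

end

text \<open>For a root \<open>w\<close> of an irreducible \<open>F\<close>, implicit differentiation turns the Riccati equation into the
vanishing at \<open>w\<close> of a polynomial \<open>G\<close> over \<open>\<complex>[y]\<close>. Then \<open>F\<close> divides \<open>G\<close>, so \<open>G\<close> vanishes at every
root of \<open>F\<close> in every other differential field, and reading the computation backwards shows that
such a root solves the Riccati equation as well.\<close>

lemma transfer_riccati_solution:
  fixes e1 :: "complex poly \<Rightarrow> 'l::field_char_0" and e2 :: "complex poly \<Rightarrow> 'm::{field_char_0,alg_closed_field}"
  assumes E1: "differential_embedding e1 D1" and E2: "differential_embedding e2 D2"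
    and b: "b \<noteq> 0" and w: "w \<in> algebraic_over (embedding_into_field.quotients e1)"
    and ricc: "D1 w + w\<^sup>2 + 1/2 * (e1 a / e1 b) = 0"
  shows "\<exists>u. D2 u + u\<^sup>2 + 1/2 * (e2 a / e2 b) = 0"
proof -
  interpret E1: differential_embedding e1 D1 by (rule E1)
  interpret E2: differential_embedding e2 D2 by (rule E2)
  obtain F where F: "irreducible F" "E1.eval2 F w = 0" using E1.algebraics_irreducible[OF w] .
  have "degree (map_poly e2 F) = degree F"
    using F(1) by (intro map_poly_degree_eq E2.e_nonzero) auto
  then obtain u where u: "E2.eval2 F u = 0"
    using E1.irreducible_degree_pos[OF F] alg_closed_imp_poly_has_root[of "map_poly e2 F"]
    by (auto simp: E2.eval2_def)
  have key1: "e1 b * (2 * E1.eval2 (map_poly pderiv F) w)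
      = (2 * e1 b * w\<^sup>2 + e1 a) * E1.eval2 (pderiv F) w"
  proof -
    have "D1 w = (D1 w + w\<^sup>2 + 1/2 * (e1 a / e1 b)) - w\<^sup>2 - 1/2 * (e1 a / e1 b)"
      by (simp add: algebra_simps)
    then have D1: "D1 w = - w\<^sup>2 - 1/2 * (e1 a / e1 b)" unfolding ricc by simp
    have "e1 b * (2 * D1 w) = - (2 * e1 b * w\<^sup>2 + e1 a)"
      unfolding D1 using E1.e_nonzero[OF b] by (simp add: right_diff_distrib)
    moreover have "E1.eval2 (map_poly pderiv F) w = - E1.eval2 (pderiv F) w * D1 w"
      using E1.D_eval2[of F w] F(2) by (simp add: add_eq_0_iff)
    then have "e1 b * (2 * E1.eval2 (map_poly pderiv F) w)
        = - E1.eval2 (pderiv F) w * (e1 b * (2 * D1 w))" by simp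
    ultimately show ?thesis by (simp only:) (simp add: algebra_simps)
  qed
  define G where "G = [:2 * b:] * map_poly pderiv F - [:a, 0, 2 * b:] * pderiv F"
  have "E1.eval2 G w = 0"
    using key1 unfolding G_def E1.eval2_diff E1.eval2_mult
    by (simp add: E1.e_mult E1.e_numeral algebra_simps power2_eq_square)
  then have "F dvd G" by (rule E1.irreducible_dvd_of_root[OF F])
  then have "E2.eval2 G u = 0" using u by (auto simp: E2.eval2_mult)
  then have key2: "e2 b * (2 * E2.eval2 (map_poly pderiv F) u)
      = (2 * e2 b * u\<^sup>2 + e2 a) * E2.eval2 (pderiv F) u"
    unfolding G_def E2.eval2_diff E2.eval2_mult
    by (simp add: E2.e_mult E2.e_numeral algebra_simps power2_eq_square)
  have eq: "E2.eval2 (map_poly pderiv F) u = - E2.eval2 (pderiv F) u * D2 u"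
    using E2.D_eval2[of F u] u by (simp add: add_eq_0_iff)
  have "(2 * e2 b * D2 u + 2 * e2 b * u\<^sup>2 + e2 a) * E2.eval2 (pderiv F) u
      = (2 * e2 b * u\<^sup>2 + e2 a) * E2.eval2 (pderiv F) u
        - e2 b * (2 * (- E2.eval2 (pderiv F) u * D2 u))"
    by (simp add: algebra_simps)
  also have "\<dots> = 0" using key2 unfolding eq by simp
  finally have "(2 * e2 b * D2 u + 2 * e2 b * u\<^sup>2 + e2 a) * E2.eval2 (pderiv F) u = 0" .
  then have "2 * e2 b * D2 u + 2 * e2 b * u\<^sup>2 + e2 a = 0"
    using E2.irreducible_separable[OF F(1) u] by simp
  then have "D2 u + u\<^sup>2 + 1/2 * (e2 a / e2 b) = 0"
    using E2.e_nonzero[OF b] by (simp add: field_simps)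
  then show ?thesis by blast
qed

lemma differential_embedding_alg_closure:
  "differential_embedding (\<lambda>p. to_ac (to_fract p) :: ratfun alg_closure) ddy"
  using extends_ddy_ddy by unfold_locales (auto simp: extends_ddy_def)

lemma no_algebraic_riccati_solution:
  fixes e :: "complex poly \<Rightarrow> 'l::field_char_0"
  assumes "differential_embedding e D" and "riccati_hypothesis R"
    and "w \<in> algebraic_over (embedding_into_field.quotients e)"
  shows "D w + w\<^sup>2 + 1/2 * (e (fst (quot_of_fract R)) / e (snd (quot_of_fract R))) \<noteq> 0"
proof
  obtain a b where ab: "quot_of_fract R = (a, b)" by fastforce
  assume "D w + w\<^sup>2 + 1/2 * (e (fst (quot_of_fract R)) / e (snd (quot_of_fract R))) = 0"
  moreover have "b \<noteq> 0" using snd_quot_of_fract_nonzero[of R] ab by simp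
  ultimately obtain u where
    "ddy u + u\<^sup>2 + 1/2 * (to_ac (to_fract a) / to_ac (to_fract b)) = 0"
    using transfer_riccati_solution[OF assms(1) differential_embedding_alg_closure _ assms(3)] ab
    by auto
  moreover have "R = to_fract a / to_fract b"
    using quot_to_fract_quot_of_fract[of R] ab by (simp add: quot_to_fract_def Fract_conv_to_fract)
  ultimately show False using assms(2) by (auto simp: riccati_hypothesis_def)
qed

section \<open>The Schwarzian in a differential field\<close>

locale field_derivation =
  fixes d :: "'l::field_char_0 \<Rightarrow> 'l"
  assumes d_add: "d (u + v) = d u + d v" and d_mult: "d (u * v) = d u * v + u * d v"
begin

lemma d_0 [simp]: "d 0 = 0" using d_add[of 0 0] by simp

lemma d_1 [simp]: "d 1 = 0" using d_mult[of 1 1] by simp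

lemma d_minus: "d (- u) = - d u"
  using d_add[of u "- u"] by (simp add: eq_neg_iff_add_eq_0 add.commute)

lemma d_numeral [simp]: "d (numeral b) = 0"
  by (induction b) (auto simp only: numeral.simps d_add d_1 add_0)

lemma d_power2: "d (u\<^sup>2) = 2 * u * d u" by (simp add: power2_eq_square d_mult algebra_simps)

lemma d_inverse: "d (inverse u) = - d u / u\<^sup>2"
proof (cases "u = 0")
  case False
  then have "d u * inverse u + u * d (inverse u) = 0" using d_mult[of u "inverse u"] by simp
  then have "u * d (inverse u) = - (d u * inverse u)" by (simp add: add_eq_0_iff2 add.commute)
  then have "u * d (inverse u) = u * (- d u / u\<^sup>2)" using False by (simp add: power2_eq_square field_simps)
  then show ?thesis using False by (simp only: mult_cancel_left) simp
qed simp

lemma d_divide: "v \<noteq> 0 \<Longrightarrow> d (u / v) = (d u * v - u * d v) / v\<^sup>2"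
  unfolding divide_inverse[of u v] d_mult d_inverse by (simp add: field_simps power2_eq_square)

definition schwarz :: "'l \<Rightarrow> 'l" where
  "schwarz f = d (d (d f)) / d f - 3/2 * (d (d f) / d f)\<^sup>2"

lemma field_derivation_scaled: "field_derivation (\<lambda>w. d w / p)"
  by unfold_locales (auto simp: d_add d_mult add_divide_distrib)

lemma schwarz_conv_log_deriv:
  assumes "d f \<noteq> 0"
  shows "schwarz f = d (d (d f) / d f) - 1/2 * (d (d f) / d f)\<^sup>2"
  using assms by (simp add: schwarz_def d_divide power2_eq_square field_simps)

text \<open>The Schwarzian cocycle: \<open>S\<^sub>t(z) = (dy/dt)\<^sup>2 S\<^sub>y(z) + S\<^sub>t(y)\<close>, where \<open>S\<^sub>y\<close> is formed with the
derivation \<open>d/dy = (dt/dy) d/dt\<close>.\<close>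

lemma schwarz_chain:
  assumes p: "d y \<noteq> 0" and z: "d z \<noteq> 0"
  shows "schwarz z = (d y)\<^sup>2 * field_derivation.schwarz (\<lambda>w. d w / d y) z + schwarz y"
proof -
  interpret D: field_derivation "\<lambda>w. d w / d y" by (rule field_derivation_scaled)
  define p where "p = d y"
  define z1 where "z1 = d z / p"
  define z2 where "z2 = d z1 / p"
  define z3 where "z3 = d z2 / p"
  have [simp]: "p \<noteq> 0" "z1 \<noteq> 0" using p z by (auto simp: p_def z1_def)
  have 1: "d z = p * z1" by (simp add: z1_def)
  have "d z1 = p * z2" "d z2 = p * z3" by (simp_all add: z2_def z3_def)
  then have 2: "d (d z) = d p * z1 + p\<^sup>2 * z2"
    and 3: "d (d (d z)) = d (d p) * z1 + 3 * p * d p * z2 + p^3 * z3"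
    by (simp_all add: 1 d_mult d_add d_power2 algebra_simps power2_eq_square power3_eq_cube)
  have "D.schwarz z = z3 / z1 - 3/2 * (z2 / z1)\<^sup>2"
    unfolding D.schwarz_def unfolding p_def[symmetric] unfolding z1_def[symmetric] unfolding z2_def[symmetric] unfolding z3_def[symmetric] ..
  moreover have "schwarz y = d (d p) / p - 3/2 * (d p / p)\<^sup>2"
    unfolding schwarz_def p_def ..
  moreover have "schwarz z = p\<^sup>2 * (z3 / z1 - 3/2 * (z2 / z1)\<^sup>2) + (d (d p) / p - 3/2 * (d p / p)\<^sup>2)"
    unfolding schwarz_def unfolding 3 unfolding 2 unfolding 1
    by (simp add: field_simps power2_eq_square power3_eq_cube)
  ultimately show ?thesis by (simp add: p_def)
qed

text \<open>If \<open>x\<close> has derivative 1, then \<open>Dx = 1/y'\<close> and \<open>u = - D\<^sup>2x / (2Dx)\<close>: this is the classical passage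
from the Schwarzian equation \<open>S\<^sub>y(x) = r\<close> of the inverse function to a Riccati equation.\<close>

lemma riccati_of_schwarz:
  assumes p: "d y \<noteq> 0" and y: "schwarz y = - ((d y)\<^sup>2 * r)"
    and u: "u = d (d y) / (2 * (d y)\<^sup>2)"
  shows "d u / d y + u\<^sup>2 + 1/2 * r = 0"
proof -
  define p where "p = d y"
  have [simp]: "p \<noteq> 0" using p by (simp add: p_def)
  have r: "r = - (d (d p) / p - 3/2 * (d p / p)\<^sup>2) / p\<^sup>2"
    using p y by (simp add: p_def schwarz_def)
  have u: "u = d p / (2 * p\<^sup>2)" by (simp add: u p_def)
  then have "d (u * (2 * p\<^sup>2)) = d (d p)" by simp
  then have "d u * (2 * p\<^sup>2) + u * (4 * p * d p) = d (d p)"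
    by (simp add: d_mult d_power2 mult.assoc)
  then have du: "d u = (d (d p) - u * (4 * p * d p)) / (2 * p\<^sup>2)" by (simp add: eq_divide_eq algebra_simps)
  show ?thesis unfolding p_def[symmetric] du r unfolding u
    by (simp add: field_simps power2_eq_square)
qed

text \<open>Half the logarithmic derivative of \<open>Q = y'\<^sup>2 A\<close> is \<open>h = g + v y'\<close> with \<open>g = y''/y'\<close>, and
\<open>g' - g\<^sup>2/2 = - y'\<^sup>2 r\<close> is the Schwarzian equation. Expressing \<open>h' - h\<^sup>2/2\<close> by \<open>v\<close>, the mixed terms
cancel. The left-hand side of the conclusion depends on \<open>Q\<close> and \<open>d\<close> only, the right-hand side on
\<open>A\<close>, \<open>r\<close> and \<open>D\<close> only.\<close>

lemma schwarz_separation: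
  assumes p: "d y \<noteq> 0" and y: "schwarz y = - ((d y)\<^sup>2 * r)"
    and Q: "Q = (d y)\<^sup>2 * A" "Q \<noteq> 0"
    and h: "h = d Q / (2 * Q)" and v: "v = d A / d y / (2 * A)"
  shows "(d h - 1/2 * h\<^sup>2) / Q = (d v / d y - 1/2 * v\<^sup>2 - r) / A"
proof -
  define p where "p = d y"
  define g where "g = d p / p"
  have [simp]: "p \<noteq> 0" "A \<noteq> 0" using p Q by (auto simp: p_def)
  have "schwarz y = d g - 1/2 * g\<^sup>2"
    using p by (simp add: schwarz_conv_log_deriv g_def p_def)
  then have g: "d g - 1/2 * g\<^sup>2 = - (p\<^sup>2 * r)" using y by (simp add: p_def)
  have h': "h = g + v * p"
    unfolding h Q(1) v g_def p_def[symmetric]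
    by (simp add: d_mult d_power2 field_simps power2_eq_square)
  have dp: "d p = g * p" by (simp add: g_def)
  have "d h - 1/2 * h\<^sup>2 = (d g - 1/2 * g\<^sup>2) + p\<^sup>2 * (d v / p - 1/2 * v\<^sup>2)"
    unfolding h' by (simp add: d_add d_mult dp field_simps power2_eq_square)
  also have "\<dots> = p\<^sup>2 * (d v / p - 1/2 * v\<^sup>2 - r)"
    unfolding g by (simp add: algebra_simps)
  finally show ?thesis unfolding Q(1) by (simp add: p_def[symmetric])
qed

text \<open>With \<open>Da = va\<close>, the function \<open>w = v + la\<close> satisfies \<open>Dw - w\<^sup>2/2 = Dv - v\<^sup>2/2 - l\<^sup>2 a\<^sup>2/2\<close>; the
choice \<open>l\<^sup>2 = 2c\<close> cancels the excess \<open>cA\<close>.\<close>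

lemma riccati_of_constant:
  assumes p: "p \<noteq> 0" and A: "a\<^sup>2 = A" "A \<noteq> 0" and v: "v = d A / p / (2 * A)"
    and c: "(d v / p - 1/2 * v\<^sup>2 - r) / A = c" and l: "l\<^sup>2 = 2 * c" "d l = 0"
    and u: "u = - 1/2 * (v + l * a)"
  shows "d u / p + u\<^sup>2 + 1/2 * r = 0"
proof -
  have [simp]: "a \<noteq> 0" using A by auto
  have v': "d a = p * v * a"
    unfolding v A(1)[symmetric] using p by (simp add: d_mult field_simps power2_eq_square)
  have "d v / p - 1/2 * v\<^sup>2 - r = c * A" using c A by (simp add: field_simps)
  then have r: "d v = p * (1/2 * v\<^sup>2 + r + 1/2 * l\<^sup>2 * a\<^sup>2)" using p A l by (simp add: field_simps)
  have "d (- 1/2) = 0" by (simp add: d_divide d_minus)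
  then have "d u = - 1/2 * (d v + l * d a)"
    unfolding u by (simp only: d_mult d_add l) (simp add: algebra_simps)
  then show ?thesis unfolding r v' u using p by (simp add: field_simps power2_eq_square)
qed

end

section \<open>Rigidity in the field of Laurent series\<close>

interpretation fls_deriv: field_derivation "fls_deriv :: complex fls \<Rightarrow> _"
  by unfold_locales (simp_all add: algebra_simps)

definition fls_poly :: "complex fls \<Rightarrow> complex poly \<Rightarrow> complex fls" where
  "fls_poly x p = poly (map_poly fls_const p) x"

lemma fls_poly_simps [simp]: "fls_poly x 0 = 0" "fls_poly x (pCons a p) = fls_const a + x * fls_poly x p"
  by (simp_all add: fls_poly_def map_poly_pCons)

lemma fls_poly_add: "fls_poly x (p + q) = fls_poly x p + fls_poly x q"
proof (induction p arbitrary: q)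
  case (pCons a p)
  then show ?case by (cases q) (auto simp: fls_plus_const[symmetric] algebra_simps)
qed simp

lemma fls_poly_smult: "fls_poly x (smult c p) = fls_const c * fls_poly x p"
  by (induction p) (auto simp: algebra_simps)

lemma fls_poly_mult: "fls_poly x (p * q) = fls_poly x p * fls_poly x q"
  by (induction p) (auto simp: fls_poly_add fls_poly_smult algebra_simps)

lemma fls_deriv_fls_poly: "fls_deriv (fls_poly x p) = fls_poly x (pderiv p) * fls_deriv x"
  by (induction p) (auto simp: pderiv_pCons fls_poly_add algebra_simps)

text \<open>A nonconstant series is transcendental over \<open>\<complex>\<close>: an equation of least degree would give one of
smaller degree by differentiation.\<close>

lemma fls_poly_nonzero:
  assumes x: "fls_deriv x \<noteq> 0"
  shows "p \<noteq> 0 \<Longrightarrow> fls_poly x p \<noteq> 0"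
proof (induction "degree p" arbitrary: p rule: less_induct)
  case less
  show ?case
  proof (cases "degree p = 0")
    case True
    then show ?thesis using less.prems by (elim degree_eq_zeroE) auto
  next
    case False
    then have "fls_poly x (pderiv p) \<noteq> 0"
      by (intro less.hyps) (auto simp: degree_pderiv pderiv_eq_0_iff)
    then have "fls_deriv (fls_poly x p) \<noteq> 0" using x by (simp add: fls_deriv_fls_poly)
    then show ?thesis by auto
  qed
qed

lemma differential_embedding_fls_poly:
  assumes "fls_deriv x \<noteq> 0"
  shows "differential_embedding (fls_poly x) (\<lambda>w. fls_deriv w / fls_deriv x)"
proof -
  interpret D: field_derivation "\<lambda>w. fls_deriv w / fls_deriv x"
    by (rule fls_deriv.field_derivation_scaled)
  show ?thesis
    by unfold_locales
      (use assms in \<open>simp_all only: fls_poly_add fls_poly_mult fls_poly_nonzero fls_deriv_fls_poly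
        D.d_add D.d_mult one_pCons fls_poly_simps not_False_eq_True\<close>, simp_all)
qed

abbreviation algebraic_in :: "complex fls \<Rightarrow> complex fls set" where
  "algebraic_in x \<equiv> algebraic_over (embedding_into_field.quotients (fls_poly x))"

text \<open>The exchange property for algebraic dependence over \<open>\<complex>\<close>. A relation \<open>F(t, f) = 0\<close> is read as an
equation for \<open>t\<close> with coefficients in \<open>\<complex>[f]\<close>; these do not all vanish because \<open>f\<close> is not constant,
and they are algebraic over \<open>\<complex>(x)\<close>.\<close>

lemma algebraic_in_exchange:
  assumes x: "fls_deriv x \<noteq> 0" and t: "fls_deriv t \<noteq> 0" and f: "fls_deriv f \<noteq> 0"
    and fx: "f \<in> algebraic_in x" and ft: "f \<in> algebraic_in t"
  shows "t \<in> algebraic_in x"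
proof -
  interpret X: differential_embedding "fls_poly x" "\<lambda>w. fls_deriv w / fls_deriv x"
    by (rule differential_embedding_fls_poly[OF x])
  interpret T: differential_embedding "fls_poly t" "\<lambda>w. fls_deriv w / fls_deriv t"
    by (rule differential_embedding_fls_poly[OF t])
  obtain F where F: "F \<noteq> 0" "T.eval2 F f = 0"
    using ft by (auto simp: T.algebraic_over_quotients_iff)
  define G where "G F = poly (map_poly (map_poly fls_const) F) [:f:]" for F
  have G: "coeff (G F) i = fls_poly f (map_poly (\<lambda>q. coeff q i) F)" for F i
    by (induction F) (auto simp: G_def map_poly_pCons coeff_map_poly)
  have G_t: "poly (G F) t = T.eval2 F f" for F
    by (induction F) (auto simp: G_def map_poly_pCons simp flip: fls_poly_def)
  obtain j where "coeff F j \<noteq> 0" using F by (auto simp: poly_eq_iff)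
  then obtain i where "coeff (coeff F j) i \<noteq> 0" by (auto simp: poly_eq_iff)
  then have "map_poly (\<lambda>q. coeff q i) F \<noteq> 0"
    by (metis coeff_0 coeff_map_poly)
  then have "coeff (G F) i \<noteq> 0" unfolding G by (rule fls_poly_nonzero[OF f])
  then have "G F \<noteq> 0" by auto
  moreover have "fls_poly f p \<in> X.algebraics" for p
  proof (induction p)
    case (pCons a p)
    have "fls_const a = fls_poly x [:a:]" by simp
    then have "fls_const a \<in> X.algebraics" using X.e_in_algebraics[of "[:a:]"] by simp
    then show ?case using pCons fx by (auto intro!: X.algebraics_closed)
  qed (simp add: X.algebraics_closed)
  ultimately have "t \<in> algebraic_over X.algebraics"
    unfolding algebraic_over_def[of X.algebraics] using F
    by (intro CollectI exI[of _ "G F"]) (auto simp: G G_t)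
  then show ?thesis by (rule algebraic_over_trans[OF X.subfield_quotients])
qed

definition fls_ratfun :: "ratfun \<Rightarrow> complex fls \<Rightarrow> complex fls" where
  "fls_ratfun R x = fls_poly x (fst (quot_of_fract R)) / fls_poly x (snd (quot_of_fract R))"

text \<open>The heart of the proof. The series \<open>Q\<close>, \<open>A\<close>, \<open>h\<close>, \<open>v\<close>, \<open>c\<close> are those of the introductory sketch. The square
root \<open>s\<close> of the Schwarzian supplies \<open>a = s / Y'\<close> with \<open>a\<^sup>2 = A\<close>; square roots need not exist in the
field of Laurent series, and they are provided by the choice of the base point.\<close>

lemma schwarz_eq_0_of_bialgebraic:
  assumes t: "fls_deriv t = 1"
    and Y: "fls_deriv Y \<noteq> 0" "fls_deriv.schwarz Y = - ((fls_deriv Y)\<^sup>2 * fls_ratfun R1 Y)"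
    and Z: "fls_deriv Z \<noteq> 0"
      "fls_deriv.schwarz Z = fls_deriv.schwarz \<phi> - (fls_deriv Z)\<^sup>2 * fls_ratfun R2 Z"
    and \<phi>: "\<phi> \<in> algebraic_in t" and ZY: "Z \<in> algebraic_in Y"
    and R1: "riccati_hypothesis R1"
    and sq: "s\<^sup>2 = fls_deriv.schwarz \<phi>"
  shows "fls_deriv.schwarz \<phi> = 0"
proof (rule ccontr)
  assume Q0: "fls_deriv.schwarz \<phi> \<noteq> 0"
  define p where "p = fls_deriv Y"
  have t': "fls_deriv t \<noteq> 0" using t by simp
  interpret Y: differential_embedding "fls_poly Y" "\<lambda>w. fls_deriv w / fls_deriv Y"
    by (rule differential_embedding_fls_poly[OF Y(1)])
  interpret T: differential_embedding "fls_poly t" "\<lambda>w. fls_deriv w / fls_deriv t"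
    by (rule differential_embedding_fls_poly[OF t'])
  interpret DY: field_derivation "\<lambda>w. fls_deriv w / fls_deriv Y"
    by (rule fls_deriv.field_derivation_scaled)
  note K = Y.algebraics_closed
  note M = T.algebraics_closed
  have DK: "fls_deriv w / fls_deriv Y \<in> Y.algebraics" if "w \<in> Y.algebraics" for w
    using that by (rule Y.D_in_algebraics)
  have DM: "fls_deriv w \<in> T.algebraics" if "w \<in> T.algebraics" for w
    using T.D_in_algebraics[OF that] t by simp
  have no_ricc: False if "u \<in> Y.algebraics"
      "fls_deriv u / fls_deriv Y + u\<^sup>2 + 1/2 * fls_ratfun R1 Y = 0" for u
    using no_algebraic_riccati_solution[OF Y.differential_embedding_axioms R1 that(1)] that(2)
    unfolding fls_ratfun_def by blast
  have R1K: "fls_ratfun R1 Y \<in> Y.algebraics"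
    unfolding fls_ratfun_def by (intro K Y.e_in_algebraics)
  have ZpK: "fls_poly Z q \<in> Y.algebraics" for q
  proof (induction q)
    case (pCons a q)
    have "fls_const a = fls_poly Y [:a:]" by simp
    then have "fls_const a \<in> Y.algebraics" using Y.e_in_algebraics[of "[:a:]"] by simp
    then show ?case using pCons ZY by (auto intro!: K)
  qed (simp add: K)
  have R2K: "fls_ratfun R2 Z \<in> Y.algebraics"
    unfolding fls_ratfun_def by (intro K ZpK)
  define Q where "Q = fls_deriv.schwarz \<phi>"
  define A where "A = DY.schwarz Z - fls_ratfun R1 Y + (fls_deriv Z / fls_deriv Y)\<^sup>2 * fls_ratfun R2 Z"
  have Q: "Q = (fls_deriv Y)\<^sup>2 * A"
  proof -
    have "Q = fls_deriv.schwarz Z + (fls_deriv Z)\<^sup>2 * fls_ratfun R2 Z"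
      using Z(2) by (simp add: Q_def)
    also have "fls_deriv.schwarz Z = (fls_deriv Y)\<^sup>2 * DY.schwarz Z - (fls_deriv Y)\<^sup>2 * fls_ratfun R1 Y"
      using fls_deriv.schwarz_chain[OF Y(1) Z(1)] Y(2) by simp
    finally show ?thesis unfolding A_def using Y(1)
      by (simp add: algebra_simps power_divide)
  qed
  have Qn: "Q \<noteq> 0" using Q0 by (simp add: Q_def)
  then have An: "A \<noteq> 0" using Q by auto
  have AK: "A \<in> Y.algebraics"
    unfolding A_def DY.schwarz_def by (intro K DK ZY R1K R2K)
  have QM: "Q \<in> T.algebraics"
    unfolding Q_def fls_deriv.schwarz_def by (intro M DM \<phi>)
  define h where "h = fls_deriv Q / (2 * Q)"
  define v where "v = fls_deriv A / fls_deriv Y / (2 * A)"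
  define c where "c = (fls_deriv v / fls_deriv Y - 1/2 * v\<^sup>2 - fls_ratfun R1 Y) / A"
  have vK: "v \<in> Y.algebraics" unfolding v_def by (intro K DK AK)
  then have cK: "c \<in> Y.algebraics" unfolding c_def by (intro K DK AK R1K)
  have hM: "h \<in> T.algebraics" unfolding h_def by (intro M DM QM)
  have "c = (fls_deriv h - 1/2 * h\<^sup>2) / Q"
    using fls_deriv.schwarz_separation[OF Y Q Qn h_def v_def] by (simp add: c_def)
  then have cM: "c \<in> T.algebraics" using hM by (auto intro!: M DM QM)
  show False
  proof (cases "fls_deriv c = 0")
    case True
    then obtain c0 where c0: "c = fls_const c0" using fls_deriv_eq_0_iff by blast
    define l where "l = fls_const (csqrt (2 * c0))"
    have csq: "csqrt (2 * c0) * csqrt (2 * c0) = c0 + c0" by (metis mult_2 power2_csqrt power2_eq_square)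
    have "l\<^sup>2 = fls_const (csqrt (2 * c0) * csqrt (2 * c0))"
      unfolding l_def power2_eq_square by (rule fls_const_mult_const)
    also have "\<dots> = fls_const c0 + fls_const c0" unfolding csq by (rule fls_plus_const[symmetric])
    finally have l: "l\<^sup>2 = 2 * c" "fls_deriv l = 0" by (simp_all only: c0 mult_2 l_def fls_deriv_const)
    define a where "a = s / fls_deriv Y"
    have a: "a\<^sup>2 = A"
      using Q Y(1) sq by (simp add: a_def power_divide Q_def[symmetric])
    have "a \<in> algebraic_over Y.algebraics"
      unfolding algebraic_over_def[of Y.algebraics] using AK a K(1,2)
      by (intro CollectI exI[of _ "[:- A, 0, 1:]"])
        (auto simp: coeff_pCons K power2_eq_square split: nat.split)
    then have aK: "a \<in> Y.algebraics" by (rule algebraic_over_trans[OF Y.subfield_quotients])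
    have "l = fls_poly Y [:csqrt (2 * c0):]" by (simp add: l_def)
    then have lK: "l \<in> Y.algebraics" using Y.e_in_algebraics by metis
    have "- 1/2 * (v + l * a) \<in> Y.algebraics" by (intro K vK lK aK)
    then show False
      using no_ricc fls_deriv.riccati_of_constant[OF Y(1) a An v_def c_def[symmetric] l refl] by blast
  next
    case False
    have "t \<in> Y.algebraics" by (rule algebraic_in_exchange[OF Y(1) t' False cK cM])
    then have "fls_deriv t / fls_deriv Y \<in> Y.algebraics" by (rule DK)
    then have "fls_deriv Y \<in> Y.algebraics" using K(7)[of "1 / fls_deriv Y"] by (simp add: t)
    then have "1 / 2 * (fls_deriv (fls_deriv Y) / fls_deriv Y) / fls_deriv Y \<in> Y.algebraics"
      by (intro K DK)
    then have "fls_deriv (fls_deriv Y) / (2 * (fls_deriv Y)\<^sup>2) \<in> Y.algebraics"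
      by (simp add: power2_eq_square mult.assoc)
    then show False using no_ricc fls_deriv.riccati_of_schwarz[OF Y refl] by blast
  qed
qed

section \<open>Curves in Zariski topologies on a product\<close>

text \<open>The plane and \<open>\<complex>P\<^sup>1 \<times> \<complex>P\<^sup>1\<close> are treated together. Their dimension theory needs only that a function
of the defining family vanishes on a whole fibre of either projection or at finitely many of its
points, and that the fibres themselves are zero sets.\<close>

locale fibrewise_finite_zeros =
  fixes Fs :: "('a \<times> 'b \<Rightarrow> complex) set"
  assumes finite_fst: "f \<in> Fs \<Longrightarrow> finite {x. f (x, y) = 0} \<or> (\<forall>x. f (x, y) = 0)"
    and finite_snd: "f \<in> Fs \<Longrightarrow> finite {y. f (x, y) = 0} \<or> (\<forall>y. f (x, y) = 0)"
    and vertical: "\<exists>f\<in>Fs. \<forall>x y. f (x, y) = 0 \<longleftrightarrow> x = x0"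
    and horizontal: "\<exists>f\<in>Fs. \<forall>x y. f (x, y) = 0 \<longleftrightarrow> y = y0"
    and nonvanishing: "\<exists>f\<in>Fs. \<forall>p. f p \<noteq> 0"
begin

definition zariski :: "('a \<times> 'b) topology" where
  "zariski = topology_generated_by {{p. f p \<noteq> 0} | f. f \<in> Fs}"

lemma topspace_zariski [simp]: "topspace zariski = UNIV"
  using nonvanishing unfolding zariski_def topology_generated_by_topspace by auto

lemma closedin_zeros: "f \<in> Fs \<Longrightarrow> closedin zariski {p. f p = 0}"
proof -
  assume "f \<in> Fs"
  then have "openin zariski {p. f p \<noteq> 0}"
    unfolding zariski_def by (intro topology_generated_by_Basis) blast
  moreover have "- {p. f p = 0} = {p. f p \<noteq> 0}" by auto
  ultimately show ?thesis by (simp add: closedin_def Compl_eq_Diff_UNIV[symmetric])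
qed

lemma closedin_singleton: "closedin zariski {p}"
proof -
  obtain f g where "f \<in> Fs" "\<And>x y. f (x, y) = 0 \<longleftrightarrow> x = fst p"
    "g \<in> Fs" "\<And>x y. g (x, y) = 0 \<longleftrightarrow> y = snd p"
    using vertical[of "fst p"] horizontal[of "snd p"] by blast
  moreover from this have "{p} = {p. f p = 0} \<inter> {p. g p = 0}" by (cases p) auto
  ultimately show ?thesis using closedin_zeros[of f] closedin_zeros[of g] by (simp add: closedin_Int)
qed

lemma openin_zariski_basis:
  assumes "openin zariski W" "p \<in> W"
  shows "\<exists>G. finite G \<and> G \<subseteq> Fs \<and> (\<forall>f\<in>G. f p \<noteq> 0) \<and> (\<forall>q. (\<forall>f\<in>G. f q \<noteq> 0) \<longrightarrow> q \<in> W)"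
proof -
  have "generate_topology_on {{p. f p \<noteq> 0} | f. f \<in> Fs} W"
    using assms(1) by (simp add: zariski_def openin_topology_generated_by_iff)
  then show ?thesis using assms(2)
  proof (induction arbitrary: p)
    case (Int a b)
    then have p: "p \<in> a" "p \<in> b" by auto
    from Int.IH(1)[OF p(1)] obtain G where
      G: "finite G" "G \<subseteq> Fs" "\<forall>f\<in>G. f p \<noteq> 0" "\<forall>q. (\<forall>f\<in>G. f q \<noteq> 0) \<longrightarrow> q \<in> a" by blast
    from Int.IH(2)[OF p(2)] obtain H where
      H: "finite H" "H \<subseteq> Fs" "\<forall>f\<in>H. f p \<noteq> 0" "\<forall>q. (\<forall>f\<in>H. f q \<noteq> 0) \<longrightarrow> q \<in> b" by blast
    show ?case using G H by (intro exI[of _ "G \<union> H"]) auto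
  next
    case (UN K)
    then obtain k where k: "k \<in> K" "p \<in> k" by blast
    from UN.IH[OF k] obtain G where G:
      "finite G" "G \<subseteq> Fs" "\<forall>f\<in>G. f p \<noteq> 0" "\<forall>q. (\<forall>f\<in>G. f q \<noteq> 0) \<longrightarrow> q \<in> k" by blast
    show ?case using G k(1) by (intro exI[of _ G] conjI) blast+
  next
    case (Basis s)
    then obtain f where "f \<in> Fs" "s = {p. f p \<noteq> 0}" by blast
    with Basis show ?case by (intro exI[of _ "{f}"]) auto
  qed simp
qed

lemma closedin_zariski_separate:
  assumes "closedin zariski Z" "p \<notin> Z"
  obtains G where "finite G" "G \<subseteq> Fs" "\<forall>f\<in>G. f p \<noteq> 0" "\<forall>q\<in>Z. \<exists>f\<in>G. f q = 0"
proof -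
  have "openin zariski (- Z)" using assms(1) by (simp add: closedin_def Compl_eq_Diff_UNIV)
  then show thesis using openin_zariski_basis[of "- Z" p] assms(2) that by (metis ComplD ComplI)
qed

text \<open>For each of two proper closed subsets of \<open>Z\<close>, finitely many functions separate it from some point
of \<open>Z\<close>. A point of \<open>Z\<close> where none of all these functions vanishes lies in neither subset.\<close>

lemma irreducible_closedI:
  assumes Z: "closedin (subtopology zariski S) Z" "Z \<noteq> {}"
    and generic: "\<And>G. finite G \<Longrightarrow> G \<subseteq> Fs \<Longrightarrow> (\<forall>f\<in>G. \<exists>p\<in>Z. f p \<noteq> 0) \<Longrightarrow> \<exists>p\<in>Z. \<forall>f\<in>G. f p \<noteq> 0"
  shows "irreducible_closed (subtopology zariski S) Z"
  unfolding irreducible_closed_def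
proof (intro conjI Z allI impI; elim conjE)
  fix A B assume "closedin (subtopology zariski S) A" "closedin (subtopology zariski S) B" and AB: "Z = A \<union> B"
  then obtain A' B' where A': "closedin zariski A'" "A = A' \<inter> S" and B': "closedin zariski B'" "B = B' \<inter> S"
    by (auto simp: closedin_subtopology)
  have ZS: "Z \<subseteq> S" using Z(1) closedin_subset by fastforce
  show "Z = A \<or> Z = B"
  proof (rule ccontr)
    assume "\<not> (Z = A \<or> Z = B)"
    then obtain p q where p: "p \<in> Z" "p \<notin> A'" and q: "q \<in> Z" "q \<notin> B'"
      using AB A' B' ZS by blast
    obtain G where G: "finite G" "G \<subseteq> Fs" "\<forall>f\<in>G. f p \<noteq> 0" "\<forall>q\<in>A'. \<exists>f\<in>G. f q = 0"
      using closedin_zariski_separate[OF A'(1) p(2)] by blast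
    obtain H where H: "finite H" "H \<subseteq> Fs" "\<forall>f\<in>H. f q \<noteq> 0" "\<forall>q\<in>B'. \<exists>f\<in>H. f q = 0"
      using closedin_zariski_separate[OF B'(1) q(2)] by blast
    have "\<exists>r\<in>Z. \<forall>f\<in>G \<union> H. f r \<noteq> 0"
    proof (rule generic)
      show "\<forall>f\<in>G \<union> H. \<exists>r\<in>Z. f r \<noteq> 0" using G(3) H(3) p(1) q(1) by blast
    qed (use G H in auto)
    then show False using G(4) H(4) AB A' B' by blast
  qed
qed

text \<open>The chain point \<open>\<subset>\<close> vertical fibre \<open>\<subset>\<close> product has length 2.\<close>

lemma not_dim_1_product:
  assumes A: "infinite A" and B: "infinite B"
  shows "\<not> has_krull_dim (subtopology zariski (A \<times> B)) (A \<times> B) 1"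
proof -
  let ?T = "subtopology zariski (A \<times> B)"
  obtain x0 where x0: "x0 \<in> A" using A by (metis finite.emptyI ex_in_conv)
  obtain y0 where y0: "y0 \<in> B" using B by (metis finite.emptyI ex_in_conv)
  have pt: "irreducible_closed ?T {(x0, y0)}"
  proof (rule irreducible_closedI)
    show "closedin ?T {(x0, y0)}"
      using closedin_singleton[of "(x0, y0)"] x0 y0 by (auto simp: closedin_subtopology)
  qed auto
  have line: "irreducible_closed ?T ({x0} \<times> B)"
  proof (rule irreducible_closedI)
    obtain f where f: "f \<in> Fs" "\<And>x y. f (x, y) = 0 \<longleftrightarrow> x = x0" using vertical by blast
    have "{x0} \<times> B = {p. f p = 0} \<inter> (A \<times> B)" using f x0 by auto
    then show "closedin ?T ({x0} \<times> B)"
      using closedin_zeros[OF f(1)] by (auto simp: closedin_subtopology)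
    fix G assume G: "finite G" "G \<subseteq> Fs" "\<forall>f\<in>G. \<exists>p\<in>{x0} \<times> B. f p \<noteq> 0"
    have "finite (\<Union>f\<in>G. {y. f (x0, y) = 0})"
    proof (rule finite_UN_I[OF G(1)])
      fix f assume f: "f \<in> G"
      then obtain y where "f (x0, y) \<noteq> 0" using G(3) by auto
      then show "finite {y. f (x0, y) = 0}" using finite_snd[of f x0] G(2) f by blast
    qed
    then have "infinite (B - (\<Union>f\<in>G. {y. f (x0, y) = 0}))"
      using B by (rule Diff_infinite_finite)
    then obtain y where "y \<in> B - (\<Union>f\<in>G. {y. f (x0, y) = 0})"
      using infinite_imp_nonempty by blast
    then have "y \<in> B" "\<forall>f\<in>G. f (x0, y) \<noteq> 0" by auto
    then show "\<exists>p\<in>{x0} \<times> B. \<forall>f\<in>G. f p \<noteq> 0" by auto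
  qed (use y0 in auto)
  have plane: "irreducible_closed ?T (A \<times> B)"
  proof (rule irreducible_closedI)
    show "closedin ?T (A \<times> B)"
      using closedin_topspace[of ?T] by simp
    fix G assume G: "finite G" "G \<subseteq> Fs" "\<forall>f\<in>G. \<exists>p\<in>A \<times> B. f p \<noteq> 0"
    \<comment> \<open>for almost all \<open>y\<close>, no member of \<open>G\<close> vanishes on the whole horizontal fibre over \<open>y\<close>\<close>
    have "finite (\<Union>f\<in>G. {y. \<forall>x. f (x, y) = 0})"
    proof (rule finite_UN_I[OF G(1)])
      fix f assume f: "f \<in> G"
      then obtain x y where "f (x, y) \<noteq> 0" using G(3) by auto
      then have "finite {y. f (x, y) = 0}" using finite_snd[of f x] f G(2) by blast
      then show "finite {y. \<forall>x. f (x, y) = 0}" by (rule rev_finite_subset) auto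
    qed
    then have "infinite (B - (\<Union>f\<in>G. {y. \<forall>x. f (x, y) = 0}))"
      using B by (rule Diff_infinite_finite)
    then obtain y where "y \<in> B - (\<Union>f\<in>G. {y. \<forall>x. f (x, y) = 0})"
      using infinite_imp_nonempty by blast
    then have y: "y \<in> B" "\<And>f. f \<in> G \<Longrightarrow> \<exists>x. f (x, y) \<noteq> 0" by auto
    have "finite (\<Union>f\<in>G. {x. f (x, y) = 0})"
    proof (rule finite_UN_I[OF G(1)])
      fix f assume "f \<in> G"
      then show "finite {x. f (x, y) = 0}" using finite_fst[of f y] y(2) G(2) by blast
    qed
    then have "infinite (A - (\<Union>f\<in>G. {x. f (x, y) = 0}))"
      using A by (rule Diff_infinite_finite)
    then obtain x where "x \<in> A - (\<Union>f\<in>G. {x. f (x, y) = 0})"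
      using infinite_imp_nonempty by blast
    then have "x \<in> A" "\<forall>f\<in>G. f (x, y) \<noteq> 0" by auto
    then show "\<exists>p\<in>A \<times> B. \<forall>f\<in>G. f p \<noteq> 0" using y(1) by auto
  qed (use x0 y0 in auto)
  define c :: "nat \<Rightarrow> ('a \<times> 'b) set"
    where "c i = (if i = 0 then {(x0, y0)} else if i = 1 then {x0} \<times> B else A \<times> B)" for i
  obtain y1 where y1: "y1 \<in> B" "y1 \<noteq> y0"
    using B by (metis finite.emptyI finite_insert finite_subset insertI1 subsetI)
  obtain x1 where x1: "x1 \<in> A" "x1 \<noteq> x0"
    using A by (metis finite.emptyI finite_insert finite_subset insertI1 subsetI)
  have "c 0 \<subset> c 1" "c 1 \<subset> c 2"
    using x0 y0 x1 y1 by (auto simp: c_def)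
  then have "\<forall>i<Suc 1. c i \<subset> c (Suc i)" by (auto simp: less_Suc_eq numeral_2_eq_2)
  moreover have "\<forall>i\<le>Suc 1. irreducible_closed ?T (c i) \<and> c i \<subseteq> A \<times> B"
    using pt line plane x0 y0 by (auto simp: c_def)
  ultimately have "irreducible_chain ?T (A \<times> B) (Suc 1) c"
    by (simp add: irreducible_chain_def)
  then show ?thesis by (auto simp: has_krull_dim_def)
qed

lemma irreducible_subset_zeros:
  assumes Z: "irreducible_closed (subtopology zariski S) Z" and "finite G" "G \<subseteq> Fs"
    and "\<forall>q\<in>Z. \<exists>f\<in>G. f q = 0"
  shows "\<exists>f\<in>G. \<forall>q\<in>Z. f q = 0"
  using assms(2-)
proof (induction G)
  case empty
  then show ?case using Z by (auto simp: irreducible_closed_def)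
next
  case (insert f G)
  let ?T = "subtopology zariski S"
  have cl: "closedin ?T Z" and irr: "\<And>A B. closedin ?T A \<Longrightarrow> closedin ?T B \<Longrightarrow> Z = A \<union> B \<Longrightarrow> Z = A \<or> Z = B"
    using Z by (auto simp: irreducible_closed_def)
  have V: "closedin ?T (Z \<inter> {p. g p = 0})" if "g \<in> Fs" for g
  proof -
    have "closedin ?T (Z \<inter> (S \<inter> {p. g p = 0}))"
      by (intro closedin_Int cl closedin_subtopology_Int_closed closedin_zeros that)
    moreover have "Z \<subseteq> S" using cl closedin_subset by fastforce
    ultimately show ?thesis by (metis inf.absorb1 inf_assoc)
  qed
  have "closedin ?T (\<Union>g\<in>G. Z \<inter> {p. g p = 0})"
    using insert V by (intro closedin_Union) auto
  moreover have "Z = (Z \<inter> {p. f p = 0}) \<union> (\<Union>g\<in>G. Z \<inter> {p. g p = 0})"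
    using insert.prems by auto
  ultimately have "Z = Z \<inter> {p. f p = 0} \<or> Z = (\<Union>g\<in>G. Z \<inter> {p. g p = 0})"
    using irr V[of f] insert.prems by blast
  then show ?case
  proof
    assume "Z = (\<Union>g\<in>G. Z \<inter> {p. g p = 0})"
    then have "\<forall>q\<in>Z. \<exists>f\<in>G. f q = 0" by blast
    then show ?thesis using insert by blast
  qed blast
qed

lemma algebraic_curve_subset_zeros:
  assumes Z: "algebraic_curve (subtopology zariski (A \<times> B)) Z" and "infinite A" "infinite B"
  obtains f p where "f \<in> Fs" "\<And>q. q \<in> Z \<Longrightarrow> f q = 0" "p \<in> A \<times> B" "f p \<noteq> 0"
proof -
  let ?T = "subtopology zariski (A \<times> B)"
  have Zi: "irreducible_closed ?T Z" using Z by (simp add: algebraic_curve_def)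
  then obtain Z' where Z': "closedin zariski Z'" "Z = Z' \<inter> (A \<times> B)"
    by (auto simp: irreducible_closed_def closedin_subtopology)
  have "Z \<noteq> A \<times> B"
    using not_dim_1_product[OF assms(2,3)] Z by (auto simp: algebraic_curve_def)
  then obtain p where p: "p \<in> A \<times> B" "p \<notin> Z'" using Z' by blast
  obtain G where G: "finite G" "G \<subseteq> Fs" "\<forall>f\<in>G. f p \<noteq> 0" "\<forall>q\<in>Z'. \<exists>f\<in>G. f q = 0"
    using closedin_zariski_separate[OF Z'(1) p(2)] by blast
  then have "\<exists>f\<in>G. \<forall>q\<in>Z. f q = 0"
    using Z' by (intro irreducible_subset_zeros[OF Zi]) auto
  then show thesis using G p that by blast
qed

text \<open>A finite irreducible set is a single point, which admits no chain of length 1.\<close>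

lemma algebraic_curve_infinite:
  assumes "algebraic_curve zariski Z"
  shows "infinite Z"
proof
  assume fin: "finite Z"
  obtain c where c: "irreducible_chain zariski Z 1 c"
    using assms by (auto simp: algebraic_curve_def has_krull_dim_def)
  then have c01: "c 0 \<subset> c 1" "c 0 \<noteq> {}" "irreducible_closed zariski (c 1)" "c 1 \<subseteq> Z"
    by (auto simp: irreducible_chain_def irreducible_closed_def)
  then obtain p where p: "p \<in> c 0" by blast
  have cl: "closedin zariski F" if "finite F" for F
    using that
  proof (induction F)
    case (insert x F)
    then show ?case using closedin_Un[OF closedin_singleton[of x]] by auto
  qed simp
  have "closedin zariski (c 1 - {p})" using c01 fin cl finite_subset by (metis finite_Diff)
  moreover have "c 1 = {p} \<union> (c 1 - {p})" using p c01 by auto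
  ultimately have "c 1 = {p} \<or> c 1 = c 1 - {p}"
    using c01(3) closedin_singleton unfolding irreducible_closed_def by blast
  then show False using p c01 by auto
qed

end

abbreviation poly2 :: "complex poly poly \<Rightarrow> complex \<Rightarrow> complex \<Rightarrow> complex" where
  "poly2 F x y \<equiv> poly (poly F [:y:]) x"

lemma poly2_conv_poly_snd: "poly2 F x y = poly (map_poly (\<lambda>c. poly c x) F) y"
  by (induction F) (auto simp: map_poly_pCons)

interpretation plane: fibrewise_finite_zeros "{(\<lambda>(x, y). poly2 F x y) | F. True}"
  rewrites "fibrewise_finite_zeros.zariski {(\<lambda>(x, y). poly2 F x y) | F. True} = zariski_plane"
proof -
  let ?Fs = "{(\<lambda>(x, y). poly2 F x y) | F. True}"
  show *: "fibrewise_finite_zeros ?Fs"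
  proof
    fix f x y assume "f \<in> ?Fs"
    then obtain F where f: "f = (\<lambda>(x, y). poly2 F x y)" by blast
    show "finite {x. f (x, y) = 0} \<or> (\<forall>x. f (x, y) = 0)"
      by (cases "poly F [:y:] = 0") (auto simp: f dest: poly_roots_finite)
    show "finite {y. f (x, y) = 0} \<or> (\<forall>y. f (x, y) = 0)"
      by (cases "map_poly (\<lambda>c. poly c x) F = 0")
        (auto simp: f poly2_conv_poly_snd dest: poly_roots_finite)
  next
    show "\<exists>f\<in>?Fs. \<forall>x y. f (x, y) = 0 \<longleftrightarrow> x = x0" for x0
      by (rule bexI[of _ "\<lambda>(x, y). poly2 [:[:- x0, 1:]:] x y"], force) blast
    show "\<exists>f\<in>?Fs. \<forall>x y. f (x, y) = 0 \<longleftrightarrow> y = y0" for y0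
      by (rule bexI[of _ "\<lambda>(x, y). poly2 [:[:- y0:], 1:] x y"], force) blast
    show "\<exists>f\<in>?Fs. \<forall>p. f p \<noteq> 0"
      by (rule bexI[of _ "\<lambda>(x, y). poly2 1 x y"], force) blast
  qed
  have "{{p. f p \<noteq> 0} | f. f \<in> ?Fs} = {{(x, y). poly2 F x y \<noteq> 0} | F. True}"
    by (auto simp: case_prod_beta')
  then show "fibrewise_finite_zeros.zariski ?Fs = zariski_plane"
    unfolding fibrewise_finite_zeros.zariski_def[OF *] zariski_plane_def by simp
qed

text \<open>Common zeros lie over the finitely many roots of the constant \<open>r\<close> of a Bezout identity. If
a fibre contained infinitely many of them, its equation \<open>x - x\<^sub>0\<close> would divide \<open>F\<close> and \<open>G\<close>; being
irreducible, \<open>F\<close> would be associated to it and divide \<open>G\<close>.\<close>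

lemma finite_common_zeros:
  assumes F: "irreducible F" and ndvd: "\<not> F dvd G"
  shows "finite {(x, y). poly2 F x y = 0 \<and> poly2 G x y = 0}"
proof -
  obtain A B r where r: "A * F + B * G = [:r:]" "r \<noteq> 0" using irreducible_bezout[OF F ndvd] .
  have fib: "finite {y. poly2 F x y = 0 \<and> poly2 G x y = 0}" for x
  proof (rule ccontr)
    assume inf: "infinite {y. poly2 F x y = 0 \<and> poly2 G x y = 0}"
    let ?L = "[:[:- x, 1:]:] :: complex poly poly"
    have dvd: "?L dvd H" if H: "infinite {y. poly2 H x y = 0}" for H
    proof -
      have "map_poly (\<lambda>c. poly c x) H = 0"
        using poly_roots_finite[of "map_poly (\<lambda>c. poly c x) H"] H by (auto simp: poly2_conv_poly_snd)
      then have "poly (coeff H n) x = 0" for n by (metis coeff_0 coeff_map_poly poly_0)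
      then show ?thesis by (simp add: const_poly_dvd_iff poly_eq_0_iff_dvd)
    qed
    have "?L dvd F" "?L dvd G" using inf by (auto intro!: dvd elim!: contrapos_nn finite_subset[rotated])
    then obtain S where "F = ?L * S" by blast
    moreover have "\<not> is_unit ?L" by (auto simp: is_unit_poly_iff)
    ultimately have "is_unit S" using F irreducibleD by blast
    then have "F dvd ?L" unfolding \<open>F = ?L * S\<close> by (simp only: mult_unit_dvd_iff dvd_refl)
    then show False using \<open>?L dvd G\<close> ndvd dvd_trans by blast
  qed
  have "{(x, y). poly2 F x y = 0 \<and> poly2 G x y = 0}
      \<subseteq> (SIGMA x:{x. poly r x = 0}. {y. poly2 F x y = 0 \<and> poly2 G x y = 0})"
  proof
    fix p assume "p \<in> {(x, y). poly2 F x y = 0 \<and> poly2 G x y = 0}"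
    then obtain x y where "p = (x, y)" "poly2 F x y = 0" "poly2 G x y = 0" by blast
    then show "p \<in> (SIGMA x:{x. poly r x = 0}. {y. poly2 F x y = 0 \<and> poly2 G x y = 0})"
      using arg_cong[OF r(1), of "\<lambda>H. poly2 H x y"] by simp
  qed
  moreover have "finite (SIGMA x:{x. poly r x = 0}. {y. poly2 F x y = 0 \<and> poly2 G x y = 0})"
    using fib poly_roots_finite[OF r(2)] by blast
  ultimately show ?thesis by (rule finite_subset)
qed

text \<open>Every polynomial that vanishes on the infinite set \<open>C\<close> has infinitely many common zeros with \<open>F\<close>,
hence is divisible by \<open>F\<close> and vanishes wherever \<open>F\<close> does.\<close>

lemma algebraic_curve_plane:
  assumes "algebraic_curve zariski_plane C"
  obtains F where "irreducible F" "C = {(x, y). poly2 F x y = 0}"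
proof -
  have C: "algebraic_curve (subtopology zariski_plane (UNIV \<times> UNIV)) C" using assms by simp
  then have Ci: "irreducible_closed zariski_plane C" by (simp add: algebraic_curve_def)
  have inf: "infinite C" using assms by (rule plane.algebraic_curve_infinite)
  obtain F0 where F0: "F0 \<noteq> 0" "\<And>x y. (x, y) \<in> C \<Longrightarrow> poly2 F0 x y = 0"
  proof (rule plane.algebraic_curve_subset_zeros[OF C infinite_UNIV_char_0 infinite_UNIV_char_0])
    fix f p assume f: "f \<in> {(\<lambda>(x, y). poly2 F x y) | F. True}" "f p \<noteq> 0"
      "\<And>q. q \<in> C \<Longrightarrow> f q = 0"
    then obtain F where F: "f = (\<lambda>(x, y). poly2 F x y)" by blast
    show thesis
    proof (rule that)
      show "F \<noteq> 0" using f(2) F by (auto split: prod.splits)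
      show "poly2 F x y = 0" if "(x, y) \<in> C" for x y using f(3)[OF that] F by simp
    qed
  qed
  let ?P = "\<lambda>F. \<forall>(x, y)\<in>C. poly2 F x y = 0"
  obtain F where F: "irreducible F" "?P F"
  proof (rule multiplicative_irreducible[of ?P F0])
    fix G H assume GH: "?P (G * H)"
    have "\<exists>f\<in>{(\<lambda>(x, y). poly2 G x y), (\<lambda>(x, y). poly2 H x y)}. \<forall>q\<in>C. f q = 0"
      using GH Ci by (intro plane.irreducible_subset_zeros[of UNIV]) auto
    then show "?P G \<or> ?P H" by auto
  next
    fix u :: "complex poly poly" assume "is_unit u"
    then obtain q where "u = [:q:]" "q dvd 1" using is_unit_poly_iff by blast
    moreover from this obtain c where "q = [:c:]" "c dvd 1" using is_unit_poly_iff by blast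
    moreover obtain x y where "(x, y) \<in> C" using inf by (metis finite.emptyI ex_in_conv prod.exhaust)
    ultimately show "\<not> ?P u" by auto
  qed (use F0 that in auto)
  have "C = {(x, y). poly2 F x y = 0}"
  proof (intro equalityI subsetI)
    fix p assume p: "p \<in> {(x, y). poly2 F x y = 0}"
    show "p \<in> C"
    proof (rule ccontr)
      assume pC: "p \<notin> C"
      have cl: "closedin zariski_plane C" using Ci by (simp add: irreducible_closed_def)
      obtain G where G: "finite G" "G \<subseteq> {(\<lambda>(x, y). poly2 F x y) | F. True}"
          "\<forall>f\<in>G. f p \<noteq> 0" "\<forall>q\<in>C. \<exists>f\<in>G. f q = 0"
        using plane.closedin_zariski_separate[OF cl pC] .
      have "irreducible_closed (subtopology zariski_plane UNIV) C" using Ci by simp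
      from plane.irreducible_subset_zeros[OF this G(1,2)] G(4)
      obtain f where f: "f \<in> G" "\<And>q. q \<in> C \<Longrightarrow> f q = 0" by blast
      then obtain H where H: "f = (\<lambda>(x, y). poly2 H x y)" using G(2) by blast
      have "C \<subseteq> {(x, y). poly2 F x y = 0 \<and> poly2 H x y = 0}" using F(2) f(2) H by auto
      then have "F dvd H" using finite_common_zeros[OF F(1)] inf finite_subset by blast
      then obtain S where S: "H = F * S" by blast
      have "f p \<noteq> 0" using G(3) f(1) by blast
      then show False using p by (auto simp: H S)
    qed
  qed (use F in auto)
  then show thesis using F that by blast
qed

lemma bihom_eval_Fin: "bihom_eval m n a (Fin x, Fin y) = (\<Sum>i\<le>m. \<Sum>j\<le>n. a i j * x ^ i * y ^ j)"
  by (simp add: bihom_eval_def)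

text \<open>A nonzero binary form restricts to a nonzero polynomial on the affine line.\<close>

lemma finite_zeros_form:
  "finite {p. (let (Y, W) = hom_coords p in \<Sum>i\<le>m. b i * Y ^ i * W ^ (m - i)) = 0}
    \<or> (\<forall>p. (let (Y, W) = hom_coords p in \<Sum>i\<le>m. (b i :: complex) * Y ^ i * W ^ (m - i)) = 0)"
proof (cases "\<exists>i\<le>m. b i \<noteq> 0")
  case True
  define q where "q = (\<Sum>i\<le>m. monom (b i) i)"
  obtain i where i: "i \<le> m" "b i \<noteq> 0" using True by blast
  have "coeff q i = b i" unfolding q_def using i by (simp add: coeff_sum if_distrib sum.delta cong: if_cong)
  then have "q \<noteq> 0" using i by auto
  then have "finite (insert Infty (Fin ` {z. poly q z = 0}))" 
    using poly_roots_finite[OF \<open>q \<noteq> 0\<close>] by simp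
  moreover have "{p. (let (Y, W) = hom_coords p in \<Sum>i\<le>m. b i * Y ^ i * W ^ (m - i)) = 0}
      \<subseteq> insert Infty (Fin ` {z. poly q z = 0})"
  proof
    fix p assume "p \<in> {p. (let (Y, W) = hom_coords p in \<Sum>i\<le>m. b i * Y ^ i * W ^ (m - i)) = 0}"
    then show "p \<in> insert Infty (Fin ` {z. poly q z = 0})"
      by (cases p) (auto simp: q_def poly_sum poly_monom)
  qed
  ultimately show ?thesis using finite_subset by blast
qed (auto simp: Let_def split: prod.splits)

interpretation cp1: fibrewise_finite_zeros "{bihom_eval m n a | m n a. True}"
  rewrites "fibrewise_finite_zeros.zariski {bihom_eval m n a | m n a. True} = zariski_cp1_cp1"
proof -
  let ?Fs = "{bihom_eval m n a | m n a. True}"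
  show *: "fibrewise_finite_zeros ?Fs"
  proof
    fix f x y assume "f \<in> ?Fs"
    then obtain m n a where f: "f = bihom_eval m n a" by blast
    obtain Y2 W2 where y: "hom_coords y = (Y2, W2)" by fastforce
    have "f (x, y) = (let (Y, W) = hom_coords x in
        \<Sum>i\<le>m. (\<Sum>j\<le>n. a i j * Y2 ^ j * W2 ^ (n - j)) * Y ^ i * W ^ (m - i))" for x
      by (auto simp: f bihom_eval_def y sum_distrib_left sum_distrib_right mult_ac split: prod.splits)
    then show "finite {x. f (x, y) = 0} \<or> (\<forall>x. f (x, y) = 0)"
      by (simp only: finite_zeros_form)
    obtain Y1 W1 where x: "hom_coords x = (Y1, W1)" by fastforce
    have "f (x, y) = (let (Y, W) = hom_coords y in
        \<Sum>j\<le>n. (\<Sum>i\<le>m. a i j * Y1 ^ i * W1 ^ (m - i)) * Y ^ j * W ^ (n - j))" for y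
      by (simp add: f bihom_eval_def x sum_distrib_left sum_distrib_right mult_ac split: prod.splits)
        (intro allI impI, subst sum.swap, simp add: mult_ac)
    then show "finite {y. f (x, y) = 0} \<or> (\<forall>y. f (x, y) = 0)"
      by (simp only: finite_zeros_form)
  next
    fix x0 obtain Y0 W0 where x0: "hom_coords x0 = (Y0, W0)" by fastforce
    have z: "W0 * Y - Y0 * W = 0 \<longleftrightarrow> x = x0" if "hom_coords x = (Y, W)" for x Y W
      using that x0 by (cases x; cases x0) auto
    show "\<exists>f\<in>?Fs. \<forall>x y. f (x, y) = 0 \<longleftrightarrow> x = x0"
    proof (rule bexI[of _ "bihom_eval 1 0 (\<lambda>i j. if i = 0 then - Y0 else W0)"])
      show "\<forall>x y. bihom_eval 1 0 (\<lambda>i j. if i = 0 then - Y0 else W0) (x, y) = 0 \<longleftrightarrow> x = x0"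
        using z by (auto simp: bihom_eval_def atMost_Suc split: prod.splits)
    qed blast
    show "\<exists>f\<in>?Fs. \<forall>x y. f (x, y) = 0 \<longleftrightarrow> y = x0"
    proof (rule bexI[of _ "bihom_eval 0 1 (\<lambda>i j. if j = 0 then - Y0 else W0)"])
      show "\<forall>x y. bihom_eval 0 1 (\<lambda>i j. if j = 0 then - Y0 else W0) (x, y) = 0 \<longleftrightarrow> y = x0"
        using z by (auto simp: bihom_eval_def atMost_Suc split: prod.splits)
    qed blast
  next
    show "\<exists>f\<in>?Fs. \<forall>p. f p \<noteq> 0"
    proof (rule bexI[of _ "bihom_eval 0 0 (\<lambda>i j. 1)"])
      show "\<forall>p. bihom_eval 0 0 (\<lambda>i j. 1) p \<noteq> 0" by (auto simp: bihom_eval_def split: prod.splits)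
    qed blast
  qed
  have "{{p. f p \<noteq> 0} | f. f \<in> ?Fs} = {{p. bihom_eval m n a p \<noteq> 0} | m n a. True}" by auto
  then show "fibrewise_finite_zeros.zariski ?Fs = zariski_cp1_cp1"
    unfolding fibrewise_finite_zeros.zariski_def[OF *] zariski_cp1_cp1_def by simp
qed

lemma hyperbolic_infinite: "hyperbolic_genus_zero Y \<Longrightarrow> infinite Y"
proof
  assume "hyperbolic_genus_zero Y" "finite Y"
  then have "finite (UNIV :: cp1 set)"
    by (metis Compl_partition finite_Un hyperbolic_genus_zero_def)
  moreover have "inj Fin" by (rule injI) simp
  ultimately show False using infinite_UNIV_char_0[where 'a = complex]
    by (meson finite_imageD finite_subset subset_UNIV)
qed

lemma algebraic_curve_cp1:
  assumes Z: "algebraic_curve (subtopology zariski_cp1_cp1 (Y1 \<times> Y2)) Z"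
    and "hyperbolic_genus_zero Y1" "hyperbolic_genus_zero Y2"
  obtains G where "G \<noteq> 0" "\<And>x y. (Fin x, Fin y) \<in> Z \<Longrightarrow> poly2 G x y = 0"
proof -
  obtain f p where f: "f \<in> {bihom_eval m n a | m n a. True}" "\<forall>q\<in>Z. f q = 0" "f p \<noteq> 0"
    by (rule cp1.algebraic_curve_subset_zeros[OF Z hyperbolic_infinite[OF assms(2)]
          hyperbolic_infinite[OF assms(3)]]) blast
  then obtain m n a where fa: "f = bihom_eval m n a" by blast
  have a: "\<And>q. q \<in> Z \<Longrightarrow> bihom_eval m n a q = 0" "bihom_eval m n a p \<noteq> 0"
    using f fa by auto
  have "\<exists>i\<le>m. \<exists>j\<le>n. a i j \<noteq> 0"
    using a(2) by (rule contrapos_np) (auto simp: bihom_eval_def split: prod.splits)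
  then obtain i j where ij: "i \<le> m" "j \<le> n" "a i j \<noteq> 0" by blast
  define G where "G = (\<Sum>j\<le>n. monom (\<Sum>i\<le>m. monom (a i j) i) j)"
  have "coeff (coeff G j) i = a i j"
    unfolding G_def using ij by (simp add: coeff_sum if_distrib sum.delta cong: if_cong)
  then have "G \<noteq> 0" using ij by auto
  moreover have "poly2 G x y = bihom_eval m n a (Fin x, Fin y)" for x y
    unfolding bihom_eval_Fin
    by (subst sum.swap)
      (simp add: G_def poly_sum poly_monom poly_power sum_distrib_left sum_distrib_right mult_ac)
  ultimately show thesis using that a(1) by metis
qed

section \<open>Holomorphic branches of plane curves\<close>

lemma has_derivative_poly2:
  "((\<lambda>p. poly2 F (fst p) (snd p)) has_derivative
     (\<lambda>h. poly2 (map_poly pderiv F) (fst p) (snd p) * fst h + poly2 (pderiv F) (fst p) (snd p) * snd h))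
   (at p within S)"
proof (induction F)
  case (pCons c F)
  have c: "((\<lambda>p. poly c (fst p)) has_derivative (\<lambda>h. poly (pderiv c) (fst p) * fst h)) (at p within S)"
  proof -
    have "(poly c has_derivative (*) (poly (pderiv c) (fst p))) (at (fst p))"
      using poly_DERIV[of c "fst p"] by (simp add: has_field_derivative_def)
    from has_derivative_compose[OF has_derivative_fst[OF has_derivative_ident] this]
    show ?thesis by simp
  qed
  have "((\<lambda>p. poly c (fst p) + snd p * poly2 F (fst p) (snd p)) has_derivative
     (\<lambda>h. poly (pderiv c) (fst p) * fst h + (snd p *
        (poly2 (map_poly pderiv F) (fst p) (snd p) * fst h + poly2 (pderiv F) (fst p) (snd p) * snd h)
        + snd h * poly2 F (fst p) (snd p)))) (at p within S)"
    by (intro derivative_intros c pCons.IH)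
  then show ?case
    by (simp add: map_poly_pCons pderiv_pCons algebra_simps)
qed simp

lemma continuous_on_poly2 [continuous_intros]:
  assumes f: "continuous_on S f" and g: "continuous_on S g"
  shows "continuous_on S (\<lambda>x. poly2 F (f x) (g x))"
proof (induction F)
  case (pCons c F)
  then show ?case by (auto intro!: continuous_intros f g)
qed simp

text \<open>Zeros of \<open>F(x, \<cdot>)\<close> persist when \<open>x\<close> moves. This is Hurwitz's theorem: polynomials \<open>F(t\<^sub>n, \<cdot>)\<close> without
zeros in a disc would converge uniformly to \<open>F(x\<^sub>0, \<cdot>)\<close>, which has a zero there and is not constant.\<close>

lemma nearby_zeros:
  assumes nv: "map_poly (\<lambda>c. poly c x0) F \<noteq> 0" and z: "poly2 F x0 y0 = 0" and e: "e > 0"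
  shows "\<exists>\<delta>>0. \<forall>x\<in>ball x0 \<delta>. \<exists>y\<in>ball y0 e. poly2 F x y = 0"
proof (rule ccontr)
  assume "\<not> ?thesis"
  then have "\<forall>n. \<exists>x\<in>ball x0 (1 / real (Suc n)). \<forall>y\<in>ball y0 e. poly2 F x y \<noteq> 0" by force
  then obtain t where t: "\<And>n. t n \<in> ball x0 (1 / real (Suc n))"
      "\<And>n y. y \<in> ball y0 e \<Longrightarrow> poly2 F (t n) y \<noteq> 0" by metis
  have lim: "t \<longlonglongrightarrow> x0"
  proof (rule metric_LIMSEQ_I)
    fix r :: real assume "r > 0"
    then obtain N where N: "inverse (real (Suc N)) < r" using reals_Archimedean by blast
    have "dist (t n) x0 < r" if "n \<ge> N" for n
    proof -
      have "1 / real (Suc n) \<le> 1 / real (Suc N)" using that by (simp add: frac_le)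
      then show ?thesis using t(1)[of n] N by (simp add: dist_commute inverse_eq_divide)
    qed
    then show "\<exists>N. \<forall>n\<ge>N. dist (t n) x0 < r" by blast
  qed
  have in_cb: "t n \<in> cball x0 1" for n
  proof -
    have "1 / real (Suc n) \<le> 1" by simp
    then show ?thesis using t(1)[of n] unfolding mem_cball mem_ball by linarith
  qed
  define g where "g = poly2 F x0"
  have g: "g y = poly (map_poly (\<lambda>c. poly c x0) F) y" for y
    unfolding g_def by (rule poly2_conv_poly_snd)
  have hol: "poly2 F x holomorphic_on S" for x S
  proof -
    have "poly2 F x = poly (map_poly (\<lambda>c. poly c x) F)" by (rule ext) (rule poly2_conv_poly_snd)
    then show ?thesis
      unfolding holomorphic_on_def field_differentiable_def
      using poly_DERIV has_field_derivative_at_within by metis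
  qed
  have "g y0 \<noteq> 0"
  proof (rule Hurwitz_no_zeros[of "ball y0 e" "\<lambda>n. poly2 F (t n)" g y0])
    show "poly2 F (t n) holomorphic_on ball y0 e" for n by (rule hol)
    show "g holomorphic_on ball y0 e" unfolding g_def by (rule hol)
    show "\<not> g constant_on ball y0 e"
    proof
      assume "g constant_on ball y0 e"
      then have "\<forall>y\<in>ball y0 e. g y = 0" using z e unfolding constant_on_def g_def by (metis centre_in_ball)
      then have "ball y0 e \<subseteq> {y. poly (map_poly (\<lambda>c. poly c x0) F) y = 0}" by (auto simp: g)
      then have "finite (ball y0 e)" using poly_roots_finite[OF nv] finite_subset by blast
      then show False using e uncountable_ball countable_finite by blast
    qed
    fix K assume K: "compact K" "K \<subseteq> ball y0 e"
    have "compact (cball x0 1 \<times> K)" using K by (intro compact_Times) auto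
    then have "uniformly_continuous_on (cball x0 1 \<times> K) (\<lambda>p. poly2 F (fst p) (snd p))"
      by (intro compact_uniformly_continuous continuous_intros)
    then have uc: "\<exists>d>0. \<forall>p\<in>cball x0 1 \<times> K. \<forall>q\<in>cball x0 1 \<times> K. dist q p < d \<longrightarrow>
        dist (poly2 F (fst q) (snd q)) (poly2 F (fst p) (snd p)) < r" if "r > 0" for r
      using that unfolding uniformly_continuous_on_def by blast
    show "uniform_limit K (\<lambda>n. poly2 F (t n)) g sequentially"
      unfolding uniform_limit_iff
    proof (intro allI impI)
      fix r :: real assume "r > 0"
      then obtain d where d: "d > 0" "\<And>p q. p \<in> cball x0 1 \<times> K \<Longrightarrow> q \<in> cball x0 1 \<times> K \<Longrightarrow> dist q p < d \<Longrightarrow>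
        dist (poly2 F (fst q) (snd q)) (poly2 F (fst p) (snd p)) < r" using uc[of r] by blast
      have "eventually (\<lambda>n. dist (t n) x0 < d) sequentially" using lim d(1) by (rule tendstoD)
      then show "\<forall>\<^sub>F n in sequentially. \<forall>y\<in>K. dist (poly2 F (t n) y) (g y) < r"
      proof eventually_elim
        case (elim n)
        show ?case
        proof
          fix y assume "y \<in> K"
          then show "dist (poly2 F (t n) y) (g y) < r"
            using d(2)[of "(x0, y)" "(t n, y)"] in_cb[of n] elim by (simp add: g_def dist_Pair_Pair)
        qed
      qed
    qed
  qed (use t e in auto)
  then show False using z by (simp add: g_def)
qed

text \<open>The inverse function theorem for \<open>(x, y) \<mapsto> (x, F(x, y))\<close> yields \<open>\<phi>\<close> as a real differentiable
function; differentiating \<open>F(t, \<phi>(t)) = 0\<close> shows that its derivative is complex linear.\<close>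

lemma implicit_function_poly2:
  assumes z: "poly2 F t1 s1 = 0" "poly2 (pderiv F) t1 s1 \<noteq> 0" and U: "open U" "(t1, s1) \<in> U"
  obtains W \<phi> where "open W" "t1 \<in> W" "\<phi> holomorphic_on W" "\<And>t. t \<in> W \<Longrightarrow> (t, \<phi> t) \<in> U"
    "\<And>t. t \<in> W \<Longrightarrow> poly2 F t (\<phi> t) = 0"
proof -
  define Fx where "Fx p = poly2 (map_poly pderiv F) (fst p) (snd p)" for p
  define Fy where "Fy p = poly2 (pderiv F) (fst p) (snd p)" for p
  define f where "f p = (fst p, poly2 F (fst p) (snd p))" for p
  define L where "L p h = (fst h, Fx p * fst h + Fy p * snd h)" for p h
  define U0 where "U0 = U \<inter> {p. Fy p \<noteq> 0}"
  have contF: "continuous_on UNIV Fx" "continuous_on UNIV Fy"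
    unfolding Fx_def Fy_def by (intro continuous_intros)+
  have "open {p. Fy p \<noteq> 0}"
    using contF(2) by (intro open_Collect_neq) auto
  then have "open U0" unfolding U0_def using U(1) by blast
  have U0: "(t1, s1) \<in> U0" using U z by (simp add: U0_def Fy_def)
  have derF: "((\<lambda>p. poly2 F (fst p) (snd p)) has_derivative (\<lambda>h. Fx p * fst h + Fy p * snd h)) (at p)" for p
    unfolding Fx_def Fy_def by (rule has_derivative_poly2)
  have derf: "(f has_derivative L p) (at p)" for p
    unfolding f_def L_def by (intro has_derivative_Pair has_derivative_fst has_derivative_ident derF)
  have bl: "bounded_linear (L p)" for p using derf by (rule has_derivative_bounded_linear)
  have app: "blinfun_apply (Blinfun (L p)) = L p" for p by (rule bounded_linear_Blinfun_apply[OF bl])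
  define M where "M h = (fst h, (snd h - Fx (t1, s1) * fst h) / Fy (t1, s1))" for h
  have blM: "bounded_linear M" unfolding M_def divide_inverse
    by (intro bounded_linear_Pair bounded_linear_fst bounded_linear_mult_const bounded_linear_sub
        bounded_linear_snd bounded_linear_const_mult)
  have contL: "continuous_on U0 (\<lambda>p. Blinfun (L p))"
    by (rule continuous_on_blinfun_componentwise)
      (auto simp: app L_def intro!: continuous_intros contF[THEN continuous_on_subset])
  have inv: "Blinfun M o\<^sub>L Blinfun (L (t1, s1)) = id_blinfun"
    using U0 by (intro blinfun_eqI)
      (simp add: app bounded_linear_Blinfun_apply[OF blM] M_def L_def U0_def)
  obtain U' V g g' where ift: "open U'" "U' \<subseteq> U0" "(t1, s1) \<in> U'" "open V" "f (t1, s1) \<in> V"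
      "homeomorphism U' V f g" "\<And>y. y \<in> V \<Longrightarrow> (g has_derivative (g' y)) (at y)"
    using inverse_function_theorem[of U0 f "\<lambda>p. Blinfun (L p)" "(t1, s1)" "Blinfun M"]
      \<open>open U0\<close> U0 derf contL inv unfolding app by metis
  define \<phi> where "\<phi> t = snd (g (t, 0))" for t
  define W where "W = {t. (t, 0::complex) \<in> V}"
  have "open W"
    unfolding W_def using ift(4)
    by (intro open_vimage[of V "\<lambda>t. (t, 0::complex)", unfolded vimage_def] continuous_intros)
  have t1: "t1 \<in> W" using ift(5) z(1) by (simp add: W_def f_def)
  have g: "g (t, 0) \<in> U0" "g (t, 0) = (t, \<phi> t)" "poly2 F t (\<phi> t) = 0" if "t \<in> W" for t
  proof -
    have V: "(t, 0) \<in> V" using that by (simp add: W_def)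
    then have "g (t, 0) \<in> U'" "f (g (t, 0)) = (t, 0)"
      using ift(6) by (auto simp: homeomorphism_def)
    then show "g (t, 0) \<in> U0" "g (t, 0) = (t, \<phi> t)" "poly2 F t (\<phi> t) = 0"
      using ift(2) by (auto simp: f_def \<phi>_def prod_eq_iff)
  qed
  have "\<phi> field_differentiable (at t)" if t: "t \<in> W" for t
  proof -
    have V: "(t, 0) \<in> V" using t by (simp add: W_def)
    define l where "l h = snd (g' (t, 0) (h, 0))" for h
    have "((\<lambda>t. (t, 0::complex)) has_derivative (\<lambda>h. (h, 0))) (at t)"
      by (intro derivative_intros)
    from has_derivative_compose[OF this ift(7)[OF V]]
    have d\<phi>: "(\<phi> has_derivative l) (at t)"
      unfolding \<phi>_def l_def by (rule has_derivative_snd)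
    have "((\<lambda>t. (t, \<phi> t)) has_derivative (\<lambda>h. (h, l h))) (at t)"
      by (intro derivative_intros d\<phi>)
    from has_derivative_compose[OF this derF]
    have "((\<lambda>t. poly2 F t (\<phi> t)) has_derivative (\<lambda>h. Fx (t, \<phi> t) * h + Fy (t, \<phi> t) * l h)) (at t)"
      by simp
    moreover have "((\<lambda>t. poly2 F t (\<phi> t)) has_derivative (\<lambda>h. 0)) (at t)"
    proof (rule has_derivative_transform_within_open[OF has_derivative_const \<open>open W\<close> t])
      show "0 = poly2 F t (\<phi> t)" if "t \<in> W" for t using g(3)[OF that] by simp
    qed
    ultimately have "(\<lambda>h. Fx (t, \<phi> t) * h + Fy (t, \<phi> t) * l h) = (\<lambda>h. 0)"
      by (rule has_derivative_unique)
    then have "Fx (t, \<phi> t) * h + Fy (t, \<phi> t) * l h = 0" for h by (rule fun_cong)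
    moreover have "Fy (t, \<phi> t) \<noteq> 0" using g(1,2)[OF t] by (simp add: U0_def)
    ultimately have "l h = (- Fx (t, \<phi> t) / Fy (t, \<phi> t)) * h" for h
      by (simp add: field_simps add_eq_0_iff)
    then have "l = (*) (- Fx (t, \<phi> t) / Fy (t, \<phi> t))" by (intro ext)
    then show ?thesis
      using d\<phi> unfolding field_differentiable_def has_field_derivative_def by blast
  qed
  then have "\<phi> holomorphic_on W"
    by (simp add: holomorphic_on_open \<open>open W\<close> field_differentiable_def)
  moreover have "(t, \<phi> t) \<in> U" if "t \<in> W" for t using g(1,2)[OF that] by (simp add: U0_def)
  ultimately show thesis using that[OF \<open>open W\<close> t1] g(3) by blast
qed

text \<open>The projection of \<open>C\<close> may ramify at the given point. By \<open>nearby_zeros\<close> there are points of \<open>C\<close> over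
all nearby parameters, and only finitely many points of \<open>C\<close> are ramified.\<close>

lemma local_branch:
  assumes F: "irreducible F" and nv: "\<And>x. map_poly (\<lambda>c. poly c x) F \<noteq> 0"
    and z: "poly2 F x0 y0 = 0" and U: "open U1" "open U2" "x0 \<in> U1" "y0 \<in> U2"
  obtains W \<phi> where "open W" "W \<noteq> {}" "W \<subseteq> U1" "\<phi> holomorphic_on W" "\<phi> ` W \<subseteq> U2"
    "\<And>t. t \<in> W \<Longrightarrow> poly2 F t (\<phi> t) = 0"
proof -
  have deg: "degree F > 0"
  proof (rule ccontr)
    assume "\<not> degree F > 0"
    then obtain f where f: "F = [:f:]" by (metis degree_eq_zeroE gr0I)
    then have "poly f x0 = 0" using z by simp
    then have "map_poly (\<lambda>c. poly c x0) F = 0" by (simp add: f map_poly_pCons)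
    then show False using nv by blast
  qed
  then have "pderiv F \<noteq> 0" by (simp add: pderiv_eq_0_iff)
  then have "\<not> F dvd pderiv F"
    using deg dvd_imp_degree_le[of F "pderiv F"] by (auto simp: degree_pderiv)
  then have fin: "finite {(x, y). poly2 F x y = 0 \<and> poly2 (pderiv F) x y = 0}"
    by (rule finite_common_zeros[OF F])
  obtain e where e: "e > 0" "ball y0 e \<subseteq> U2" using U open_contains_ball by blast
  obtain \<delta>1 where \<delta>1: "\<delta>1 > 0" "ball x0 \<delta>1 \<subseteq> U1" using U open_contains_ball by blast
  obtain \<delta>2 where \<delta>2: "\<delta>2 > 0" "\<And>x. x \<in> ball x0 \<delta>2 \<Longrightarrow> \<exists>y\<in>ball y0 e. poly2 F x y = 0"
    using nearby_zeros[OF nv z e(1)] by blast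
  have "infinite (ball x0 (min \<delta>1 \<delta>2))" 
    using \<delta>1(1) \<delta>2(1) uncountable_ball countable_finite by (metis min_less_iff_conj)
  then have "infinite (ball x0 (min \<delta>1 \<delta>2) - fst ` {(x, y). poly2 F x y = 0 \<and> poly2 (pderiv F) x y = 0})"
    using fin by (intro Diff_infinite_finite) auto
  then obtain t1 where t1: "t1 \<in> ball x0 (min \<delta>1 \<delta>2)"
      "t1 \<notin> fst ` {(x, y). poly2 F x y = 0 \<and> poly2 (pderiv F) x y = 0}"
    using infinite_imp_nonempty by blast
  then obtain s1 where s1: "s1 \<in> ball y0 e" "poly2 F t1 s1 = 0" using \<delta>2(2)[of t1] by auto
  then have "poly2 (pderiv F) t1 s1 \<noteq> 0" using t1(2) by force
  moreover have "(t1, s1) \<in> U1 \<times> U2" using t1(1) s1(1) \<delta>1 e by auto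
  ultimately obtain W \<phi> where W: "open W" "t1 \<in> W" "\<phi> holomorphic_on W"
      "\<And>t. t \<in> W \<Longrightarrow> (t, \<phi> t) \<in> U1 \<times> U2" "\<And>t. t \<in> W \<Longrightarrow> poly2 F t (\<phi> t) = 0"
    using implicit_function_poly2[OF s1(2), of "U1 \<times> U2"] U open_Times by metis
  show thesis using W by (intro that[of W \<phi>]) auto
qed

section \<open>Regular points of the solutions\<close>

lemma inv_chart_inject [simp]: "inv_chart w = inv_chart w' \<longleftrightarrow> w = w'"
  by (auto simp: inv_chart_def)

text \<open>The identity theorem for maps to \<open>\<complex>P\<^sup>1\<close>: the set of points near which \<open>J\<close> equals \<open>c\<close> is open, and
closed in \<open>U\<close> by analytic continuation in a chart.\<close>

lemma holomorphic_to_cp1_not_constant_on_open: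
  assumes J: "holomorphic_to_cp1 J U" "\<not> J constant_on U" and U: "open U" "connected U"
    and W: "open W" "W \<noteq> {}" "W \<subseteq> U"
  shows "\<not> J constant_on W"
proof
  assume "J constant_on W"
  then obtain c where c: "\<And>s. s \<in> W \<Longrightarrow> J s = c" by (auto simp: constant_on_def)
  define S where "S = \<Union>{V. open V \<and> V \<subseteq> U \<and> (\<forall>s\<in>V. J s = c)}"
  have S: "open S" "W \<subseteq> S" "S \<subseteq> U" "\<And>s. s \<in> S \<Longrightarrow> J s = c"
    unfolding S_def using W c by blast+
  have "\<exists>B. open B \<and> t \<in> B \<and> B \<inter> S = {}" if t: "t \<in> U - S" for t
  proof -
    obtain V g where V: "open V" "t \<in> V" "V \<subseteq> U" "g holomorphic_on V"
      and ch: "(\<forall>s\<in>V. J s = Fin (g s)) \<or> (\<forall>s\<in>V. J s = inv_chart (g s))"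
    proof -
      have "t \<in> U" using t by blast
      then show thesis using J(1) that unfolding holomorphic_to_cp1_def by meson
    qed
    have J_eq: "J s = J s' \<longleftrightarrow> g s = g s'" if "s \<in> V" "s' \<in> V" for s s'
      using ch that by auto
    obtain r where r: "r > 0" "ball t r \<subseteq> V" using V open_contains_ball by blast
    have "ball t r \<inter> S = {}"
    proof (rule ccontr)
      assume "ball t r \<inter> S \<noteq> {}"
      then obtain s where s: "s \<in> ball t r" "s \<in> S" by blast
      have "g z = g s" if "z \<in> ball t r" for z
      proof (rule analytic_continuation_open[of "ball t r \<inter> S" "ball t r" g "\<lambda>_. g s"])
        show "open (ball t r \<inter> S)" using S(1) by blast
        show "g holomorphic_on ball t r" using V(4) r(2) by (rule holomorphic_on_subset)
        show "g z = g s" if z: "z \<in> ball t r \<inter> S" for z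
        proof -
          have "z \<in> V" "s \<in> V" using z s r(2) by blast+
          moreover have "J z = J s" using z s S(4) by auto
          ultimately show ?thesis using J_eq by simp
        qed
      qed (use s that in auto)
      then have "J z = c" if z: "z \<in> ball t r" for z
      proof -
        have "z \<in> V" "s \<in> V" using z s r(2) by blast+
        moreover have "g z = g s" using \<open>\<And>z. z \<in> ball t r \<Longrightarrow> g z = g s\<close> z .
        ultimately show ?thesis using J_eq[of z s] S(4)[OF s(2)] by simp
      qed
      then have "ball t r \<subseteq> S" unfolding S_def using r(2) V(3) by blast
      then show False using t r(1) centre_in_ball by blast
    qed
    then show ?thesis using r(1) by (intro exI[of _ "ball t r"]) auto
  qed
  define N where "N = \<Union>{B. open B \<and> B \<inter> S = {}}"
  have "open N" "N \<inter> S = {}" unfolding N_def by auto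
  have cov: "U \<subseteq> S \<union> N"
    unfolding N_def using \<open>\<And>t. t \<in> U - S \<Longrightarrow> \<exists>B. open B \<and> t \<in> B \<and> B \<inter> S = {}\<close> by fast
  have "S \<inter> U = {} \<or> N \<inter> U = {}"
    by (rule connectedD[OF U(2) S(1) \<open>open N\<close> _ cov]) (use \<open>N \<inter> S = {}\<close> in auto)
  moreover have "S \<inter> U \<noteq> {}" using S(2) W(2,3) by blast
  ultimately have "U \<subseteq> S" using cov by blast
  then show False using S(4) J(2) unfolding constant_on_def by blast
qed

text \<open>Infinite values, ramification points and poles of \<open>R\<close> are exceptional: if they filled an open set,
\<open>J\<close> would be constant on it. Hence every open set contains a smaller one where the Schwarzian
equation holds without exceptions.\<close>

lemma regular_affine_domain:
  assumes J: "holomorphic_to_cp1 J U" and nc: "\<forall>W'. open W' \<and> W' \<noteq> {} \<and> W' \<subseteq> U \<longrightarrow> \<not> J constant_on W'"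
    and W: "open W" "W \<noteq> {}" "W \<subseteq> U"
  obtains W' where "open W'" "W' \<noteq> {}" "W' \<subseteq> W" "(affine_coord \<circ> J) holomorphic_on W'"
    "\<forall>t\<in>W'. J t \<noteq> Infty" "\<forall>t\<in>W'. deriv (affine_coord \<circ> J) t \<noteq> 0"
    "\<forall>t\<in>W'. \<not> ratfun_pole R ((affine_coord \<circ> J) t)"
proof -
  let ?y = "affine_coord \<circ> J"
  obtain t where t: "t \<in> W" using W by blast
  obtain V g where V: "open V" "t \<in> V" "V \<subseteq> U" "g holomorphic_on V"
    and ch: "(\<forall>s\<in>V. J s = Fin (g s)) \<or> (\<forall>s\<in>V. J s = inv_chart (g s))"
  proof -
    have "t \<in> U" using t W(3) by blast
    then show thesis using J that unfolding holomorphic_to_cp1_def by meson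
  qed
  have "\<exists>V1. open V1 \<and> V1 \<noteq> {} \<and> V1 \<subseteq> W \<and> ?y holomorphic_on V1 \<and> (\<forall>s\<in>V1. J s \<noteq> Infty)"
    using ch
  proof
    assume Fin: "\<forall>s\<in>V. J s = Fin (g s)"
    have "?y holomorphic_on V \<inter> W"
      by (rule holomorphic_transform[OF holomorphic_on_subset[OF V(4)]]) (use Fin in auto)
    then show ?thesis using V t W Fin by (intro exI[of _ "V \<inter> W"]) auto
  next
    assume Inv: "\<forall>s\<in>V. J s = inv_chart (g s)"
    define V1 where "V1 = {s \<in> V \<inter> W. g s \<noteq> 0}"
    have op: "open V1"
    proof -
      have "continuous_on (V \<inter> W) g"
        using V(4) holomorphic_on_imp_continuous_on continuous_on_subset by blast
      then have "open ((V \<inter> W) \<inter> g -` (- {0}))"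
        using V W by (intro continuous_open_preimage) auto
      moreover have "V1 = (V \<inter> W) \<inter> g -` (- {0})" by (auto simp: V1_def)
      ultimately show ?thesis by simp
    qed
    have ne: "V1 \<noteq> {}"
    proof
      assume "V1 = {}"
      then have "J s = Infty" if "s \<in> V \<inter> W" for s
        using Inv that by (auto simp: V1_def inv_chart_def)
      then have "J constant_on V \<inter> W" by (auto simp: constant_on_def)
      moreover have "open (V \<inter> W)" "V \<inter> W \<noteq> {}" "V \<inter> W \<subseteq> U" using V W t by blast+
      ultimately show False using nc by blast
    qed
    have "(\<lambda>s. 1 / g s) holomorphic_on V1"
      using V(4) by (intro holomorphic_intros holomorphic_on_subset[OF V(4)]) (auto simp: V1_def)
    then have "?y holomorphic_on V1"
      by (rule holomorphic_transform) (use Inv in \<open>auto simp: V1_def inv_chart_def\<close>)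
    then show ?thesis using op ne Inv by (intro exI[of _ V1]) (auto simp: V1_def inv_chart_def)
  qed
  then obtain V1 where V1: "open V1" "V1 \<noteq> {}" "V1 \<subseteq> W" "?y holomorphic_on V1" "\<And>s. s \<in> V1 \<Longrightarrow> J s \<noteq> Infty"
    by blast
  have ync: "\<not> ?y constant_on B" if B: "open B" "B \<noteq> {}" "B \<subseteq> V1" for B
  proof
    assume "?y constant_on B"
    then obtain c where c: "\<And>s. s \<in> B \<Longrightarrow> ?y s = c" by (auto simp: constant_on_def)
    have "J s = Fin c" if "s \<in> B" for s
      using c[OF that] V1(5)[of s] B(3) that by (cases "J s") auto
    then have "J constant_on B" by (auto simp: constant_on_def)
    moreover have "B \<subseteq> U" using B V1 W by blast
    ultimately show False using nc B by blast
  qed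
  have contd: "continuous_on V1 (deriv ?y)"
    using holomorphic_deriv[OF V1(4,1)] by (rule holomorphic_on_imp_continuous_on)
  have conty: "continuous_on V1 ?y" using V1(4) by (rule holomorphic_on_imp_continuous_on)
  define B1 where "B1 = V1 \<inter> deriv ?y -` (- {0})"
  have B1o: "open B1" unfolding B1_def using V1(1) contd by (intro continuous_open_preimage) auto
  obtain z r where zr: "r > 0" "z \<in> V1" "ball z r \<subseteq> V1" using V1 open_contains_ball by blast
  have B1ne: "B1 \<noteq> {}"
  proof
    assume emp: "B1 = {}"
    have "\<exists>c. \<forall>x\<in>ball z r. ?y x = c"
    proof (rule has_field_derivative_zero_constant)
      fix x assume x: "x \<in> ball z r"
      then have "x \<in> V1" using zr(3) by blast
      then have "deriv ?y x = 0" using emp unfolding B1_def by blast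
      then show "(?y has_field_derivative 0) (at x within ball z r)"
        using holomorphic_derivI[OF V1(4,1) \<open>x \<in> V1\<close>] has_field_derivative_at_within by metis
    qed auto
    then have "?y constant_on ball z r" by (auto simp: constant_on_def)
    then show False using ync[of "ball z r"] zr by auto
  qed
  define b where "b = snd (quot_of_fract R)"
  have b: "b \<noteq> 0" by (simp add: b_def)
  define W' where "W' = B1 \<inter> ?y -` (- {z. poly b z = 0})"
  have W'o: "open W'" unfolding W'_def
  proof (intro continuous_open_preimage B1o)
    show "continuous_on B1 ?y" using conty by (rule continuous_on_subset) (auto simp: B1_def)
    show "open (- {z. poly b z = 0})"
      using poly_roots_finite[OF b] finite_imp_closed open_Compl by blast
  qed
  have W'ne: "W' \<noteq> {}"
  proof
    assume emp: "W' = {}"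
    obtain z r where zr: "r > 0" "ball z r \<subseteq> B1" "z \<in> B1"
      using B1o B1ne open_contains_ball by blast
    have "?y ` ball z r \<subseteq> {z. poly b z = 0}" using emp zr(2) unfolding W'_def by blast
    then have "finite (?y ` ball z r)" using poly_roots_finite[OF b] finite_subset by blast
    moreover have "ball z r \<subseteq> V1" using zr(2) unfolding B1_def by blast
    ultimately have "?y constant_on ball z r"
      using continuous_finite_range_constant[of "ball z r" ?y] conty continuous_on_subset by (metis connected_ball)
    then show False using ync[of "ball z r"] zr \<open>ball z r \<subseteq> V1\<close> by auto
  qed
  show thesis
  proof (rule that[OF W'o W'ne])
    show "W' \<subseteq> W" using V1(3) by (auto simp: W'_def B1_def)
    show "?y holomorphic_on W'" by (rule holomorphic_on_subset[OF V1(4)]) (auto simp: W'_def B1_def)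
    show "\<forall>t\<in>W'. J t \<noteq> Infty" using V1(5) by (auto simp: W'_def B1_def)
    show "\<forall>t\<in>W'. deriv ?y t \<noteq> 0" by (auto simp: W'_def B1_def)
    show "\<forall>t\<in>W'. \<not> ratfun_pole R (?y t)" by (auto simp: W'_def ratfun_pole_def b_def)
  qed
qed

section \<open>Power series expansions of Schwarzian equations\<close>

definition fps_poly :: "complex fps \<Rightarrow> complex poly \<Rightarrow> complex fps" where
  "fps_poly Y p = poly (map_poly fps_const p) Y"

lemma fps_poly_simps [simp]: "fps_poly Y 0 = 0" "fps_poly Y (pCons a p) = fps_const a + Y * fps_poly Y p"
  by (simp_all add: fps_poly_def map_poly_pCons)

lemma fps_to_fls_fps_poly: "fps_to_fls (fps_poly Y p) = fls_poly (fps_to_fls Y) p"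
  by (induction p) (simp_all add: fls_times_fps_to_fls)

lemma fps_poly_nth_0: "fps_nth (fps_poly Y p) 0 = poly p (fps_nth Y 0)"
  by (induction p) auto

lemma fps_poly_compose:
  fixes U :: "complex fps"
  assumes "U $ 0 = 0"
  shows "fps_poly Y p oo U = fps_poly (Y oo U) p"
  by (induction p) (simp_all add: fps_compose_add_distrib fps_compose_mult_distrib[OF assms])

lemma has_fps_expansion_poly:
  assumes "f has_fps_expansion Y"
  shows "(\<lambda>h. poly p (f h)) has_fps_expansion fps_poly Y p"
  by (induction p) (auto intro!: has_fps_expansion_add has_fps_expansion_mult assms)

lemma has_fps_expansion_poly2:
  assumes "f has_fps_expansion V" "g has_fps_expansion Y"
  shows "(\<lambda>h. poly2 F (f h) (g h)) has_fps_expansion poly (map_poly (fps_poly V) F) Y"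
  by (induction F)
    (auto simp: map_poly_pCons intro!: has_fps_expansion_add has_fps_expansion_mult
      has_fps_expansion_poly assms)

lemma fps_to_fls_poly2:
  "fps_to_fls (poly (map_poly (fps_poly V) F) Y) = poly (map_poly (fls_poly (fps_to_fls V)) F) (fps_to_fls Y)"
  by (induction F) (auto simp: map_poly_pCons fls_times_fps_to_fls fps_to_fls_fps_poly)

lemma has_fps_expansion_deriv_shift:
  fixes Y :: "complex fps"
  assumes "(\<lambda>h. y (t + h)) has_fps_expansion Y"
  shows "(\<lambda>h. deriv y (t + h)) has_fps_expansion fps_deriv Y"
proof -
  have "deriv (\<lambda>h. y (t + h)) = (\<lambda>h. deriv y (t + h))"
  proof
    fix h
    show "deriv (\<lambda>h. y (t + h)) h = deriv y (t + h)"
      unfolding deriv_def using DERIV_shift[of y _ h t] by (simp add: add.commute)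
  qed
  then show ?thesis using has_fps_expansion_deriv[OF assms] by simp
qed

lemma expansion_eq_0:
  fixes N :: "complex fps"
  assumes "(\<lambda>h. f (t + h)) has_fps_expansion N" "open W" "t \<in> W" "\<And>s. s \<in> W \<Longrightarrow> f s = 0"
  shows "N = 0"
proof -
  have "open ((\<lambda>h. t + h) -` W)" using assms(2) by (intro open_vimage continuous_intros)
  then have "eventually (\<lambda>h. h \<in> (\<lambda>h. t + h) -` W) (nhds 0)"
    using assms(3) by (intro eventually_nhds_in_open) auto
  then have "eventually (\<lambda>h. f (t + h) = 0) (nhds 0)"
    by eventually_elim (use assms(4) in auto)
  then have "(\<lambda>h. f (t + h)) has_fps_expansion 0" by (simp only: has_fps_expansion_0_iff)
  with assms(1) show ?thesis by (rule fps_expansion_unique_complex)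
qed

lemma holomorphic_expansion:
  assumes "y holomorphic_on W" "open W" "t \<in> W"
  shows "(\<lambda>h. y (t + h)) has_fps_expansion fps_expansion y t"
  using assms by (intro analytic_at_imp_has_fps_expansion) (auto simp: analytic_at)

text \<open>The Schwarzian multiplied by the square of the derivative, which makes sense for power series
without division.\<close>

definition schwarz_num :: "complex fps \<Rightarrow> complex fps" where
  "schwarz_num Y = fps_deriv (fps_deriv (fps_deriv Y)) * fps_deriv Y - fps_const (3/2) * (fps_deriv (fps_deriv Y))\<^sup>2"

definition schwarz_num_fun :: "(complex \<Rightarrow> complex) \<Rightarrow> complex \<Rightarrow> complex" where
  "schwarz_num_fun y t = deriv (deriv (deriv y)) t * deriv y t - 3/2 * (deriv (deriv y) t)\<^sup>2"

lemma has_fps_expansion_schwarz_num: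
  assumes "(\<lambda>h. y (t + h)) has_fps_expansion Y"
  shows "(\<lambda>h. schwarz_num_fun y (t + h)) has_fps_expansion schwarz_num Y"
  unfolding schwarz_num_fun_def schwarz_num_def
  by (intro has_fps_expansion_diff has_fps_expansion_mult has_fps_expansion_power
      has_fps_expansion_const has_fps_expansion_deriv_shift assms)

lemma schwarzian_eq_num:
  assumes "y holomorphic_on W" "open W" "t \<in> W" "deriv y t \<noteq> 0"
  shows "schwarzian y t = schwarz_num_fun y t / (deriv y t)\<^sup>2"
proof -
  have 1: "(deriv y has_field_derivative deriv (deriv y) t) (at t)"
    and 2: "(deriv (deriv y) has_field_derivative deriv (deriv (deriv y)) t) (at t)"
    using assms by (auto intro!: holomorphic_derivI[of _ W] holomorphic_deriv)
  have quot: "deriv (\<lambda>s. deriv (deriv y) s / deriv y s) t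
      = (deriv (deriv (deriv y)) t * deriv y t - deriv (deriv y) t * deriv (deriv y) t) / (deriv y t * deriv y t)"
    by (rule DERIV_imp_deriv, rule DERIV_divide[OF 2 1 assms(4)])
  show ?thesis unfolding schwarzian_def quot schwarz_num_fun_def using assms(4)
    by (simp add: field_simps power2_eq_square)
qed

lemma schwarz_equation_fps:
  assumes y: "y holomorphic_on W" "open W" "t \<in> W"
    and eq: "\<And>s. s \<in> W \<Longrightarrow> deriv y s \<noteq> 0 \<and> poly b (y s) \<noteq> 0 \<and>
        schwarzian y s + (deriv y s)\<^sup>2 * (poly a (y s) / poly b (y s)) = 0"
    and Y: "(\<lambda>h. y (t + h)) has_fps_expansion Y"
  shows "schwarz_num Y * fps_poly Y b + (fps_deriv Y) ^ 4 * fps_poly Y a = 0"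
proof (rule expansion_eq_0[OF _ y(2,3)])
  let ?f = "\<lambda>s. schwarz_num_fun y s * poly b (y s) + (deriv y s) ^ 4 * poly a (y s)"
  show "(\<lambda>h. ?f (t + h)) has_fps_expansion schwarz_num Y * fps_poly Y b + (fps_deriv Y) ^ 4 * fps_poly Y a"
    by (intro has_fps_expansion_add has_fps_expansion_mult has_fps_expansion_power
        has_fps_expansion_schwarz_num has_fps_expansion_poly has_fps_expansion_deriv_shift Y)
  fix s assume s: "s \<in> W"
  define p where "p = deriv y s"
  define B where "B = poly b (y s)"
  have pB: "p \<noteq> 0" "B \<noteq> 0" using eq[OF s] by (auto simp: p_def B_def)
  have "schwarz_num_fun y s / p\<^sup>2 + p\<^sup>2 * (poly a (y s) / B) = 0"
    using eq[OF s] schwarzian_eq_num[OF y(1,2) s] by (simp add: p_def B_def)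
  then have "(schwarz_num_fun y s / p\<^sup>2 + p\<^sup>2 * (poly a (y s) / B)) * (p\<^sup>2 * B) = 0" by simp
  then show "?f s = 0" using pB
    by (simp add: p_def[symmetric] B_def[symmetric] field_simps power2_eq_square eval_nat_numeral)
qed

lemma fps_to_fls_deriv: "fps_to_fls (fps_deriv Y) = fls_deriv (fps_to_fls Y)"
  by (rule fls_deriv_fps_to_fls[symmetric])

lemma fls_schwarz_num:
  assumes "fps_deriv Y \<noteq> 0"
  shows "fls_deriv.schwarz (fps_to_fls Y) = fps_to_fls (schwarz_num Y) / (fps_to_fls (fps_deriv Y))\<^sup>2"
proof -
  have "fls_const (3/2) = (3/2 :: complex fls)"
  proof -
    have "(3 / 2 :: complex fls) = fls_const 3 / fls_const 2" by (simp only: fls_const_numeral)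
    also have "\<dots> = fls_const (3 / 2)" by (rule fls_const_divide_const)
    finally show ?thesis ..
  qed
  moreover have "fls_deriv (fps_to_fls Y) \<noteq> 0" using assms by (simp flip: fps_to_fls_deriv)
  ultimately show ?thesis
    by (simp add: fls_deriv.schwarz_def schwarz_num_def fls_times_fps_to_fls fps_to_fls_deriv
        power2_eq_square field_simps)
qed

lemma schwarz_equation_fls:
  fixes Y :: "complex fps"
  assumes Y: "fps_deriv Y $ 0 \<noteq> 0" and b: "poly (snd (quot_of_fract R)) (Y $ 0) \<noteq> 0"
    and eq: "schwarz_num Y * fps_poly Y (snd (quot_of_fract R))
        + (fps_deriv Y) ^ 4 * fps_poly Y (fst (quot_of_fract R)) = 0"
  shows "fls_deriv.schwarz (fps_to_fls Y) = - ((fls_deriv (fps_to_fls Y))\<^sup>2 * fls_ratfun R (fps_to_fls Y))"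
proof -
  let ?b = "snd (quot_of_fract R)" and ?a = "fst (quot_of_fract R)"
  have Y0: "fps_deriv Y \<noteq> 0" using Y by (metis fps_zero_nth)
  have B0: "fps_poly Y ?b \<noteq> 0" using b fps_poly_nth_0[of Y ?b] by auto
  define p where "p = fls_deriv (fps_to_fls Y)"
  define B where "B = fls_poly (fps_to_fls Y) ?b"
  define N where "N = fps_to_fls (schwarz_num Y)"
  have nz: "p \<noteq> 0" "B \<noteq> 0"
    using Y0 B0 by (auto simp: p_def B_def simp flip: fps_to_fls_deriv fps_to_fls_fps_poly)
  have "N * B + p ^ 4 * fls_poly (fps_to_fls Y) ?a = 0"
    using arg_cong[OF eq, of fps_to_fls]
    by (simp add: N_def B_def p_def fls_times_fps_to_fls fps_to_fls_fps_poly fps_to_fls_deriv fps_to_fls_power)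
  then have "N * B = - (p ^ 4 * fls_poly (fps_to_fls Y) ?a)" by (simp add: add_eq_0_iff2)
  then have "N / p\<^sup>2 = - (p\<^sup>2 * (fls_poly (fps_to_fls Y) ?a / B))"
    using nz by (simp add: field_simps eval_nat_numeral)
  moreover have "fls_deriv.schwarz (fps_to_fls Y) = N / p\<^sup>2"
    using fls_schwarz_num[OF Y0] by (simp add: N_def p_def fps_to_fls_deriv)
  ultimately show ?thesis by (simp add: p_def B_def fls_ratfun_def)
qed

text \<open>In the application \<open>W\<close> expands \<open>J\<^sub>2\<close> at the value of \<open>\<phi>\<close> at the base point, and \<open>P\<close> is the expansion
of \<open>\<phi>\<close> without its constant term, so that \<open>Z\<close> expands \<open>J\<^sub>2 \<circ> \<phi>\<close>. By the cocycle property, \<open>S(W \<circ> P) = P'\<^sup>2 (S(W) \<circ> P) + S(P)\<close>.\<close>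

lemma schwarz_equation_compose_fls:
  fixes W P Z :: "complex fps"
  assumes Wd: "fps_deriv W $ 0 \<noteq> 0" and b: "poly (snd (quot_of_fract R)) (W $ 0) \<noteq> 0"
    and eq: "schwarz_num W * fps_poly W (snd (quot_of_fract R))
        + (fps_deriv W) ^ 4 * fps_poly W (fst (quot_of_fract R)) = 0"
    and P: "P $ 0 = 0" "fps_deriv P \<noteq> 0" and Z: "Z = W oo P"
  shows "fls_deriv (fps_to_fls Z) \<noteq> 0"
    "fls_deriv.schwarz (fps_to_fls Z)
      = fls_deriv.schwarz (fps_to_fls P) - (fls_deriv (fps_to_fls Z))\<^sup>2 * fls_ratfun R (fps_to_fls Z)"
proof -
  let ?b = "snd (quot_of_fract R)" and ?a = "fst (quot_of_fract R)"
  define w1 where "w1 = fps_deriv W oo P"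
  define w2 where "w2 = fps_deriv (fps_deriv W) oo P"
  define w3 where "w3 = fps_deriv (fps_deriv (fps_deriv W)) oo P"
  define q where "q = fps_deriv P"
  have Z1: "fps_deriv Z = w1 * q" unfolding Z w1_def q_def by (rule fps_compose_deriv[OF P(1)])
  have w1': "fps_deriv w1 = w2 * q" and w2': "fps_deriv w2 = w3 * q"
    unfolding w1_def w2_def w3_def q_def by (rule fps_compose_deriv[OF P(1)])+
  have "w1 $ 0 \<noteq> 0" using Wd by (simp add: w1_def)
  then have w10: "w1 \<noteq> 0" by auto
  have q0: "q \<noteq> 0" using P by (simp add: q_def)
  have B0: "fps_poly Z ?b \<noteq> 0"
    using b fps_poly_nth_0[of Z ?b] by (auto simp: Z)
  have "(schwarz_num W * fps_poly W ?b + (fps_deriv W) ^ 4 * fps_poly W ?a) oo P = 0"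
    unfolding eq by simp
  then have E: "(w3 * w1 - fps_const (3/2) * w2\<^sup>2) * fps_poly Z ?b + w1 ^ 4 * fps_poly Z ?a = 0"
    unfolding schwarz_num_def
    by (simp add: fps_compose_add_distrib fps_compose_sub_distrib fps_compose_mult_distrib[OF P(1)]
        fps_compose_power[OF P(1)] fps_poly_compose[OF P(1)] w1_def w2_def w3_def Z)
  show Zd: "fls_deriv (fps_to_fls Z) \<noteq> 0"
    using w10 q0 by (simp add: Z1 flip: fps_to_fls_deriv)
  have num: "schwarz_num Z = (w3 * w1 - fps_const (3/2) * w2\<^sup>2) * q ^ 4 + w1\<^sup>2 * schwarz_num P"
  proof -
    have c: "fps_const (3/2) * 2 = (3 :: complex fps)" by (simp add: numeral_fps_const)
    have Z2: "fps_deriv (fps_deriv Z) = w2 * q\<^sup>2 + w1 * fps_deriv q"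
      by (simp add: Z1 w1' power2_eq_square algebra_simps)
    have Z3: "fps_deriv (fps_deriv (fps_deriv Z))
        = w3 * q ^ 3 + 3 * w2 * q * fps_deriv q + w1 * fps_deriv (fps_deriv q)"
      unfolding Z2 by (simp add: w1' w2' power2_eq_square power3_eq_cube algebra_simps)
    have "schwarz_num Z = (w3 * w1 - fps_const (3/2) * w2\<^sup>2) * q ^ 4
        + w1\<^sup>2 * (fps_deriv (fps_deriv q) * q - fps_const (3/2) * (fps_deriv q)\<^sup>2)
        + (3 - fps_const (3/2) * 2) * (w1 * w2 * q\<^sup>2 * fps_deriv q)"
      unfolding schwarz_num_def unfolding Z3 unfolding Z2 unfolding Z1
      by (simp add: power2_eq_square eval_nat_numeral algebra_simps)
    then show ?thesis unfolding c by (simp add: schwarz_num_def q_def)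
  qed
  define u where "u = fps_to_fls w1"
  define p where "p = fps_to_fls q"
  define B where "B = fls_poly (fps_to_fls Z) ?b"
  define A where "A = fls_poly (fps_to_fls Z) ?a"
  define N where "N = fps_to_fls (w3 * w1 - fps_const (3/2) * w2\<^sup>2)"
  have nz: "u \<noteq> 0" "p \<noteq> 0" "B \<noteq> 0"
    using w10 q0 B0 by (auto simp: u_def p_def B_def simp flip: fps_to_fls_fps_poly)
  have "N * B + u ^ 4 * A = 0"
    using arg_cong[OF E, of fps_to_fls] unfolding N_def A_def B_def u_def
    by (simp only: fps_to_fls_plus fls_times_fps_to_fls fps_to_fls_fps_poly fps_to_fls_power fps_zero_to_fls)
  then have NB: "N = - (u ^ 4 * (A / B))" using nz by (simp add: field_simps add_eq_0_iff2)
  have Zp: "fps_to_fls (fps_deriv Z) = u * p" by (simp add: Z1 u_def p_def fls_times_fps_to_fls)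
  have numf: "fps_to_fls (schwarz_num Z) = N * p ^ 4 + u\<^sup>2 * fps_to_fls (schwarz_num P)"
    unfolding num N_def u_def p_def by (simp only: fps_to_fls_plus fls_times_fps_to_fls fps_to_fls_power)
  have "fls_deriv.schwarz (fps_to_fls Z) = (N * p ^ 4 + u\<^sup>2 * fps_to_fls (schwarz_num P)) / (u * p)\<^sup>2"
  proof -
    have "fps_deriv Z \<noteq> 0" using w10 q0 unfolding Z1 by simp
    from fls_schwarz_num[OF this] show ?thesis unfolding Zp numf .
  qed
  also have "\<dots> = fps_to_fls (schwarz_num P) / p\<^sup>2 - (u * p)\<^sup>2 * (A / B)"
    unfolding NB using nz by (simp add: field_simps eval_nat_numeral)
  also have "fps_to_fls (schwarz_num P) / p\<^sup>2 = fls_deriv.schwarz (fps_to_fls P)"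
    using fls_schwarz_num[OF P(2)] by (simp add: p_def q_def)
  finally show "fls_deriv.schwarz (fps_to_fls Z)
      = fls_deriv.schwarz (fps_to_fls P) - (fls_deriv (fps_to_fls Z))\<^sup>2 * fls_ratfun R (fps_to_fls Z)"
    by (simp add: Zp[symmetric] fps_to_fls_deriv fls_ratfun_def A_def B_def)
qed

section \<open>Bi-algebraic curves\<close>

lemma fls_deriv_eq_0_imp_const:
  assumes "fls_deriv (x :: complex fls) = 0"
  obtains c where "x = fls_const c"
  using assms fls_deriv_eq_0_iff by blast

text \<open>With \<open>f = \<phi>''/\<phi>'\<close> the equation reads \<open>f' = f\<^sup>2/2\<close>. Either \<open>f = 0\<close> and \<open>\<phi>\<close> is affine, or \<open>g = 2/f\<close> has
derivative \<open>-1\<close>, so \<open>g = k - T\<close>; integrating \<open>g \<phi>'' = 2 \<phi>'\<close> twice shows that \<open>g \<phi>\<close> is affine in \<open>T\<close>.\<close>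

lemma homography_of_schwarz_eq_0:
  assumes T: "fls_deriv T = 1" and \<phi>: "fls_deriv \<phi> \<noteq> 0" "fls_deriv.schwarz \<phi> = 0"
  obtains a b c d :: complex where "a * d - b * c \<noteq> 0"
    "\<phi> * (fls_const d + T * fls_const c) = fls_const b + T * fls_const a"
proof -
  define p where "p = fls_deriv \<phi>"
  define f where "f = fls_deriv p / p"
  have p0: "p \<noteq> 0" using \<phi> by (simp add: p_def)
  have f': "fls_deriv f = 1/2 * f\<^sup>2"
    using fls_deriv.schwarz_conv_log_deriv[OF \<phi>(1)] \<phi>(2) by (simp add: f_def p_def)
  show thesis
  proof (cases "f = 0")
    case True
    then have "fls_deriv p = 0" using p0 by (simp add: f_def)
    then obtain a where a: "p = fls_const a" by (rule fls_deriv_eq_0_imp_const)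
    have "fls_deriv (\<phi> - T * fls_const a) = 0" using T a by (simp add: p_def)
    then obtain b where "\<phi> - T * fls_const a = fls_const b" by (rule fls_deriv_eq_0_imp_const)
    then have "\<phi> = fls_const b + T * fls_const a" by (simp add: algebra_simps)
    moreover have "a \<noteq> 0" using a p0 by auto
    ultimately show thesis using that[of a 1 b 0] by simp
  next
    case False
    define g where "g = 2 / f"
    have g': "fls_deriv g = - 1"
      using False by (simp add: g_def fls_deriv.d_divide f' power2_eq_square)
    have "fls_deriv (g + T) = 0" using g' T by simp
    then obtain k where k: "g + T = fls_const k" by (rule fls_deriv_eq_0_imp_const)
    have gp: "g * fls_deriv p = 2 * p" using False p0 by (simp add: g_def f_def)
    have "fls_deriv (g * p - \<phi>) = 0" using gp g' by (simp add: p_def)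
    then obtain m where m: "g * p - \<phi> = fls_const m" by (rule fls_deriv_eq_0_imp_const)
    have "fls_deriv (g * \<phi>) = g * p - \<phi>" using g' by (simp add: p_def)
    then have "fls_deriv (g * \<phi> - T * fls_const m) = 0" using m T by simp
    then obtain n where n: "g * \<phi> - T * fls_const m = fls_const n" by (rule fls_deriv_eq_0_imp_const)
    have gT: "g = fls_const k + T * fls_const (- 1)" using k by (simp add: eq_diff_eq fls_const_uminus[symmetric])
    have eq: "\<phi> * (fls_const k + T * fls_const (- 1)) = fls_const n + T * fls_const m"
      using n unfolding gT by (simp add: algebra_simps)
    have "m * k - n * (- 1) \<noteq> 0"
    proof
      assume "m * k - n * (- 1) = 0"
      then have "n = - m * k" by (simp add: add_eq_0_iff)
      then have "g * \<phi> = g * fls_const (- m)"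
        using eq unfolding gT by (simp add: algebra_simps)
      moreover have "g \<noteq> 0" using False by (simp add: g_def)
      ultimately have "\<phi> = fls_const (- m)" by (simp only: mult_cancel_left) simp
      then show False using \<phi>(1) by simp
    qed
    then show thesis using that eq by blast
  qed
qed

text \<open>The base point \<open>t0\<close> is generic in three ways: \<open>\<phi>\<close> is unramified there, both Schwarzian equations
hold without exceptions near the points concerned, and the Schwarzian of \<open>\<phi>\<close> is either nonzero at
\<open>t0\<close> or identically zero. The last condition provides its square root \<open>s\<close>.\<close>

lemma formal_bialgebraic_branch:
  assumes J1: "holomorphic_to_cp1 J1 U1" "schwarzian_solution R1 J1 U1 Y1" "\<not> J1 constant_on U1"
    and U1: "open U1" "connected U1"
    and J2: "holomorphic_to_cp1 J2 U2" "schwarzian_solution R2 J2 U2 Y2" "\<not> J2 constant_on U2"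
    and U2: "open U2" "connected U2"
    and W: "open W" "W \<noteq> {}" "W \<subseteq> U1" and \<phi>: "\<phi> holomorphic_on W" "\<phi> ` W \<subseteq> U2"
    and F: "\<And>t. t \<in> W \<Longrightarrow> poly2 F t (\<phi> t) = 0" and nh: "\<And>y. poly F [:y:] \<noteq> 0"
    and G: "\<And>t x y. t \<in> W \<Longrightarrow> J1 t = Fin x \<Longrightarrow> J2 (\<phi> t) = Fin y \<Longrightarrow> poly2 G x y = 0"
  obtains T \<Phi> Y Z s :: "complex fls" where
    "fls_deriv T = 1" "fls_deriv \<Phi> \<noteq> 0" "fls_deriv Y \<noteq> 0" "fls_deriv Z \<noteq> 0"
    "poly (map_poly (fls_poly T) F) \<Phi> = 0" "poly (map_poly (fls_poly Y) G) Z = 0"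
    "fls_deriv.schwarz Y = - ((fls_deriv Y)\<^sup>2 * fls_ratfun R1 Y)"
    "fls_deriv.schwarz Z = fls_deriv.schwarz \<Phi> - (fls_deriv Z)\<^sup>2 * fls_ratfun R2 Z"
    "s\<^sup>2 = fls_deriv.schwarz \<Phi>"
proof -
  let ?y1 = "affine_coord \<circ> J1" and ?y2 = "affine_coord \<circ> J2"
  have inf_ball: "infinite (ball z r)" if "r > 0" for z :: complex and r
    using that uncountable_ball countable_finite by blast
  have \<phi>nc: "\<not> \<phi> constant_on ball z r" if zr: "r > 0" "ball z r \<subseteq> W" for z r
  proof
    assume "\<phi> constant_on ball z r"
    then obtain c where c: "\<And>t. t \<in> ball z r \<Longrightarrow> \<phi> t = c" by (auto simp: constant_on_def)
    have "ball z r \<subseteq> {t. poly (poly F [:c:]) t = 0}"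
    proof
      fix t assume t: "t \<in> ball z r"
      then have "t \<in> W" using zr(2) by blast
      then show "t \<in> {t. poly (poly F [:c:]) t = 0}" using F[of t] c[OF t] by simp
    qed
    then show False using poly_roots_finite[OF nh] inf_ball[OF zr(1)] finite_subset by blast
  qed
  \<comment> \<open>shrink the domain until \<open>\<phi>\<close> is unramified\<close>
  define W0 where "W0 = W \<inter> deriv \<phi> -` (- {0})"
  have W0: "open W0" unfolding W0_def
    using holomorphic_on_imp_continuous_on[OF holomorphic_deriv[OF \<phi>(1) W(1)]] W(1)
    by (intro continuous_open_preimage) auto
  have W0ne: "W0 \<noteq> {}"
  proof
    assume emp: "W0 = {}"
    obtain z r where zr: "r > 0" "ball z r \<subseteq> W" using W open_contains_ball by blast
    have "\<exists>c. \<forall>x\<in>ball z r. \<phi> x = c"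
    proof (rule has_field_derivative_zero_constant)
      fix x assume "x \<in> ball z r"
      then have "x \<in> W" using zr by blast
      moreover from this have "deriv \<phi> x = 0" using emp unfolding W0_def by blast
      ultimately show "(\<phi> has_field_derivative 0) (at x within ball z r)"
        using holomorphic_derivI[OF \<phi>(1) W(1)] has_field_derivative_at_within by metis
    qed auto
    then show False using \<phi>nc[OF zr] by (auto simp: constant_on_def)
  qed
  have W0W: "W0 \<subseteq> W" by (auto simp: W0_def)
  have W0U1: "W0 \<subseteq> U1" using W0W W(3) by blast
  have nc1: "\<forall>V. open V \<and> V \<noteq> {} \<and> V \<subseteq> U1 \<longrightarrow> \<not> J1 constant_on V"
    using holomorphic_to_cp1_not_constant_on_open[OF J1(1,3) U1] by blast
  obtain W1 where W1: "open W1" "W1 \<noteq> {}" "W1 \<subseteq> W0" "?y1 holomorphic_on W1"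
      "\<forall>t\<in>W1. J1 t \<noteq> Infty" "\<forall>t\<in>W1. deriv ?y1 t \<noteq> 0"
      "\<forall>t\<in>W1. \<not> ratfun_pole R1 (?y1 t)"
    by (rule regular_affine_domain[OF J1(1) nc1 W0 W0ne W0U1, where R = R1]) blast
  obtain z r where zr: "r > 0" "ball z r \<subseteq> W1" using W1(1,2) open_contains_ball by blast
  have ballW: "ball z r \<subseteq> W" using zr(2) W1(3) W0W by blast
  have \<phi>B: "\<phi> holomorphic_on ball z r" using \<phi>(1) ballW by (rule holomorphic_on_subset)
  have op: "open (\<phi> ` ball z r)"
    by (rule open_mapping_thm[OF \<phi>B _ _ _ _ \<phi>nc[OF zr(1) ballW]]) auto
  have ne: "\<phi> ` ball z r \<noteq> {}" using zr(1) by simp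
  have sub: "\<phi> ` ball z r \<subseteq> U2" using \<phi>(2) ballW by blast
  have nc2: "\<forall>V. open V \<and> V \<noteq> {} \<and> V \<subseteq> U2 \<longrightarrow> \<not> J2 constant_on V"
    using holomorphic_to_cp1_not_constant_on_open[OF J2(1,3) U2] by blast
  obtain W2 where W2: "open W2" "W2 \<noteq> {}" "W2 \<subseteq> \<phi> ` ball z r" "?y2 holomorphic_on W2"
      "\<forall>t\<in>W2. J2 t \<noteq> Infty" "\<forall>t\<in>W2. deriv ?y2 t \<noteq> 0"
      "\<forall>t\<in>W2. \<not> ratfun_pole R2 (?y2 t)"
    by (rule regular_affine_domain[OF J2(1) nc2 op ne sub, where R = R2]) blast
  define W3 where "W3 = ball z r \<inter> \<phi> -` W2"
  have W3: "open W3" unfolding W3_def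
    using holomorphic_on_imp_continuous_on[OF \<phi>B] W2(1) by (intro continuous_open_preimage) auto
  have W3ne: "W3 \<noteq> {}" using W2(2,3) unfolding W3_def by blast
  have W3W1: "W3 \<subseteq> W1" and W3W: "W3 \<subseteq> W" and W3W2: "\<phi> ` W3 \<subseteq> W2"
    using zr(2) ballW unfolding W3_def by blast+
  \<comment> \<open>choose the base point such that the Schwarzian of \<open>\<phi>\<close> has a square root there\<close>
  obtain t0 where t0: "t0 \<in> W3" "schwarz_num_fun \<phi> t0 \<noteq> 0 \<or> (\<forall>t\<in>W3. schwarz_num_fun \<phi> t = 0)"
    using W3ne by blast
  have t0': "t0 \<in> W" "t0 \<in> W1" "\<phi> t0 \<in> W2" using t0(1) W3W W3W1 W3W2 by blast+
  define \<Phi> where "\<Phi> = fps_expansion \<phi> t0"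
  define P where "P = \<Phi> - fps_const (\<phi> t0)"
  define Y where "Y = fps_expansion ?y1 t0"
  define V where "V = fps_expansion ?y2 (\<phi> t0)"
  define Z where "Z = V oo P"
  define T where "T = fps_const t0 + fps_X"
  have eT: "(\<lambda>h. t0 + h) has_fps_expansion T"
    unfolding T_def by (intro has_fps_expansion_add has_fps_expansion_const has_fps_expansion_fps_X)
  have e\<Phi>: "(\<lambda>h. \<phi> (t0 + h)) has_fps_expansion \<Phi>"
    unfolding \<Phi>_def by (rule holomorphic_expansion[OF \<phi>(1) W(1) t0'(1)])
  have eY: "(\<lambda>h. ?y1 (t0 + h)) has_fps_expansion Y"
    unfolding Y_def by (rule holomorphic_expansion[OF W1(4,1) t0'(2)])
  have eV: "(\<lambda>h. ?y2 (\<phi> t0 + h)) has_fps_expansion V"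
    unfolding V_def by (rule holomorphic_expansion[OF W2(4,1) t0'(3)])
  have eP: "(\<lambda>h. \<phi> (t0 + h) - \<phi> t0) has_fps_expansion P"
    unfolding P_def by (intro has_fps_expansion_diff e\<Phi> has_fps_expansion_const)
  have P0: "fps_nth P 0 = 0" using has_fps_expansion_imp_0_eq_fps_nth_0[OF eP] by simp
  have eZ: "(\<lambda>h. ?y2 (\<phi> (t0 + h))) has_fps_expansion Z"
    using has_fps_expansion_compose[OF eV eP P0] by (simp add: Z_def o_def)
  have d\<Phi>: "fps_nth (fps_deriv \<Phi>) 0 \<noteq> 0"
  proof -
    have "deriv \<phi> t0 \<noteq> 0" using t0'(2) W1(3) unfolding W0_def by blast
    then show ?thesis
      using has_fps_expansion_imp_0_eq_fps_nth_0[OF has_fps_expansion_deriv_shift[OF e\<Phi>]] by simp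
  qed
  have dP: "fps_deriv P = fps_deriv \<Phi>" by (simp add: P_def)
  have dY: "fps_nth (fps_deriv Y) 0 \<noteq> 0"
    using has_fps_expansion_imp_0_eq_fps_nth_0[OF has_fps_expansion_deriv_shift[OF eY]] W1(6) t0'(2)
    by (metis add.right_neutral)
  have dV: "fps_nth (fps_deriv V) 0 \<noteq> 0"
    using has_fps_expansion_imp_0_eq_fps_nth_0[OF has_fps_expansion_deriv_shift[OF eV]] W2(6) t0'(3)
    by (metis add.right_neutral)
  have nz: "fps_deriv \<Phi> \<noteq> 0" "fps_deriv Y \<noteq> 0" using d\<Phi> dY by (metis fps_zero_nth)+
  have eq1: "schwarz_num Y * fps_poly Y (snd (quot_of_fract R1))
      + (fps_deriv Y) ^ 4 * fps_poly Y (fst (quot_of_fract R1)) = 0"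
  proof (rule schwarz_equation_fps[OF W1(4,1) t0'(2) _ eY])
    fix s assume s: "s \<in> W1"
    then have "s \<in> U1" using W1(3) W0U1 by blast
    then show "deriv ?y1 s \<noteq> 0 \<and> poly (snd (quot_of_fract R1)) (?y1 s) \<noteq> 0 \<and>
        schwarzian ?y1 s + (deriv ?y1 s)\<^sup>2 *
          (poly (fst (quot_of_fract R1)) (?y1 s) / poly (snd (quot_of_fract R1)) (?y1 s)) = 0"
      using J1(2) W1(5-7) s
      by (auto simp: schwarzian_solution_def Let_def ratfun_pole_def ratfun_eval_def)
  qed
  have eq2: "schwarz_num V * fps_poly V (snd (quot_of_fract R2))
      + (fps_deriv V) ^ 4 * fps_poly V (fst (quot_of_fract R2)) = 0"
  proof (rule schwarz_equation_fps[OF W2(4,1) t0'(3) _ eV])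
    fix s assume s: "s \<in> W2"
    then have "s \<in> U2" using W2(3) sub by blast
    then show "deriv ?y2 s \<noteq> 0 \<and> poly (snd (quot_of_fract R2)) (?y2 s) \<noteq> 0 \<and>
        schwarzian ?y2 s + (deriv ?y2 s)\<^sup>2 *
          (poly (fst (quot_of_fract R2)) (?y2 s) / poly (snd (quot_of_fract R2)) (?y2 s)) = 0"
      using J2(2) W2(5-7) s
      by (auto simp: schwarzian_solution_def Let_def ratfun_pole_def ratfun_eval_def)
  qed
  have bY: "poly (snd (quot_of_fract R1)) (fps_nth Y 0) \<noteq> 0"
    using W1(7) t0'(2) has_fps_expansion_imp_0_eq_fps_nth_0[OF eY]
    unfolding ratfun_pole_def by (metis add.right_neutral)
  have bV: "poly (snd (quot_of_fract R2)) (fps_nth V 0) \<noteq> 0"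
    using W2(7) t0'(3) has_fps_expansion_imp_0_eq_fps_nth_0[OF eV]
    unfolding ratfun_pole_def by (metis add.right_neutral)
  have dP0: "fps_deriv P \<noteq> 0" using nz dP by simp
  have schP: "fls_deriv.schwarz (fps_to_fls P) = fls_deriv.schwarz (fps_to_fls \<Phi>)"
    unfolding fls_deriv.schwarz_def by (simp add: fls_deriv_fps_to_fls dP)
  note Zeq = schwarz_equation_compose_fls[OF dV bV eq2 P0 dP0 Z_def, unfolded schP]
  have F0: "poly (map_poly (fls_poly (fps_to_fls T)) F) (fps_to_fls \<Phi>) = 0"
  proof -
    have "poly (map_poly (fps_poly T) F) \<Phi> = 0"
      by (rule expansion_eq_0[OF has_fps_expansion_poly2[OF eT e\<Phi>] W(1) t0'(1)]) (rule F)
    then show ?thesis by (simp flip: fps_to_fls_poly2)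
  qed
  have G0: "poly (map_poly (fls_poly (fps_to_fls Y)) G) (fps_to_fls Z) = 0"
  proof -
    have "poly (map_poly (fps_poly Y) G) Z = 0"
    proof (rule expansion_eq_0[OF has_fps_expansion_poly2[OF eY eZ] W3 t0(1)])
      fix s assume s: "s \<in> W3"
      then have s': "s \<in> W" "s \<in> W1" "\<phi> s \<in> W2" using W3W W3W1 W3W2 by blast+
      have "J1 s = Fin (?y1 s)" using W1(5) s'(2) by (cases "J1 s") auto
      moreover have "J2 (\<phi> s) = Fin (?y2 (\<phi> s))" using W2(5) s'(3) by (cases "J2 (\<phi> s)") auto
      ultimately show "poly2 G (?y1 s) (?y2 (\<phi> s)) = 0" using G s'(1) by blast
    qed
    then show ?thesis by (simp flip: fps_to_fls_poly2)
  qed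
  obtain s where s: "s\<^sup>2 = schwarz_num \<Phi>"
  proof (cases "schwarz_num_fun \<phi> t0 = 0")
    case True
    then have "\<forall>t\<in>W3. schwarz_num_fun \<phi> t = 0" using t0(2) by blast
    then have "schwarz_num \<Phi> = 0"
      using expansion_eq_0[OF has_fps_expansion_schwarz_num[OF e\<Phi>] W3 t0(1)] by blast
    then show thesis using that[of 0] by simp
  next
    case False
    then have "fps_nth (schwarz_num \<Phi>) 0 \<noteq> 0"
      using has_fps_expansion_imp_0_eq_fps_nth_0[OF has_fps_expansion_schwarz_num[OF e\<Phi>]] by simp
    from power_radical[OF this, of "\<lambda>_. csqrt" 1]
    have "(fps_radical (\<lambda>_. csqrt) 2 (schwarz_num \<Phi>))\<^sup>2 = schwarz_num \<Phi>"
      by (simp add: numeral_2_eq_2[symmetric])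
    then show thesis by (rule that)
  qed
  have sq: "(fps_to_fls s / fps_to_fls (fps_deriv \<Phi>))\<^sup>2 = fls_deriv.schwarz (fps_to_fls \<Phi>)"
    unfolding fls_schwarz_num[OF nz(1)] s[symmetric]
    by (simp add: power_divide fps_to_fls_power)
  show thesis
  proof (rule that[OF _ _ _ Zeq(1) F0 G0 schwarz_equation_fls[OF dY bY eq1] Zeq(2) sq])
    show "fls_deriv (fps_to_fls T) = 1" by (simp add: T_def fls_deriv_fps_to_fls)
    show "fls_deriv (fps_to_fls \<Phi>) \<noteq> 0" "fls_deriv (fps_to_fls Y) \<noteq> 0"
      using nz by (simp_all flip: fps_to_fls_deriv)
  qed
qed

text \<open>The bidegree \<open>(1, 1)\<close> forces the cofactor \<open>E\<close> to be a polynomial in \<open>x\<close> alone; a root of \<open>E\<close> would be a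
common root of \<open>ax + b\<close> and \<open>cx + d\<close>, so \<open>E\<close> has no zeros.\<close>

lemma graph_of_homography:
  assumes F: "irreducible F" and deg: "degree F > 0" and abcd: "a * d - b * c \<noteq> 0"
    and dvd: "F dvd [:- [:b, a:], [:d, c:]:]"
  shows "{(x, y). poly2 F x y = 0} = {(t1, t2). c * t1 + d \<noteq> 0 \<and> t2 = (a * t1 + b) / (c * t1 + d)}"
proof -
  let ?H = "[:- [:b, a:], [:d, c:]:]"
  obtain E where E: "?H = F * E" using dvd by blast
  have cd: "[:d, c:] \<noteq> 0" using abcd by auto
  have no_common: "\<not> (b + x * a = 0 \<and> d + x * c = 0)" for x
  proof
    assume "b + x * a = 0 \<and> d + x * c = 0"
    then have "b = - x * a" "d = - x * c" by (auto simp: add_eq_0_iff2 add.commute)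
    then show False using abcd by (simp add: algebra_simps)
  qed
  have "E \<noteq> 0" "F \<noteq> 0" using E cd by auto
  then have "degree F + degree E = degree ?H" using E by (simp add: degree_mult_eq)
  also have "degree ?H = 1" using cd by simp
  finally have "degree E = 0" using deg by simp
  then obtain e where e: "E = [:e:]" by (rule degree_eq_zeroE)
  have HE: "poly2 ?H x y = poly2 F x y * poly e x" for x y unfolding E e by simp
  have H: "poly2 ?H x y = y * (c * x + d) - (a * x + b)" for x y by (simp add: algebra_simps)
  have e0: "poly e x \<noteq> 0" for x
  proof
    assume "poly e x = 0"
    then have "y * (c * x + d) - (a * x + b) = 0" for y using HE[where x = x and y = y] H[where x = x and y = y] by simp
    from this[of 0] this[of 1] have "b + x * a = 0 \<and> d + x * c = 0" by (simp add: algebra_simps add_eq_0_iff)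
    then show False using no_common by blast
  qed
  have "poly2 F x y = 0 \<longleftrightarrow> y * (c * x + d) - (a * x + b) = 0" for x y
  proof -
    have "poly2 F x y * poly e x = y * (c * x + d) - (a * x + b)"
      using HE[where x = x and y = y] H[where x = x and y = y] by (rule trans[OF sym])
    then show ?thesis using e0[of x] by (metis mult_eq_0_iff)
  qed
  moreover have "y * (c * x + d) - (a * x + b) = 0 \<longleftrightarrow> c * x + d \<noteq> 0 \<and> y = (a * x + b) / (c * x + d)" for x y
  proof (cases "c * x + d = 0")
    case True
    then have "a * x + b \<noteq> 0" using no_common[of x] by (auto simp: algebra_simps)
    then show ?thesis unfolding True mult_zero_right diff_0 neg_equal_0_iff_equal by blast
  next
    case False
    then show ?thesis by (simp add: eq_divide_eq)
  qed
  ultimately show ?thesis by auto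
qed

lemma irreducible_same_zeros:
  assumes F: "irreducible F" and L: "\<not> is_unit L" "L dvd F"
  shows "poly2 F x y = 0 \<longleftrightarrow> poly2 L x y = 0"
proof -
  obtain S where S: "F = L * S" using L(2) by blast
  then have "is_unit S" using F L(1) irreducibleD by blast
  then obtain q where "S = [:q:]" "q dvd 1" using is_unit_poly_iff by blast
  moreover from this obtain c where "q = [:c:]" "c dvd 1" using is_unit_poly_iff by blast
  ultimately show ?thesis by (auto simp: S)
qed

theorem theorem5p6:
  fixes U1 U2 :: "complex set" and Y1 Y2 :: "cp1 set"
    and R1 R2 :: "complex poly fract"
    and J1 J2 :: "complex \<Rightarrow> cp1"
    and C :: "(complex \<times> complex) set"
  assumes "hyperbolic_genus_zero Y1" and "hyperbolic_genus_zero Y2"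
    and "open U1" and "connected U1" and "U1 \<noteq> {}"
    and "open U2" and "connected U2" and "U2 \<noteq> {}"
    and "schwarzian_solution R1 J1 U1 Y1" and "\<not> J1 constant_on U1"
    and "schwarzian_solution R2 J2 U2 Y2" and "\<not> J2 constant_on U2"
    and "riccati_hypothesis R1" and "riccati_hypothesis R2"
    and "bialgebraic_curve U1 U2 Y1 Y2 J1 J2 C"
    and "\<not> (\<exists>b. C = {b} \<times> UNIV)" and "\<not> (\<exists>b. C = UNIV \<times> {b})"
  shows "\<exists>a b c d :: complex. a * d - b * c \<noteq> 0 \<and>
           C = {(t1, t2). c * t1 + d \<noteq> 0 \<and> t2 = (a * t1 + b) / (c * t1 + d)}"
proof -
  let ?S = "subtopology zariski_cp1_cp1 (Y1 \<times> Y2)"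
  let ?I = "map_prod J1 J2 ` (C \<inter> U1 \<times> U2)"
  have C: "algebraic_curve zariski_plane C" and D: "algebraic_curve ?S (?S closure_of ?I)"
    using assms(15) by (auto simp: bialgebraic_curve_def Let_def)
  obtain F where F: "irreducible F" "C = {(x, y). poly2 F x y = 0}" using algebraic_curve_plane[OF C] .
  \<comment> \<open>if the equation vanished on a vertical or horizontal line, \<open>C\<close> would be that line\<close>
  have nv: "map_poly (\<lambda>c. poly c x) F \<noteq> 0" for x
  proof
    assume "map_poly (\<lambda>c. poly c x) F = 0"
    then have "poly (coeff F n) x = 0" for n by (metis coeff_0 coeff_map_poly poly_0)
    then have "[:[:- x, 1:]:] dvd F" by (simp add: const_poly_dvd_iff poly_eq_0_iff_dvd)
    then have "poly2 F u v = 0 \<longleftrightarrow> u = x" for u v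
      using irreducible_same_zeros[OF F(1), where L = "[:[:- x, 1:]:]" and x = u and y = v] by (auto simp: is_unit_poly_iff)
    then have "C = {x} \<times> UNIV" using F(2) by auto
    then show False using assms(16) by blast
  qed
  have nh: "poly F [:y:] \<noteq> 0" for y
  proof
    assume "poly F [:y:] = 0"
    then have "[:- [:y:], 1:] dvd F" by (simp only: poly_eq_0_iff_dvd)
    then have "poly2 F u v = 0 \<longleftrightarrow> v = y" for u v
      using irreducible_same_zeros[OF F(1), where L = "[:- [:y:], 1:]" and x = u and y = v] by (auto simp: is_unit_poly_iff)
    then have "C = UNIV \<times> {y}" using F(2) by auto
    then show False using assms(17) by blast
  qed
  have "?I \<subseteq> topspace ?S"
    using assms(9,11) by (auto simp: schwarzian_solution_def)
  then have ID: "?I \<subseteq> ?S closure_of ?I" by (rule closure_of_subset)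
  have "?S closure_of ?I \<noteq> {}" using D by (simp add: algebraic_curve_def irreducible_closed_def)
  then have "?I \<noteq> {}" by (metis closure_of_empty)
  then obtain x0 y0 where xy: "(x0, y0) \<in> C" "x0 \<in> U1" "y0 \<in> U2" by blast
  obtain G where G: "G \<noteq> 0" "\<And>x y. (Fin x, Fin y) \<in> ?S closure_of ?I \<Longrightarrow> poly2 G x y = 0"
    by (rule algebraic_curve_cp1[OF D assms(1,2)]) blast
  have "poly2 F x0 y0 = 0" using xy F(2) by auto
  then obtain W \<phi> where W: "open W" "W \<noteq> {}" "W \<subseteq> U1" "\<phi> holomorphic_on W" "\<phi> ` W \<subseteq> U2"
      "\<And>t. t \<in> W \<Longrightarrow> poly2 F t (\<phi> t) = 0"
    by (rule local_branch[OF F(1) nv _ assms(3,6) xy(2,3)]) blast+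
  have GW: "poly2 G x y = 0" if "t \<in> W" "J1 t = Fin x" "J2 (\<phi> t) = Fin y" for t x y
  proof -
    have "(t, \<phi> t) \<in> C \<inter> U1 \<times> U2" using W(3,5,6) that(1) F(2) by auto
    then have "map_prod J1 J2 (t, \<phi> t) \<in> ?S closure_of ?I" using ID by blast
    then show ?thesis using G(2) that by simp
  qed
  have hol: "holomorphic_to_cp1 J1 U1" "holomorphic_to_cp1 J2 U2"
    using assms(9,11) by (auto simp: schwarzian_solution_def)
  obtain T \<Phi> Y Z s :: "complex fls" where
    L: "fls_deriv T = 1" "fls_deriv \<Phi> \<noteq> 0" "fls_deriv Y \<noteq> 0" "fls_deriv Z \<noteq> 0"
    "poly (map_poly (fls_poly T) F) \<Phi> = 0" "poly (map_poly (fls_poly Y) G) Z = 0"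
    "fls_deriv.schwarz Y = - ((fls_deriv Y)\<^sup>2 * fls_ratfun R1 Y)"
    "fls_deriv.schwarz Z = fls_deriv.schwarz \<Phi> - (fls_deriv Z)\<^sup>2 * fls_ratfun R2 Z"
    "s\<^sup>2 = fls_deriv.schwarz \<Phi>"
    using formal_bialgebraic_branch[OF hol(1) assms(9,10,3,4) hol(2) assms(11,12,6,7) W nh GW] .
  have "fls_deriv T \<noteq> 0" using L(1) by simp
  then interpret T: differential_embedding "fls_poly T" "\<lambda>w. fls_deriv w / fls_deriv T"
    by (rule differential_embedding_fls_poly)
  interpret Y: differential_embedding "fls_poly Y" "\<lambda>w. fls_deriv w / fls_deriv Y"
    by (rule differential_embedding_fls_poly[OF L(3)])
  have F\<Phi>: "T.eval2 F \<Phi> = 0" using L(5) by (simp add: T.eval2_def)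
  have "F \<noteq> 0" using F(1) by auto
  then have "\<Phi> \<in> T.algebraics" using F\<Phi> unfolding T.algebraic_over_quotients_iff by blast
  moreover have "Z \<in> Y.algebraics"
    using L(6) G(1) unfolding Y.algebraic_over_quotients_iff Y.eval2_def by blast
  ultimately have "fls_deriv.schwarz \<Phi> = 0"
    by (rule schwarz_eq_0_of_bialgebraic[OF L(1,3,7,4,8) _ _ assms(13) L(9)])
  then obtain a b c d where abcd: "a * d - b * c \<noteq> 0"
      "\<Phi> * (fls_const d + T * fls_const c) = fls_const b + T * fls_const a"
    using homography_of_schwarz_eq_0[OF L(1,2)] by metis
  have "T.eval2 [:- [:b, a:], [:d, c:]:] \<Phi> = 0"
    using abcd(2) by (simp only: T.eval2_simps T.e_minus fls_poly_simps) simp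
  then have "F dvd [:- [:b, a:], [:d, c:]:]" by (rule T.irreducible_dvd_of_root[OF F(1) F\<Phi>])
  then show ?thesis
    using graph_of_homography[OF F(1) T.irreducible_degree_pos[OF F(1) F\<Phi>] abcd(1)] F(2) abcd(1)
    by blast
qed

end
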